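(* Let $A$ be a separable unital C$^*$-algebra such that $\widehat{A}_{\mathrm{fin}}\neq\emptyset$ and each point of $\widehat{A}_{\mathrm{fin}}$ is isolated in $\widehat{A}$. Let $\mathcal{H}$ be a separable infinite-dimensional Hilbert space. Then $\mathrm{WM}(A,\mathcal{H})$ is closed and nowhere dense in $\mathrm{Rep}(A,\mathcal{H})$.
   Context: A representation of a C$^*$-algebra $A$ is a $^*$-homomorphism from $A$ into the bounded operators $\mathcal{B}(\mathcal{H})$ on a Hilbert space $\mathcal{H}$. The spectrum $\widehat{A}$ is the set of unitary equivalence classes of irreducible representations of $A$ with its usual (hull-kernel/Fell) topology; $\widehat{A}_{\mathrm{fin}}\subseteq\widehat{A}$ is the set of (classes of) finite-dimensional irreducible representations. A point $\pi\in\widehat{A}$ is isolated in $\widehat A$ if $\{\pi\}$ is open in $\widehat{A}$. $\mathrm{Rep}(A,\mathcal{H})$ is the set of all unital representations of $A$ on $\mathcal{H}$, equipped with the point-strong operator topology (i.e. $\pi_i\to\pi$ iff $\pi_i(a)\to\pi(a)$ in the strong operator topology for every $a\in A$). A unital representation of $A$ is weakly mixing if it has no nonzero finite-dimensional subrepresentation, and $\mathrm{WM}(A,\mathcal{H})\subseteq\mathrm{Rep}(A,\mathcal{H})$ is the set of weakly mixing representations. *)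

theory Defs
  imports "HOL-Analysis.Analysis"
begin

section \<open>Complex vector spaces, C*-algebras, Hilbert spaces\<close>

class scaleC =
  fixes scaleC :: "complex \<Rightarrow> 'a \<Rightarrow> 'a"  (infixr \<open>*\<^sub>C\<close> 75)

class complex_vector = real_vector + scaleC +
  assumes scaleC_add_right: "c *\<^sub>C (x + y) = c *\<^sub>C x + c *\<^sub>C y"
    and scaleC_add_left: "(c + d) *\<^sub>C x = c *\<^sub>C x + d *\<^sub>C x"
    and scaleC_scaleC: "c *\<^sub>C d *\<^sub>C x = (c * d) *\<^sub>C x"
    and scaleC_of_real: "complex_of_real r *\<^sub>C x = r *\<^sub>R x"

class complex_normed_vector = complex_vector + real_normed_vector +
  assumes norm_scaleC: "norm (c *\<^sub>C x) = cmod c * norm x"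

text \<open>Since \<^class>\<open>real_normed_algebra_1\<close> has \<open>norm 1 = 1\<close>, the zero algebra is excluded;
  it has no irreducible representations.\<close>

class unital_cstar_algebra = complex_normed_vector + real_normed_algebra_1 + banach +
  fixes star :: "'a \<Rightarrow> 'a"
  assumes scaleC_mult_left: "(c *\<^sub>C a) * b = c *\<^sub>C (a * b)"
    and scaleC_mult_right: "a * (c *\<^sub>C b) = c *\<^sub>C (a * b)"
    and star_add: "star (a + b) = star a + star b"
    and star_scaleC: "star (c *\<^sub>C a) = cnj c *\<^sub>C star a"
    and star_mult: "star (a * b) = star b * star a"
    and star_star: "star (star a) = a"
    and cstar_identity: "norm (star a * a) = (norm a)\<^sup>2"

class complex_hilbert_space = complex_normed_vector + banach +
  fixes cinner :: "'a \<Rightarrow> 'a \<Rightarrow> complex"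
  assumes cinner_add_left: "cinner (x + y) z = cinner x z + cinner y z"
    and cinner_scaleC_left: "cinner (c *\<^sub>C x) y = c * cinner x y"
    and cinner_commute: "cinner x y = cnj (cinner y x)"
    and cinner_self: "cinner x x = complex_of_real ((norm x)\<^sup>2)"

global_interpretation complex_vector: vector_space
  "scaleC :: complex \<Rightarrow> 'a \<Rightarrow> 'a::complex_vector"
  defines csubspace_raw_def: csubspace = complex_vector.subspace
    and cspan_raw_def: cspan = complex_vector.span
proof
  fix x :: 'a
  show "1 *\<^sub>C x = x" using scaleC_of_real[of 1 x] by simp
qed (simp_all add: scaleC_add_right scaleC_add_left scaleC_scaleC)

definition cfinite_dim :: "'a::complex_vector set \<Rightarrow> bool" where
  "cfinite_dim V \<longleftrightarrow> (\<exists>B. finite B \<and> cspan B = V)"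


section \<open>The Hilbert spaces \<open>\<ell>\<^sup>2(I)\<close>\<close>

typedef 'i ell2 = "{f :: 'i \<Rightarrow> complex. (\<lambda>i. (cmod (f i))\<^sup>2) summable_on UNIV}"
  by (rule exI[of _ "\<lambda>_. 0"]) simp

setup_lifting type_definition_ell2

lemma ell2_iff_L2_set_bounded:
  fixes f :: "'i \<Rightarrow> complex"
  shows "(\<lambda>i. (cmod (f i))\<^sup>2) summable_on UNIV
    \<longleftrightarrow> (\<exists>B. \<forall>F. finite F \<longrightarrow> L2_set (\<lambda>i. cmod (f i)) F \<le> B)" (is "?S \<longleftrightarrow> ?B")
proof
  assume S: ?S
  have "L2_set (\<lambda>i. cmod (f i)) F \<le> sqrt (\<Sum>\<^sub>\<infinity>i. (cmod (f i))\<^sup>2)" if "finite F" for F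
    unfolding L2_set_def
    by (rule real_sqrt_le_mono, rule finite_sum_le_infsum[OF S]) (use that in auto)
  then show ?B by blast
next
  assume ?B
  then obtain B where B: "\<And>F. finite F \<Longrightarrow> L2_set (\<lambda>i. cmod (f i)) F \<le> B" by blast
  have "sum (\<lambda>i. (cmod (f i))\<^sup>2) F \<le> B\<^sup>2" if "finite F" for F
  proof -
    have "(L2_set (\<lambda>i. cmod (f i)) F)\<^sup>2 \<le> B\<^sup>2"
      by (rule power_mono[OF B[OF that]]) simp
    then show ?thesis by (simp add: L2_set_def sum_nonneg)
  qed
  then show ?S
    by (intro nonneg_bdd_above_summable_on bdd_aboveI[of _ "B\<^sup>2"]) auto
qed

lemma L2_set_cmod_add_le:
  "L2_set (\<lambda>i. cmod (f i + g i)) F \<le> L2_set (\<lambda>i. cmod (f i)) F + L2_set (\<lambda>i. cmod (g i)) F"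
proof -
  have "L2_set (\<lambda>i. cmod (f i + g i)) F \<le> L2_set (\<lambda>i. cmod (f i) + cmod (g i)) F"
    by (rule L2_set_mono) (auto intro: norm_triangle_ineq)
  also have "\<dots> \<le> L2_set (\<lambda>i. cmod (f i)) F + L2_set (\<lambda>i. cmod (g i)) F"
    by (rule L2_set_triangle_ineq)
  finally show ?thesis .
qed

lemma ell2_summable_add:
  fixes f g :: "'i \<Rightarrow> complex"
  assumes "(\<lambda>i. (cmod (f i))\<^sup>2) summable_on UNIV" "(\<lambda>i. (cmod (g i))\<^sup>2) summable_on UNIV"
  shows "(\<lambda>i. (cmod (f i + g i))\<^sup>2) summable_on UNIV"
proof -
  obtain B C where "\<And>F. finite F \<Longrightarrow> L2_set (\<lambda>i. cmod (f i)) F \<le> B"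
    and "\<And>F. finite F \<Longrightarrow> L2_set (\<lambda>i. cmod (g i)) F \<le> C"
    using assms unfolding ell2_iff_L2_set_bounded by blast
  then have "\<And>F. finite F \<Longrightarrow> L2_set (\<lambda>i. cmod (f i + g i)) F \<le> B + C"
    by (intro order_trans[OF L2_set_cmod_add_le] add_mono)
  then show ?thesis unfolding ell2_iff_L2_set_bounded by blast
qed

lemma ell2_summable_scale:
  fixes f :: "'i \<Rightarrow> complex"
  assumes "(\<lambda>i. (cmod (f i))\<^sup>2) summable_on UNIV"
  shows "(\<lambda>i. (cmod (c * f i))\<^sup>2) summable_on UNIV"
  using summable_on_cmult_right[OF assms, of "(cmod c)\<^sup>2"]
  by (simp add: norm_mult power_mult_distrib)

lemma ell2_summable_mult:
  fixes f g :: "'i \<Rightarrow> complex"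
  assumes "(\<lambda>i. (cmod (f i))\<^sup>2) summable_on UNIV" "(\<lambda>i. (cmod (g i))\<^sup>2) summable_on UNIV"
  shows "(\<lambda>i. f i * cnj (g i)) summable_on UNIV"
proof -
  have "(\<lambda>i. (cmod (f i))\<^sup>2 + (cmod (g i))\<^sup>2) summable_on UNIV"
    by (rule summable_on_add[OF assms])
  then have "(\<lambda>i. norm (f i * cnj (g i))) summable_on UNIV"
  proof (rule summable_on_comparison_test)
    fix i
    have "0 \<le> (cmod (f i) - cmod (g i))\<^sup>2" by simp
    then have "2 * (cmod (f i) * cmod (g i)) \<le> (cmod (f i))\<^sup>2 + (cmod (g i))\<^sup>2"
      by (simp add: power2_diff)
    moreover have "0 \<le> cmod (f i) * cmod (g i)" by simp
    ultimately show "norm (f i * cnj (g i)) \<le> (cmod (f i))\<^sup>2 + (cmod (g i))\<^sup>2"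
      unfolding norm_mult complex_mod_cnj by linarith
  qed auto
  then show ?thesis by (rule abs_summable_summable)
qed

instantiation ell2 :: (type) complex_vector
begin

lift_definition zero_ell2 :: "'a ell2" is "\<lambda>_. 0" by simp
lift_definition plus_ell2 :: "'a ell2 \<Rightarrow> 'a ell2 \<Rightarrow> 'a ell2" is "\<lambda>f g i. f i + g i"
  by (rule ell2_summable_add)
lift_definition uminus_ell2 :: "'a ell2 \<Rightarrow> 'a ell2" is "\<lambda>f i. - f i" by simp
lift_definition minus_ell2 :: "'a ell2 \<Rightarrow> 'a ell2 \<Rightarrow> 'a ell2" is "\<lambda>f g i. f i - g i"
  using ell2_summable_add[of _ "\<lambda>i. - _ i"] by simp
lift_definition scaleC_ell2 :: "complex \<Rightarrow> 'a ell2 \<Rightarrow> 'a ell2" is "\<lambda>c f i. c * f i"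
  by (rule ell2_summable_scale)
lift_definition scaleR_ell2 :: "real \<Rightarrow> 'a ell2 \<Rightarrow> 'a ell2" is "\<lambda>r f i. complex_of_real r * f i"
  by (rule ell2_summable_scale)
instance
proof
  fix x y z :: "'a ell2" and r s :: real and c d :: complex
  show "x + y + z = x + (y + z)" by transfer (simp add: add.assoc)
  show "x + y = y + x" by transfer (simp add: add.commute)
  show "0 + x = x" by transfer simp
  show "- x + x = 0" by transfer simp
  show "x - y = x + - y" by transfer simp
  show "r *\<^sub>R (x + y) = r *\<^sub>R x + r *\<^sub>R y" by transfer (simp add: distrib_left)
  show "(r + s) *\<^sub>R x = r *\<^sub>R x + s *\<^sub>R x" by transfer (simp add: distrib_right)
  show "r *\<^sub>R s *\<^sub>R x = (r * s) *\<^sub>R x" by transfer (simp add: mult.assoc)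
  show "1 *\<^sub>R x = x" by transfer simp
  show "c *\<^sub>C (x + y) = c *\<^sub>C x + c *\<^sub>C y" by transfer (simp add: distrib_left)
  show "(c + d) *\<^sub>C x = c *\<^sub>C x + d *\<^sub>C x" by transfer (simp add: distrib_right)
  show "c *\<^sub>C d *\<^sub>C x = (c * d) *\<^sub>C x" by transfer (simp add: mult.assoc)
  show "complex_of_real r *\<^sub>C x = r *\<^sub>R x" by transfer simp
qed

end

instantiation ell2 :: (type) complex_normed_vector
begin

lift_definition norm_ell2 :: "'a ell2 \<Rightarrow> real" is "\<lambda>f. sqrt (\<Sum>\<^sub>\<infinity>i. (cmod (f i))\<^sup>2)" .

definition dist_ell2 :: "'a ell2 \<Rightarrow> 'a ell2 \<Rightarrow> real" where "dist_ell2 x y = norm (x - y)"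
definition sgn_ell2 :: "'a ell2 \<Rightarrow> 'a ell2" where "sgn_ell2 x = x /\<^sub>R norm x"
definition uniformity_ell2 :: "('a ell2 \<times> 'a ell2) filter" where
  "uniformity_ell2 = (INF e\<in>{0<..}. principal {(x, y). dist x y < e})"
definition open_ell2 :: "'a ell2 set \<Rightarrow> bool" where
  "open_ell2 U \<longleftrightarrow> (\<forall>x\<in>U. \<forall>\<^sub>F (x', y) in uniformity. x' = x \<longrightarrow> y \<in> U)"

lemma L2_set_le_norm_ell2:
  "finite F \<Longrightarrow> L2_set (\<lambda>i. cmod (Rep_ell2 x i)) F \<le> norm x"
proof (transfer fixing: F)
  fix f :: "'a \<Rightarrow> complex"
  assume "finite F" "(\<lambda>i. (cmod (f i))\<^sup>2) summable_on UNIV"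
  then show "L2_set (\<lambda>i. cmod (f i)) F \<le> sqrt (\<Sum>\<^sub>\<infinity>i. (cmod (f i))\<^sup>2)"
    unfolding L2_set_def by (intro real_sqrt_le_mono finite_sum_le_infsum) auto
qed

lemma norm_ell2_nonneg: "0 \<le> norm (x :: 'a ell2)"
  using L2_set_le_norm_ell2[of "{}" x] by simp

lemma norm_ell2_le:
  fixes x :: "'a ell2"
  assumes "\<And>F. finite F \<Longrightarrow> L2_set (\<lambda>i. cmod (Rep_ell2 x i)) F \<le> B"
  shows "norm x \<le> B"
  using assms
proof (transfer fixing: B)
  fix f :: "'a \<Rightarrow> complex"
  assume S: "(\<lambda>i. (cmod (f i))\<^sup>2) summable_on UNIV"
    and B: "\<And>F. finite F \<Longrightarrow> L2_set (\<lambda>i. cmod (f i)) F \<le> B"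
  have "0 \<le> B" using B[of "{}"] by simp
  have "sum (\<lambda>i. (cmod (f i))\<^sup>2) F \<le> B\<^sup>2" if "finite F" for F
  proof -
    have "(L2_set (\<lambda>i. cmod (f i)) F)\<^sup>2 \<le> B\<^sup>2"
      by (rule power_mono[OF B[OF that]]) simp
    then show ?thesis by (simp add: L2_set_def sum_nonneg)
  qed
  then have "(\<Sum>\<^sub>\<infinity>i. (cmod (f i))\<^sup>2) \<le> B\<^sup>2"
    by (intro infsum_le_finite_sums[OF S]) auto
  then show "sqrt (\<Sum>\<^sub>\<infinity>i. (cmod (f i))\<^sup>2) \<le> B"
    using \<open>0 \<le> B\<close> real_le_lsqrt by blast
qed

lemma cmod_le_norm_ell2: "cmod (Rep_ell2 x i) \<le> norm x"
  using L2_set_le_norm_ell2[of "{i}" x] by simp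

lemma norm_scaleC_ell2: "norm (c *\<^sub>C x) = cmod c * norm (x :: 'a ell2)"
  by transfer
    (simp add: norm_mult power_mult_distrib infsum_cmult_right' real_sqrt_mult)

instance
proof
  fix x y z :: "'a ell2" and r s :: real and c d :: complex
  show "dist x y = norm (x - y)" by (rule dist_ell2_def)
  show "sgn x = x /\<^sub>R norm x" by (rule sgn_ell2_def)
  show "(uniformity :: ('a ell2 \<times> 'a ell2) filter)
      = (INF e\<in>{0<..}. principal {(x, y). dist x y < e})"
    by (rule uniformity_ell2_def)
  show "open U \<longleftrightarrow> (\<forall>x\<in>U. \<forall>\<^sub>F (x', y) in uniformity. x' = x \<longrightarrow> y \<in> U)"
    for U :: "'a ell2 set"
    by (rule open_ell2_def)
  show "norm x = 0 \<longleftrightarrow> x = 0"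
  proof
    assume "norm x = 0"
    then have "Rep_ell2 x i = 0" for i using cmod_le_norm_ell2[of x i] by simp
    then show "x = 0" by transfer auto
  next
    assume "x = 0"
    then show "norm x = 0" by transfer simp
  qed
  show "norm (x + y) \<le> norm x + norm y"
  proof (rule norm_ell2_le)
    fix F :: "'a set"
    assume F: "finite F"
    have "L2_set (\<lambda>i. cmod (Rep_ell2 (x + y) i)) F
        \<le> L2_set (\<lambda>i. cmod (Rep_ell2 x i)) F + L2_set (\<lambda>i. cmod (Rep_ell2 y i)) F"
      by (simp add: plus_ell2.rep_eq L2_set_cmod_add_le)
    also have "\<dots> \<le> norm x + norm y"
      by (intro add_mono L2_set_le_norm_ell2 F)
    finally show "L2_set (\<lambda>i. cmod (Rep_ell2 (x + y) i)) F \<le> norm x + norm y" .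
  qed
  show "norm (c *\<^sub>C x) = cmod c * norm x" by (rule norm_scaleC_ell2)
  show "norm (r *\<^sub>R x) = \<bar>r\<bar> * norm x"
    unfolding scaleC_of_real[symmetric] norm_scaleC_ell2 by simp
qed

end

instantiation ell2 :: (type) complex_hilbert_space
begin

lift_definition cinner_ell2 :: "'a ell2 \<Rightarrow> 'a ell2 \<Rightarrow> complex"
  is "\<lambda>f g. \<Sum>\<^sub>\<infinity>i. f i * cnj (g i)" .

instance
proof
  fix x y z :: "'a ell2" and c :: complex
  show "cinner (x + y) z = cinner x z + cinner y z"
    by transfer (simp add: distrib_right infsum_add ell2_summable_mult)
  show "cinner (c *\<^sub>C x) y = c * cinner x y"
    by transfer (simp add: mult.assoc infsum_cmult_right')
  show "cinner x y = cnj (cinner y x)"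
    by transfer (simp add: mult.commute flip: infsum_cnj)
  show "cinner x x = complex_of_real ((norm x)\<^sup>2)"
  proof transfer
    fix f :: "'a \<Rightarrow> complex"
    assume S: "(\<lambda>i. (cmod (f i))\<^sup>2) summable_on UNIV"
    have "(\<Sum>\<^sub>\<infinity>i. f i * cnj (f i)) = (\<Sum>\<^sub>\<infinity>i. complex_of_real ((cmod (f i))\<^sup>2))"
      by (simp only: complex_norm_square)
    also have "\<dots> = complex_of_real (\<Sum>\<^sub>\<infinity>i. (cmod (f i))\<^sup>2)"
      by (rule infsumI, rule has_sum_of_real, rule has_sum_infsum[OF S])
    also have "\<dots> = complex_of_real ((sqrt (\<Sum>\<^sub>\<infinity>i. (cmod (f i))\<^sup>2))\<^sup>2)"
      by (simp add: infsum_nonneg)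
    finally show "(\<Sum>\<^sub>\<infinity>i. f i * cnj (f i)) = complex_of_real ((sqrt (\<Sum>\<^sub>\<infinity>i. (cmod (f i))\<^sup>2))\<^sup>2)" .
  qed
next
  fix X :: "nat \<Rightarrow> 'a ell2"
  assume X: "Cauchy X"
  have comp: "cmod (Rep_ell2 (X m) i - Rep_ell2 (X n) i) \<le> norm (X m - X n)" for m n i
    using cmod_le_norm_ell2[of "X m - X n" i] by (simp add: minus_ell2.rep_eq)
  have "Cauchy (\<lambda>n. Rep_ell2 (X n) i)" for i
    unfolding Cauchy_iff
  proof (intro allI impI)
    fix e :: real assume "0 < e"
    then obtain M where "\<forall>m\<ge>M. \<forall>n\<ge>M. norm (X m - X n) < e"
      using X unfolding Cauchy_iff by blast
    then show "\<exists>M. \<forall>m\<ge>M. \<forall>n\<ge>M. norm (Rep_ell2 (X m) i - Rep_ell2 (X n) i) < e"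
      using comp by (meson le_less_trans)
  qed
  then have "\<exists>l. (\<lambda>n. Rep_ell2 (X n) i) \<longlonglongrightarrow> l" for i
    using Cauchy_convergent convergent_def by blast
  then obtain f where f: "\<And>i. (\<lambda>n. Rep_ell2 (X n) i) \<longlonglongrightarrow> f i" by metis
  have tail: "L2_set (\<lambda>i. cmod (f i - Rep_ell2 (X n) i)) F \<le> e"
    if F: "finite F" and e: "\<forall>m\<ge>M. norm (X m - X n) \<le> e" for F n e M
  proof (rule LIMSEQ_le_const2)
    show "(\<lambda>m. L2_set (\<lambda>i. cmod (Rep_ell2 (X m) i - Rep_ell2 (X n) i)) F)
        \<longlonglongrightarrow> L2_set (\<lambda>i. cmod (f i - Rep_ell2 (X n) i)) F"
      unfolding L2_set_def by (intro tendsto_intros f)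
    have "L2_set (\<lambda>i. cmod (Rep_ell2 (X m) i - Rep_ell2 (X n) i)) F \<le> e" if "m \<ge> M" for m
      using L2_set_le_norm_ell2[OF F, of "X m - X n"] e that
      by (simp add: minus_ell2.rep_eq) (meson order_trans)
    then show "\<exists>N. \<forall>m\<ge>N. L2_set (\<lambda>i. cmod (Rep_ell2 (X m) i - Rep_ell2 (X n) i)) F \<le> e"
      by blast
  qed
  have cauchy: "\<exists>M. \<forall>n\<ge>M. \<forall>m\<ge>M. norm (X m - X n) \<le> e" if "0 < e" for e
    using X that unfolding Cauchy_iff by (meson less_imp_le)
  obtain M where M: "\<forall>m\<ge>M. norm (X m - X M) \<le> 1" using cauchy[of 1] by auto
  have "(\<lambda>i. (cmod (f i - Rep_ell2 (X M) i))\<^sup>2) summable_on UNIV"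
    unfolding ell2_iff_L2_set_bounded using tail[OF _ M] by blast
  then have "(\<lambda>i. (cmod ((f i - Rep_ell2 (X M) i) + Rep_ell2 (X M) i))\<^sup>2) summable_on UNIV"
    by (rule ell2_summable_add) (use Rep_ell2[of "X M"] in simp)
  then have L: "Rep_ell2 (Abs_ell2 f) = f" by (intro Abs_ell2_inverse) simp
  have "X \<longlonglongrightarrow> Abs_ell2 f"
  proof (rule LIMSEQ_I)
    fix e :: real assume "0 < e"
    then obtain M where M: "\<forall>n\<ge>M. \<forall>m\<ge>M. norm (X m - X n) \<le> e / 2"
      using cauchy[of "e / 2"] by auto
    have "norm (X n - Abs_ell2 f) < e" if n: "n \<ge> M" for n
    proof -
      have "norm (Abs_ell2 f - X n) \<le> e / 2"
      proof (rule norm_ell2_le)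
        fix F :: "'a set" assume "finite F"
        then show "L2_set (\<lambda>i. cmod (Rep_ell2 (Abs_ell2 f - X n) i)) F \<le> e / 2"
          using tail[of F M n "e / 2"] M n by (simp add: minus_ell2.rep_eq L)
      qed
      then show ?thesis using \<open>0 < e\<close> by (simp add: norm_minus_commute)
    qed
    then show "\<exists>no. \<forall>n\<ge>no. norm (X n - Abs_ell2 f) < e" by blast
  qed
  then show "convergent X" by (rule convergentI)
qed

end


section \<open>Representations\<close>

definition bounded_clinear_on ::
  "'v::complex_normed_vector set \<Rightarrow> ('v \<Rightarrow> 'v) \<Rightarrow> bool" where
  "bounded_clinear_on K T \<longleftrightarrow>
    (\<forall>x\<in>K. T x \<in> K)
    \<and> (\<forall>x\<in>K. \<forall>y\<in>K. T (x + y) = T x + T y)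
    \<and> (\<forall>c. \<forall>x\<in>K. T (c *\<^sub>C x) = c *\<^sub>C T x)
    \<and> (\<exists>B. \<forall>x\<in>K. norm (T x) \<le> B * norm x)"

text \<open>\<open>representation_on K \<pi>\<close>: \<open>\<pi>\<close> is a (not necessarily unital) *-homomorphism into the bounded
  operators on the Hilbert space \<open>K\<close>, a closed subspace of the ambient Hilbert space. Only the
  values \<open>\<pi> a x\<close> with \<open>x \<in> K\<close> matter.\<close>

definition representation_on ::
  "'v::complex_hilbert_space set \<Rightarrow> ('a::unital_cstar_algebra \<Rightarrow> 'v \<Rightarrow> 'v) \<Rightarrow> bool" where
  "representation_on K \<pi> \<longleftrightarrow>
    closed K \<and> csubspace K
    \<and> (\<forall>a. bounded_clinear_on K (\<pi> a))
    \<and> (\<forall>a b. \<forall>x\<in>K. \<pi> (a + b) x = \<pi> a x + \<pi> b x)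
    \<and> (\<forall>c a. \<forall>x\<in>K. \<pi> (c *\<^sub>C a) x = c *\<^sub>C \<pi> a x)
    \<and> (\<forall>a b. \<forall>x\<in>K. \<pi> (a * b) x = \<pi> a (\<pi> b x))
    \<and> (\<forall>a. \<forall>x\<in>K. \<forall>y\<in>K. cinner (\<pi> a x) y = cinner x (\<pi> (star a) y))"

definition unital_representation_on ::
  "'v::complex_hilbert_space set \<Rightarrow> ('a::unital_cstar_algebra \<Rightarrow> 'v \<Rightarrow> 'v) \<Rightarrow> bool" where
  "unital_representation_on K \<pi> \<longleftrightarrow> representation_on K \<pi> \<and> (\<forall>x\<in>K. \<pi> 1 x = x)"

text \<open>The subrepresentations of \<open>\<pi>\<close> are its restrictions to closed invariant subspaces, which
  \<open>subrep_space K \<pi> M\<close> describes.\<close>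

definition subrep_space ::
  "'v::complex_hilbert_space set \<Rightarrow> ('a \<Rightarrow> 'v \<Rightarrow> 'v) \<Rightarrow> 'v set \<Rightarrow> bool" where
  "subrep_space K \<pi> M \<longleftrightarrow> M \<subseteq> K \<and> closed M \<and> csubspace M \<and> (\<forall>a. \<forall>x\<in>M. \<pi> a x \<in> M)"

text \<open>The usual convention that irreducible representations are nonzero rules out, besides
  \<open>K = {0}\<close>, the zero representation on a one-dimensional space.\<close>

definition irreducible_on ::
  "'v::complex_hilbert_space set \<Rightarrow> ('a::unital_cstar_algebra \<Rightarrow> 'v \<Rightarrow> 'v) \<Rightarrow> bool" where
  "irreducible_on K \<pi> \<longleftrightarrow>
    representation_on K \<pi>
    \<and> (\<exists>a. \<exists>x\<in>K. \<pi> a x \<noteq> 0)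
    \<and> (\<forall>M. subrep_space K \<pi> M \<longrightarrow> M = {0} \<or> M = K)"

definition weakly_mixing_on ::
  "'v::complex_hilbert_space set \<Rightarrow> ('a::unital_cstar_algebra \<Rightarrow> 'v \<Rightarrow> 'v) \<Rightarrow> bool" where
  "weakly_mixing_on K \<pi> \<longleftrightarrow>
    unital_representation_on K \<pi>
    \<and> (\<forall>M. subrep_space K \<pi> M \<and> cfinite_dim M \<longrightarrow> M = {0})"

definition unitarily_equivalent ::
  "'v::complex_hilbert_space set \<times> ('a \<Rightarrow> 'v \<Rightarrow> 'v)
    \<Rightarrow> 'w::complex_hilbert_space set \<times> ('a \<Rightarrow> 'w \<Rightarrow> 'w) \<Rightarrow> bool" where
  "unitarily_equivalent = (\<lambda>(K, \<pi>) (L, \<rho>). \<exists>U.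
    bij_betw U K L
    \<and> (\<forall>x\<in>K. \<forall>y\<in>K. U (x + y) = U x + U y)
    \<and> (\<forall>c. \<forall>x\<in>K. U (c *\<^sub>C x) = c *\<^sub>C U x)
    \<and> (\<forall>x\<in>K. \<forall>y\<in>K. cinner (U x) (U y) = cinner x y)
    \<and> (\<forall>a. \<forall>x\<in>K. U (\<pi> a x) = \<rho> a (U x)))"


section \<open>The spectrum\<close>

text \<open>Irreducible representations of \<open>A\<close> are cyclic, so the Hilbert space dimension is at most the
  cardinality of \<open>A\<close>. Hence every irreducible representation on any Hilbert space is unitarily
  equivalent to one on a closed subspace of \<open>\<ell>\<^sup>2(A)\<close>, and these suffice to form the set of
  equivalence classes.\<close>

type_synonym 'a rep = "'a ell2 set \<times> ('a \<Rightarrow> 'a ell2 \<Rightarrow> 'a ell2)"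

definition irreps :: "'a::unital_cstar_algebra rep set" where
  "irreps = {(K, \<pi>). irreducible_on K \<pi>}"

definition irrep_equiv :: "('a::unital_cstar_algebra rep \<times> 'a rep) set" where
  "irrep_equiv = {(r, s). r \<in> irreps \<and> s \<in> irreps \<and> unitarily_equivalent r s}"

definition spectrum :: "'a::unital_cstar_algebra rep set set" where
  "spectrum = irreps // irrep_equiv"

definition spectrum_fin :: "'a::unital_cstar_algebra rep set set" where
  "spectrum_fin = {c \<in> spectrum. \<exists>(K, \<pi>)\<in>c. cfinite_dim K}"

definition rep_kernel :: "'a::unital_cstar_algebra rep \<Rightarrow> 'a set" where
  "rep_kernel = (\<lambda>(K, \<pi>). {a. \<forall>x\<in>K. \<pi> a x = 0})"

text \<open>Unitarily equivalent representations have the same kernel (see \<open>class_kernel_eq\<close>), so the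
  intersection is over a single ideal.\<close>

definition class_kernel :: "'a::unital_cstar_algebra rep set \<Rightarrow> 'a set" where
  "class_kernel c = (\<Inter>r\<in>c. rep_kernel r)"

definition hull_kernel ::
  "'a::unital_cstar_algebra rep set set \<Rightarrow> 'a rep set set" where
  "hull_kernel S = {c \<in> spectrum. (\<Inter>d\<in>S. class_kernel d) \<subseteq> class_kernel c}"

text \<open>\<open>hull_kernel\<close> is the closure operator of the topology; \<open>openin_spectrum_topology\<close> shows that
  the sets on the right do form a topology.\<close>

definition spectrum_topology :: "'a::unital_cstar_algebra rep set topology" where
  "spectrum_topology =
    topology (\<lambda>U. U \<subseteq> spectrum \<and> hull_kernel (spectrum - U) = spectrum - U)"

lemma unitarily_equivalent_refl: "unitarily_equivalent r r"
  unfolding unitarily_equivalent_def by (cases r) (auto intro!: exI[of _ id])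

lemma unitarily_equivalent_sym:
  fixes r :: "'v::complex_hilbert_space set \<times> ('a::unital_cstar_algebra \<Rightarrow> 'v \<Rightarrow> 'v)"
    and s :: "'w::complex_hilbert_space set \<times> ('a \<Rightarrow> 'w \<Rightarrow> 'w)"
  assumes "unitarily_equivalent r s" and "representation_on (fst r) (snd r)"
  shows "unitarily_equivalent s r"
proof -
  obtain K \<pi> L \<rho> where rs: "r = (K, \<pi>)" "s = (L, \<rho>)" by (metis surj_pair)
  obtain U where U: "bij_betw U K L"
    and add: "\<And>x y. x \<in> K \<Longrightarrow> y \<in> K \<Longrightarrow> U (x + y) = U x + U y"
    and sc: "\<And>c x. x \<in> K \<Longrightarrow> U (c *\<^sub>C x) = c *\<^sub>C U x"
    and inn: "\<And>x y. x \<in> K \<Longrightarrow> y \<in> K \<Longrightarrow> cinner (U x) (U y) = cinner x y"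
    and int: "\<And>a x. x \<in> K \<Longrightarrow> U (\<pi> a x) = \<rho> a (U x)"
    using assms(1) unfolding unitarily_equivalent_def rs by auto
  have K: "csubspace K" "\<And>a x. x \<in> K \<Longrightarrow> \<pi> a x \<in> K"
    using assms(2) unfolding representation_on_def rs bounded_clinear_on_def by auto
  define V where "V = the_inv_into K U"
  have inj: "inj_on U K" using U by (simp add: bij_betw_def)
  have V: "bij_betw V L K" unfolding V_def by (rule bij_betw_the_inv_into[OF U])
  have VK: "V y \<in> K" and UV: "U (V y) = y" if "y \<in> L" for y
    using V that U by (auto simp: bij_betw_def V_def f_the_inv_into_f)
  have VU: "V (U x) = x" if "x \<in> K" for x
    using inj that by (simp add: V_def the_inv_into_f_f)
  have "V (x + y) = V x + V y" if "x \<in> L" "y \<in> L" for x y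
    using VU[of "V x + V y"] VK[OF that(1)] VK[OF that(2)] K(1) that
    by (simp add: add UV complex_vector.subspace_add)
  moreover have "V (c *\<^sub>C x) = c *\<^sub>C V x" if "x \<in> L" for c x
    using VU[of "c *\<^sub>C V x"] VK[OF that] K(1) that
    by (simp add: sc UV complex_vector.subspace_scale)
  moreover have "cinner (V x) (V y) = cinner x y" if "x \<in> L" "y \<in> L" for x y
    using inn[OF VK[OF that(1)] VK[OF that(2)]] that by (simp add: UV)
  moreover have "V (\<rho> a x) = \<pi> a (V x)" if "x \<in> L" for a x
    using VU[OF K(2)[OF VK[OF that], of a]] that VK[OF that] by (simp add: int UV)
  ultimately show ?thesis unfolding unitarily_equivalent_def rs using V by auto
qed

lemma unitarily_equivalent_trans:
  assumes "unitarily_equivalent r s" and "unitarily_equivalent s t"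
  shows "unitarily_equivalent r t"
proof -
  obtain K \<pi> L \<rho> M \<sigma> where rst: "r = (K, \<pi>)" "s = (L, \<rho>)" "t = (M, \<sigma>)" by (metis surj_pair)
  obtain U where U: "bij_betw U K L"
    and 1: "\<forall>x\<in>K. \<forall>y\<in>K. U (x + y) = U x + U y" "\<forall>c. \<forall>x\<in>K. U (c *\<^sub>C x) = c *\<^sub>C U x"
      "\<forall>x\<in>K. \<forall>y\<in>K. cinner (U x) (U y) = cinner x y" "\<forall>a. \<forall>x\<in>K. U (\<pi> a x) = \<rho> a (U x)"
    using assms(1) unfolding unitarily_equivalent_def rst by auto
  obtain V where V: "bij_betw V L M"
    and 2: "\<forall>x\<in>L. \<forall>y\<in>L. V (x + y) = V x + V y" "\<forall>c. \<forall>x\<in>L. V (c *\<^sub>C x) = c *\<^sub>C V x"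
      "\<forall>x\<in>L. \<forall>y\<in>L. cinner (V x) (V y) = cinner x y" "\<forall>a. \<forall>x\<in>L. V (\<rho> a x) = \<sigma> a (V x)"
    using assms(2) unfolding unitarily_equivalent_def rst by auto
  have UL: "U x \<in> L" if "x \<in> K" for x using U that by (auto simp: bij_betw_def)
  have "bij_betw (V \<circ> U) K M" using U V by (rule bij_betw_trans)
  then show ?thesis unfolding unitarily_equivalent_def rst
    using 1 2 UL by (auto intro!: exI[of _ "V \<circ> U"])
qed

lemma equiv_irrep_equiv: "equiv irreps irrep_equiv"
proof (rule equivI)
  show "irrep_equiv \<subseteq> irreps \<times> (irreps :: 'a rep set)"
    by (auto simp: irrep_equiv_def)
  show "refl_on irreps (irrep_equiv :: ('a rep \<times> 'a rep) set)"
    by (auto simp: refl_on_def irrep_equiv_def unitarily_equivalent_refl)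
  show "sym (irrep_equiv :: ('a rep \<times> 'a rep) set)"
    by (auto simp: sym_def irrep_equiv_def irreps_def irreducible_on_def
        intro: unitarily_equivalent_sym)
  show "trans (irrep_equiv :: ('a rep \<times> 'a rep) set)"
    by (auto simp: trans_def irrep_equiv_def intro: unitarily_equivalent_trans)
qed

lemma rep_kernel_subset:
  assumes "(r, s) \<in> irrep_equiv"
  shows "rep_kernel r \<subseteq> rep_kernel s"
proof -
  obtain K \<pi> L \<rho> where rs: "r = (K, \<pi>)" "s = (L, \<rho>)" by (metis surj_pair)
  obtain U where U: "bij_betw U K L" and int: "\<And>a x. x \<in> K \<Longrightarrow> U (\<pi> a x) = \<rho> a (U x)"
    and add: "\<And>x y. x \<in> K \<Longrightarrow> y \<in> K \<Longrightarrow> U (x + y) = U x + U y"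
    using assms unfolding irrep_equiv_def unitarily_equivalent_def rs by auto
  have "csubspace K"
    using assms by (auto simp: irrep_equiv_def irreps_def irreducible_on_def
        representation_on_def rs)
  then have "0 \<in> K" by (rule complex_vector.subspace_0)
  then have U0: "U 0 = 0" using add[of 0 0] by simp
  show ?thesis
  proof
    fix a assume "a \<in> rep_kernel r"
    then have a: "\<And>x. x \<in> K \<Longrightarrow> \<pi> a x = 0" by (auto simp: rep_kernel_def rs)
    have "\<rho> a (U x) = 0" if "x \<in> K" for x using int[OF that, of a] a[OF that] U0 by simp
    then show "a \<in> rep_kernel s" using U by (auto simp: rep_kernel_def rs bij_betw_def)
  qed
qed

lemma class_kernel_eq:
  assumes "c \<in> spectrum" and "r \<in> c"
  shows "class_kernel c = rep_kernel r"
proof -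
  have "rep_kernel s = rep_kernel r" if "s \<in> c" for s
  proof -
    have "(r, s) \<in> irrep_equiv" "(s, r) \<in> irrep_equiv"
      using in_quotient_imp_in_rel[OF equiv_irrep_equiv, of c] assms that
      by (simp_all add: spectrum_def)
    then show ?thesis by (intro subset_antisym rep_kernel_subset)
  qed
  then show ?thesis unfolding class_kernel_def using assms(2) by blast
qed

lemma spectrumE:
  assumes "c \<in> spectrum"
  obtains K \<pi> where "(K, \<pi>) \<in> c" "irreducible_on K \<pi>" "class_kernel c = {a. \<forall>x\<in>K. \<pi> a x = 0}"
proof -
  obtain r where r: "r \<in> irreps" "c = irrep_equiv `` {r}"
    using assms unfolding spectrum_def by (auto elim: quotientE)
  have "r \<in> c" unfolding r(2) using r(1) equiv_class_self[OF equiv_irrep_equiv] by blast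
  obtain K \<pi> where K: "r = (K, \<pi>)" by (cases r)
  show ?thesis
  proof (rule that[of K \<pi>])
    show "(K, \<pi>) \<in> c" using \<open>r \<in> c\<close> K by simp
    show "irreducible_on K \<pi>" using r(1) K by (simp add: irreps_def)
    show "class_kernel c = {a. \<forall>x\<in>K. \<pi> a x = 0}"
      using class_kernel_eq[OF assms \<open>r \<in> c\<close>] K by (simp add: rep_kernel_def)
  qed
qed

lemma irreducible_onD:
  assumes "irreducible_on K \<pi>"
  shows "closed K" "csubspace K"
    and "\<And>a x. x \<in> K \<Longrightarrow> \<pi> a x \<in> K"
    and "\<And>a x y. x \<in> K \<Longrightarrow> y \<in> K \<Longrightarrow> \<pi> a (x + y) = \<pi> a x + \<pi> a y"
    and "\<And>a c x. x \<in> K \<Longrightarrow> \<pi> a (c *\<^sub>C x) = c *\<^sub>C \<pi> a x"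
    and "\<And>a. \<exists>B. \<forall>x\<in>K. norm (\<pi> a x) \<le> B * norm x"
    and "\<And>a b x. x \<in> K \<Longrightarrow> \<pi> (a * b) x = \<pi> a (\<pi> b x)"
    and "\<And>M. subrep_space K \<pi> M \<Longrightarrow> M = {0} \<or> M = K"
    and "\<exists>a. \<exists>x\<in>K. \<pi> a x \<noteq> 0"
    and "\<And>a. \<pi> a 0 = 0"
proof -
  have R: "representation_on K \<pi>" using assms by (simp add: irreducible_on_def)
  then have B: "bounded_clinear_on K (\<pi> a)" for a by (simp add: representation_on_def)
  show "closed K" and K: "csubspace K" using R by (simp_all add: representation_on_def)
  show "\<pi> a x \<in> K" if "x \<in> K" for a x
    using B[of a] that by (simp add: bounded_clinear_on_def)
  show add: "\<pi> a (x + y) = \<pi> a x + \<pi> a y" if "x \<in> K" "y \<in> K" for a x y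
    using B[of a] that by (simp add: bounded_clinear_on_def)
  show "\<pi> a (c *\<^sub>C x) = c *\<^sub>C \<pi> a x" if "x \<in> K" for a c x
    using B[of a] that by (simp add: bounded_clinear_on_def)
  show "\<exists>B. \<forall>x\<in>K. norm (\<pi> a x) \<le> B * norm x" for a
    using B[of a] by (simp add: bounded_clinear_on_def)
  show "\<pi> (a * b) x = \<pi> a (\<pi> b x)" if "x \<in> K" for a b x
    using R that by (simp add: representation_on_def)
  show "M = {0} \<or> M = K" if "subrep_space K \<pi> M" for M
    using assms that by (simp add: irreducible_on_def)
  show "\<exists>a. \<exists>x\<in>K. \<pi> a x \<noteq> 0" using assms by (simp add: irreducible_on_def)
  show "\<pi> a 0 = 0" for a
    using add[of 0 0 a] complex_vector.subspace_0[OF K] by simp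
qed

lemma class_kernel_ideal:
  fixes c :: "'a::unital_cstar_algebra rep set"
  assumes "c \<in> spectrum" and "a \<in> class_kernel c"
  shows "a * b \<in> class_kernel c" and "b * a \<in> class_kernel c"
proof -
  obtain K \<pi> where KK: "(K, \<pi>) \<in> c" "irreducible_on K \<pi>"
    "class_kernel c = {a. \<forall>x\<in>K. \<pi> a x = 0}"
    by (rule spectrumE[OF assms(1)])
  note irreducible = irreducible_onD[OF KK(2)]
  show "a * b \<in> class_kernel c" and "b * a \<in> class_kernel c"
    using assms(2) unfolding KK(3) by (simp_all add: irreducible)
qed

lemma class_kernel_prime:
  fixes c :: "'a::unital_cstar_algebra rep set"
  assumes c: "c \<in> spectrum"
    and I: "\<And>a b. a \<in> I \<Longrightarrow> b * a \<in> I"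
    and J: "\<And>a b. a \<in> J \<Longrightarrow> a * b \<in> J"
    and IJ: "I \<inter> J \<subseteq> class_kernel c"
  shows "I \<subseteq> class_kernel c \<or> J \<subseteq> class_kernel c"
proof (rule disjCI)
  assume nJ: "\<not> J \<subseteq> class_kernel c"
  obtain K \<pi> where KK: "(K, \<pi>) \<in> c" "irreducible_on K \<pi>"
    "class_kernel c = {a. \<forall>x\<in>K. \<pi> a x = 0}"
    by (rule spectrumE[OF c])
  note irreducible = irreducible_onD[OF KK(2)]
  note cl = irreducible(1) and sub = irreducible(2) and inK = irreducible(3)
    and add = irreducible(4) and sc = irreducible(5) and bdd = irreducible(6)
    and mult = irreducible(7) and irr = irreducible(8) and z = irreducible(10)
  define N where "N = {y \<in> K. \<forall>b\<in>J. \<pi> b y = 0}"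
  have "closed N"
  proof -
    have "y \<in> N" if Y: "\<And>n. Y n \<in> N" and lim: "Y \<longlonglongrightarrow> y" for Y y
    proof -
      have YK: "\<And>n. Y n \<in> K" using Y by (auto simp: N_def)
      have yK: "y \<in> K" using closed_sequentially[OF cl YK lim] .
      have "\<pi> b y = 0" if b: "b \<in> J" for b
      proof -
        obtain B where B: "\<forall>x\<in>K. norm (\<pi> b x) \<le> B * norm x" using bdd by blast
        have bound: "norm (\<pi> b y) \<le> B * norm (y - Y n)" for n
        proof -
          have "(-1) *\<^sub>C Y n = - Y n"
            using scaleC_of_real[of "-1" "Y n"] by simp
          then have "- Y n \<in> K" and "\<pi> b (- Y n) = - \<pi> b (Y n)"
            using complex_vector.subspace_scale[OF sub YK, of "-1" n] sc[OF YK, of b "-1" n]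
              scaleC_of_real[of "-1" "\<pi> b (Y n)"] by simp_all
          then have "\<pi> b (y - Y n) = \<pi> b y" and "y - Y n \<in> K"
            using add[OF yK, of "- Y n" b] complex_vector.subspace_add[OF sub yK, of "- Y n"] Y b
            by (simp_all add: N_def)
          then show ?thesis using B by metis
        qed
        have "(\<lambda>n. B * norm (y - Y n)) \<longlonglongrightarrow> B * norm (y - y)"
          by (intro tendsto_intros lim)
        then have "norm (\<pi> b y) \<le> B * norm (y - y)"
          by (rule LIMSEQ_le_const) (use bound in auto)
        then show ?thesis by simp
      qed
      then show ?thesis using yK by (simp add: N_def)
    qed
    then show ?thesis unfolding closed_sequential_limits by blast
  qed
  moreover have "csubspace N"
    unfolding N_def
    by (rule complex_vector.subspaceI)
      (use sub in \<open>auto simp: z add sc complex_vector.subspace_0 complex_vector.subspace_add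
          complex_vector.subspace_scale\<close>)
  moreover have "\<pi> a y \<in> N" if "y \<in> N" for a y
    using that J inK mult[symmetric] by (auto simp: N_def)
  moreover have "N \<subseteq> K" by (auto simp: N_def)
  ultimately have "N = {0} \<or> N = K" by (intro irr) (auto simp: subrep_space_def)
  moreover have "N \<noteq> K" using nJ unfolding KK(3) N_def by auto
  ultimately have N0: "N = {0}" by blast
  show "I \<subseteq> class_kernel c"
  proof
    fix a assume a: "a \<in> I"
    have "\<pi> a x \<in> N" if x: "x \<in> K" for x
    proof -
      have "b * a \<in> I \<inter> J" if "b \<in> J" for b using a that I J by blast
      then have "\<pi> (b * a) x = 0" if "b \<in> J" for b using that IJ KK(3) x by blast
      then show ?thesis using x inK by (simp add: N_def mult)
    qed
    then show "a \<in> class_kernel c" unfolding KK(3) using N0 by auto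
  qed
qed

lemma subset_hull_kernel: "S \<subseteq> spectrum \<Longrightarrow> S \<subseteq> hull_kernel S"
  by (auto simp: hull_kernel_def)

lemma hull_kernel_mono: "S \<subseteq> T \<Longrightarrow> hull_kernel S \<subseteq> hull_kernel T"
  unfolding hull_kernel_def by blast

lemma hull_kernel_empty: "hull_kernel {} = ({} :: 'a::unital_cstar_algebra rep set set)"
proof -
  have "\<exists>a. a \<notin> class_kernel c" if c: "c \<in> spectrum" for c :: "'a rep set"
  proof -
    obtain K \<pi> where "(K, \<pi>) \<in> c" "irreducible_on K \<pi>"
      "class_kernel c = {a. \<forall>x\<in>K. \<pi> a x = 0}"
      by (rule spectrumE[OF c])
    then show ?thesis using irreducible_onD(9)[of K \<pi>] by auto
  qed
  then show ?thesis unfolding hull_kernel_def by auto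
qed

lemma hull_kernel_Un:
  assumes S: "S \<subseteq> spectrum" and T: "T \<subseteq> spectrum"
  shows "hull_kernel (S \<union> T) = hull_kernel S \<union> hull_kernel T"
proof
  show "hull_kernel S \<union> hull_kernel T \<subseteq> hull_kernel (S \<union> T)"
    by (simp add: hull_kernel_mono)
  show "hull_kernel (S \<union> T) \<subseteq> hull_kernel S \<union> hull_kernel T"
  proof
    fix c assume "c \<in> hull_kernel (S \<union> T)"
    then have c: "c \<in> spectrum"
      and "(\<Inter>d\<in>S. class_kernel d) \<inter> (\<Inter>d\<in>T. class_kernel d) \<subseteq> class_kernel c"
      unfolding hull_kernel_def by auto
    then have "(\<Inter>d\<in>S. class_kernel d) \<subseteq> class_kernel c \<or> (\<Inter>d\<in>T. class_kernel d) \<subseteq> class_kernel c"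
      by (intro class_kernel_prime[OF c])
        (use S T in \<open>auto intro: class_kernel_ideal\<close>)
    then show "c \<in> hull_kernel S \<union> hull_kernel T" using c by (auto simp: hull_kernel_def)
  qed
qed

lemma openin_spectrum_topology:
  fixes U :: "'a::unital_cstar_algebra rep set set"
  shows "openin spectrum_topology U \<longleftrightarrow> U \<subseteq> spectrum \<and> hull_kernel (spectrum - U) = spectrum - U"
proof -
  let ?P = "\<lambda>U :: 'a rep set set. U \<subseteq> spectrum \<and> hull_kernel (spectrum - U) = spectrum - U"
  have "?P (U \<inter> V)" if "?P U" "?P V" for U V
    using that hull_kernel_Un[of "spectrum - U" "spectrum - V"] by (auto simp: Diff_Int)
  moreover have "?P (\<Union>\<U>)" if \<U>: "\<forall>U\<in>\<U>. ?P U" for \<U>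
  proof
    show "\<Union>\<U> \<subseteq> spectrum" using \<U> by blast
    have "hull_kernel (spectrum - \<Union>\<U>) \<subseteq> spectrum - U" if "U \<in> \<U>" for U
      using hull_kernel_mono[of "spectrum - \<Union>\<U>" "spectrum - U"] \<U> that by blast
    moreover have "hull_kernel (spectrum - \<Union>\<U>) \<subseteq> spectrum" by (auto simp: hull_kernel_def)
    ultimately have "hull_kernel (spectrum - \<Union>\<U>) \<subseteq> spectrum - \<Union>\<U>" by blast
    then show "hull_kernel (spectrum - \<Union>\<U>) = spectrum - \<Union>\<U>"
      using subset_hull_kernel[of "spectrum - \<Union>\<U>"] by blast
  qed
  ultimately have "istopology ?P" unfolding istopology_def by blast
  then show ?thesis unfolding spectrum_topology_def by (simp add: topology_inverse')
qed

lemma topspace_spectrum_topology: "topspace spectrum_topology = spectrum"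
proof -
  have "openin spectrum_topology spectrum"
    by (simp add: openin_spectrum_topology hull_kernel_empty)
  then show ?thesis
    by (metis openin_subset openin_topspace openin_spectrum_topology subset_antisym)
qed


section \<open>Spaces of representations\<close>

text \<open>Members of \<^typ>\<open>'h \<Rightarrow>\<^sub>L 'h\<close> are only real-linear; complex linearity is part of
  \<^const>\<open>representation_on\<close>. The point-strong operator topology is the product topology, over
  the points of the algebra, of the strong operator topology.\<close>

definition Rep :: "('a::unital_cstar_algebra \<Rightarrow> 'h::complex_hilbert_space \<Rightarrow>\<^sub>L 'h) set" where
  "Rep = {\<pi>. unital_representation_on UNIV (\<lambda>a. blinfun_apply (\<pi> a))}"

definition WM :: "('a::unital_cstar_algebra \<Rightarrow> 'h::complex_hilbert_space \<Rightarrow>\<^sub>L 'h) set" where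
  "WM = {\<pi> \<in> Rep. weakly_mixing_on UNIV (\<lambda>a. blinfun_apply (\<pi> a))}"

definition Rep_topology ::
  "('a::unital_cstar_algebra \<Rightarrow> 'h::complex_hilbert_space \<Rightarrow>\<^sub>L 'h) topology" where
  "Rep_topology = subtopology (product_topology (\<lambda>_. strong_operator_topology) UNIV) Rep"

definition nowhere_dense_in :: "'a topology \<Rightarrow> 'a set \<Rightarrow> bool" where
  "nowhere_dense_in X S \<longleftrightarrow> S \<subseteq> topspace X \<and> X interior_of (X closure_of S) = {}"

end

theory Submission
  imports Defs "HOL-Computational_Algebra.Formal_Power_Series"
begin

text \<open>That the set is closed follows from the existence of enough irreducible representations; that its
  interior is empty, from an explicit perturbation.

  \<^bold>\<open>Irreducible representations.\<close> A unital representation \<open>\<pi>\<close> of a separable algebra that is non-zero at \<open>b\<close> dominates an irreducible representation that is non-zero at \<open>b\<close>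
  and vanishes wherever \<open>\<pi>\<close> does (\<open>separating_spectrum\<close>). For its proof let \<open>p a\<close> be the supremum
  of the real part of the numerical range of \<open>\<pi> a\<close>. A Zorn argument yields an extreme point \<open>\<phi>\<close>
  of the set of linear functionals below \<open>p\<close> with \<open>\<phi> (star b * b) = p (star b * b) > 0\<close>
  (\<open>extreme_functional\<close>). It is the real part of a positive functional, whose GNS representation can
  be built inside \<open>\<ell>\<^sup>2(A)\<close> since \<open>A\<close> is separable; an invariant subspace would split \<open>\<phi>\<close> into
  functionals that are again below \<open>p\<close>, so extremality makes the representation irreducible.

  \<^bold>\<open>Closedness.\<close> Let \<open>\<pi>\<close> have a non-zero finite-dimensional subrepresentation on \<open>M\<close>. It dominates
  some irreducible class \<open>c\<close>, which is finite-dimensional because \<open>A\<close> modulo the kernel of \<open>\<pi>\<close> on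
  \<open>M\<close> is. As \<open>c\<close> is isolated, the intersection \<open>J\<close> of the kernels of all other classes is not
  contained in the kernel of \<open>c\<close>, whereas \<open>J\<close> meets the kernel of \<open>c\<close> only in elements that every
  class, hence every representation, annihilates. So some \<open>a \<in> J\<close> and some \<open>x\<close> satisfy
  \<open>\<pi> a x \<noteq> 0\<close>, which is an open condition; and if a representation \<open>\<rho>\<close> satisfies it, then
  \<open>\<rho>(J) x\<close> is invariant, non-zero, and finite-dimensional as an image of \<open>J\<close> modulo the kernel of
  \<open>c\<close>. Thus \<open>\<rho>\<close> is not weakly mixing.

  \<^bold>\<open>Empty interior.\<close> A basic neighbourhood of \<open>\<pi>\<close> only restricts finitely many vectors
  \<open>\<pi> a x\<close>. Choose an orthonormal sequence orthogonal to all vectors \<open>x\<close> and \<open>\<pi> a x\<close> involved, and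
  an isometry \<open>V\<close> that shifts the sequence by the dimension \<open>n\<close> of some finite-dimensional
  irreducible \<open>\<sigma>\<close> and fixes its orthogonal complement. Conjugating \<open>\<pi>\<close> by \<open>V\<close> and placing \<open>\<sigma>\<close> on the
  \<open>n\<close> vectors thus freed gives a representation that agrees with \<open>\<pi>\<close> on the given data and is not
  weakly mixing (\<open>insert_finite_dim_subrep\<close>).\<close>

section \<open>Semi-inner products and Hilbert space\<close>

text \<open>Degenerate forms are admitted because the GNS form \<open>f (star b * a)\<close> of a positive functional
  is one; the inner product of a Hilbert space is the other instance.\<close>

locale semi_inner =
  fixes g :: "'v::complex_vector \<Rightarrow> 'v \<Rightarrow> complex"
  assumes add_left: "g (x + y) z = g x z + g y z"
    and scale_left: "g (c *\<^sub>C x) y = c * g x y"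
    and commute: "g x y = cnj (g y x)"
    and nonneg: "0 \<le> Re (g x x)"
begin

abbreviation q :: "'v \<Rightarrow> real" where "q x \<equiv> Re (g x x)"

lemma add_right: "g x (y + z) = g x y + g x z"
  using commute[of x "y + z"] commute[of x y] commute[of x z] by (simp add: add_left)

lemma scale_right: "g x (c *\<^sub>C y) = cnj c * g x y"
  using commute[of x "c *\<^sub>C y"] commute[of x y] by (simp add: scale_left)

lemma zero_left [simp]: "g 0 x = 0" and zero_right [simp]: "g x 0 = 0"
  using scale_left[of 0 0 x] scale_right[of x 0 0] by simp_all

lemma minus_left: "g (- x) y = - g x y" and minus_right: "g x (- y) = - g x y"
  using scale_left[of "-1" x y] scale_right[of x "-1" y] by simp_all

lemma diff_left: "g (x - y) z = g x z - g y z" and diff_right: "g x (y - z) = g x y - g x z"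
  using add_left[of x "- y" z] add_right[of x y "- z"] by (simp_all add: minus_left minus_right)

lemma sum_left: "g (\<Sum>i\<in>I. f i) y = (\<Sum>i\<in>I. g (f i) y)"
  by (induction I rule: infinite_finite_induct) (simp_all add: add_left)

lemma sum_right: "g x (\<Sum>i\<in>I. f i) = (\<Sum>i\<in>I. g x (f i))"
  by (induction I rule: infinite_finite_induct) (simp_all add: add_right)

lemma self_eq: "g x x = complex_of_real (q x)"
  using commute[of x x] by (simp add: complex_eq_iff)

lemma Im_self [simp]: "Im (g x x) = 0"
  by (subst self_eq) simp

lemma q_diff_scale: "q (x - c *\<^sub>C y) = q x - 2 * Re (cnj c * g x y) + (cmod c)\<^sup>2 * q y"
proof -
  have "Re (c * g y x) = Re (cnj c * g x y)"
    using commute[of y x] by simp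
  moreover have "g (x - c *\<^sub>C y) (x - c *\<^sub>C y) = g x x - cnj c * g x y - c * g y x + (c * cnj c) * g y y"
    by (simp add: diff_left diff_right scale_left scale_right algebra_simps)
  moreover have "Re ((c * cnj c) * g y y) = (cmod c)\<^sup>2 * q y"
    by (simp only: complex_norm_square[symmetric] times_complex.sel Re_complex_of_real
        Im_complex_of_real mult_zero_left diff_0_right)
  ultimately show ?thesis by simp
qed

lemma Cauchy_Schwarz: "(cmod (g x y))\<^sup>2 \<le> q x * q y"
proof -
  have quad: "2 * t * (cmod (g x y))\<^sup>2 \<le> q x + t\<^sup>2 * (cmod (g x y))\<^sup>2 * q y" for t :: real
  proof -
    let ?c = "complex_of_real t * g x y"
    have "Re (cnj ?c * g x y) = t * (cmod (g x y))\<^sup>2"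
      by (simp add: cmod_power2) (simp add: power2_eq_square algebra_simps)
    then show ?thesis
      using nonneg[of "x - ?c *\<^sub>C y"] unfolding q_diff_scale by (simp add: norm_mult power_mult_distrib)
  qed
  show ?thesis
  proof (cases "q y = 0")
    case True
    \<comment> \<open>The bound is then affine in \<open>t\<close>, so a large \<open>t\<close> violates it unless \<open>g x y = 0\<close>.\<close>
    have "(cmod (g x y))\<^sup>2 \<le> 0"
    proof (rule ccontr)
      assume "\<not> ?thesis"
      then have pos: "(cmod (g x y))\<^sup>2 > 0" by simp
      have "2 * ((q x + 1) / (cmod (g x y))\<^sup>2) * (cmod (g x y))\<^sup>2 \<le> q x"
        using quad[of "(q x + 1) / (cmod (g x y))\<^sup>2"] True by simp
      then have "2 * (q x + 1) \<le> q x" using pos by simp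
      then have "q x + 2 \<le> 0" by (simp add: distrib_left)
      then show False using nonneg[of x] by simp
    qed
    then show ?thesis using True by simp
  next
    case False
    then have "q y > 0" using nonneg[of y] by linarith
    then show ?thesis using quad[of "1 / q y"] by (simp add: field_simps power2_eq_square)
  qed
qed

lemma null_right: "q y = 0 \<Longrightarrow> g x y = 0"
  using Cauchy_Schwarz[of x y] by simp

text \<open>Gram-Schmidt applied to a dependent sequence, or for a degenerate form, produces vectors of
  length zero. Keeping them lets the system be indexed by all natural numbers, and they contribute
  nothing to Bessel sums.\<close>

definition orthonormal_or_null :: "'i set \<Rightarrow> ('i \<Rightarrow> 'v) \<Rightarrow> bool" where
  "orthonormal_or_null I e \<longleftrightarrow> (\<forall>i\<in>I. \<forall>j\<in>I. i \<noteq> j \<longrightarrow> g (e i) (e j) = 0)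
     \<and> (\<forall>i\<in>I. g (e i) (e i) = 0 \<or> g (e i) (e i) = 1)"

lemma residual_orthogonal:
  assumes "orthonormal_or_null I e" "finite I" "j \<in> I"
  shows "g (x - (\<Sum>i\<in>I. g x (e i) *\<^sub>C e i)) (e j) = 0"
proof -
  have "g (\<Sum>i\<in>I. g x (e i) *\<^sub>C e i) (e j) = (\<Sum>i\<in>I. g x (e i) * g (e i) (e j))"
    by (simp add: sum_left scale_left)
  also have "\<dots> = (\<Sum>i\<in>I. if i = j then g x (e j) * g (e j) (e j) else 0)"
    using assms by (intro sum.cong) (auto simp: orthonormal_or_null_def)
  also have "\<dots> = g x (e j) * g (e j) (e j)" using assms by simp
  also have "\<dots> = g x (e j)"
    using assms null_right[of "e j" x] by (auto simp: orthonormal_or_null_def)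
  finally show ?thesis by (simp add: diff_left)
qed

lemma residual_q:
  assumes "orthonormal_or_null I e" "finite I"
  shows "q (x - (\<Sum>i\<in>I. g x (e i) *\<^sub>C e i)) = q x - (\<Sum>i\<in>I. (cmod (g x (e i)))\<^sup>2)"
proof -
  let ?r = "x - (\<Sum>i\<in>I. g x (e i) *\<^sub>C e i)"
  have "g ?r (\<Sum>i\<in>I. g x (e i) *\<^sub>C e i) = 0"
    using residual_orthogonal[OF assms] by (simp add: sum_right scale_right)
  then have "g ?r ?r = g ?r x" by (subst diff_right) simp
  also have "\<dots> = g x x - (\<Sum>i\<in>I. g x (e i) * g (e i) x)"
    by (simp add: diff_left sum_left scale_left)
  also have "(\<Sum>i\<in>I. g x (e i) * g (e i) x) = (\<Sum>i\<in>I. complex_of_real ((cmod (g x (e i)))\<^sup>2))"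
    by (intro sum.cong refl, subst commute[of "e _" x]) (rule complex_norm_square[symmetric])
  finally show ?thesis by simp
qed

lemma Bessel:
  assumes "orthonormal_or_null I e" "finite I"
  shows "(\<Sum>i\<in>I. (cmod (g x (e i)))\<^sup>2) \<le> q x"
  using residual_q[OF assms, of x] nonneg[of "x - (\<Sum>i\<in>I. g x (e i) *\<^sub>C e i)"] by linarith

text \<open>If the residual \<open>u\<close> has length zero, the factor \<open>1 / sqrt (q u)\<close> is \<open>0\<close> by the convention for
  division, so this step contributes the vector \<open>0\<close>.\<close>

fun gram_schmidt :: "(nat \<Rightarrow> 'v) \<Rightarrow> nat \<Rightarrow> 'v" where
  "gram_schmidt a n =
    (let u = a n - (\<Sum>k<n. g (a n) (gram_schmidt a k) *\<^sub>C gram_schmidt a k)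
     in complex_of_real (1 / sqrt (q u)) *\<^sub>C u)"

declare gram_schmidt.simps [simp del]

lemma gram_schmidt_orthonormal_below: "orthonormal_or_null {..<n} (gram_schmidt a)"
proof (induction n)
  case (Suc n)
  let ?e = "gram_schmidt a"
  define u where "u = a n - (\<Sum>k<n. g (a n) (?e k) *\<^sub>C ?e k)"
  have e: "?e n = complex_of_real (1 / sqrt (q u)) *\<^sub>C u"
    by (subst gram_schmidt.simps) (simp add: u_def Let_def)
  have "g u (?e j) = 0" if "j < n" for j
    unfolding u_def using residual_orthogonal[OF Suc] that by simp
  then have 1: "g (?e n) (?e j) = 0" if "j < n" for j unfolding e using that by (simp add: scale_left)
  then have 2: "g (?e j) (?e n) = 0" if "j < n" for j using commute[of "?e j" "?e n"] that by simp
  have "g (?e n) (?e n) = complex_of_real ((1 / sqrt (q u))\<^sup>2 * q u)"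
    unfolding e by (simp add: scale_left scale_right complex_eq_iff power2_eq_square)
  then have "g (?e n) (?e n) = 0 \<or> g (?e n) (?e n) = 1"
    using nonneg[of u] by (cases "q u = 0") (simp_all add: power_divide)
  then show ?case using Suc 1 2 unfolding orthonormal_or_null_def
    by (auto simp: less_Suc_eq)
qed (simp add: orthonormal_or_null_def)

lemma gram_schmidt_orthonormal: "orthonormal_or_null (I :: nat set) (gram_schmidt a)"
  unfolding orthonormal_or_null_def
proof (intro conjI ballI impI)
  fix i j :: nat assume "i \<noteq> j"
  then show "g (gram_schmidt a i) (gram_schmidt a j) = 0"
    using gram_schmidt_orthonormal_below[of "Suc (max i j)" a] by (auto simp: orthonormal_or_null_def)
next
  fix i :: nat
  show "g (gram_schmidt a i) (gram_schmidt a i) = 0 \<or> g (gram_schmidt a i) (gram_schmidt a i) = 1"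
    using gram_schmidt_orthonormal_below[of "Suc i" a] by (auto simp: orthonormal_or_null_def)
qed

text \<open>Parseval's identity for the members of the orthogonalised sequence: the coefficient of \<open>a n\<close> at
  the last vector is the length of the residual left by the earlier ones.\<close>

lemma gram_schmidt_complete:
  "(\<Sum>k\<le>n. (cmod (g (a n) (gram_schmidt a k)))\<^sup>2) = q (a n)"
proof -
  let ?e = "gram_schmidt a"
  define u where "u = a n - (\<Sum>k<n. g (a n) (?e k) *\<^sub>C ?e k)"
  have e: "?e n = complex_of_real (1 / sqrt (q u)) *\<^sub>C u"
    by (subst gram_schmidt.simps) (simp add: u_def Let_def)
  have "q u = q (a n) - (\<Sum>k<n. (cmod (g (a n) (?e k)))\<^sup>2)"
    unfolding u_def by (rule residual_q[OF gram_schmidt_orthonormal]) simp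
  moreover have "g (a n) (?e n) = complex_of_real (sqrt (q u))"
  proof -
    have "g (\<Sum>k<n. g (a n) (?e k) *\<^sub>C ?e k) (?e n) = 0"
      using gram_schmidt_orthonormal[of "{..n}" a]
      by (simp add: sum_left scale_left orthonormal_or_null_def)
    then have "g (a n) (?e n) = g u (?e n)" by (simp add: u_def diff_left)
    also have "\<dots> = complex_of_real (1 / sqrt (q u) * q u)"
      unfolding e by (simp add: scale_right complex_eq_iff)
    finally show ?thesis using nonneg[of u] by (simp add: real_div_sqrt)
  qed
  then have "(cmod (g (a n) (?e n)))\<^sup>2 = q u" using nonneg[of u] by simp
  ultimately show ?thesis by (simp add: lessThan_Suc_atMost[symmetric])
qed

end

text \<open>The real and imaginary parts of \<open>g x y\<close> can be read off from the squared lengths of \<open>x - y\<close>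
  and \<open>x - \<i> y\<close>.\<close>

lemma polarization:
  assumes g: "semi_inner g" and h: "semi_inner h" and eq: "\<And>x. Re (g x x) = Re (h x x)"
  shows "g x y = h x y"
proof -
  interpret g: semi_inner g by fact
  interpret h: semi_inner h by fact
  have "Re (cnj c * g x y) = Re (cnj c * h x y)" for c
    using g.q_diff_scale[of x c y] h.q_diff_scale[of x c y] by (simp add: eq)
  from this[of 1] this[of "\<i>"] show ?thesis by (simp add: complex_eq_iff)
qed

global_interpretation hilbert: semi_inner "cinner :: 'h::complex_hilbert_space \<Rightarrow> _"
proof
  fix x y :: 'h
  show "cinner x y = cnj (cinner y x)" by (rule cinner_commute)
qed (simp_all add: cinner_add_left cinner_scaleC_left cinner_self)

lemma Cauchy_Schwarz_norm: "cmod (cinner x y) \<le> norm x * norm y"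
proof -
  have "(cmod (cinner x y))\<^sup>2 \<le> (norm x * norm y)\<^sup>2"
    using hilbert.Cauchy_Schwarz[of x y] by (simp add: cinner_self power_mult_distrib)
  then show ?thesis by (rule power2_le_imp_le) simp
qed

lemma scaleR_scaleC: "r *\<^sub>R (x :: 'a::complex_vector) = complex_of_real r *\<^sub>C x"
  by (simp add: scaleC_of_real)

lemma bounded_bilinear_cinner: "bounded_bilinear cinner"
proof
  show "\<exists>K. \<forall>a b. norm (cinner a b) \<le> norm a * norm b * K"
    by (rule exI[of _ 1]) (simp add: Cauchy_Schwarz_norm)
qed (simp_all add: hilbert.add_left hilbert.add_right scaleR_scaleC hilbert.scale_left
    hilbert.scale_right scaleR_conv_of_real)

lemmas tendsto_cinner [tendsto_intros] = bounded_bilinear.tendsto[OF bounded_bilinear_cinner]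
lemmas continuous_on_cinner [continuous_intros] =
  bounded_bilinear.continuous_on[OF bounded_bilinear_cinner]

lemma bounded_linear_scaleC_const: "bounded_linear (\<lambda>c. c *\<^sub>C (x :: 'a::complex_normed_vector))"
  by (rule bounded_linear_intro[where K = "norm x"])
    (simp_all add: scaleC_add_left scaleR_scaleC scaleC_scaleC norm_scaleC scaleR_conv_of_real
      )

lemmas continuous_on_scaleC_const [continuous_intros] =
  bounded_linear.continuous_on[OF bounded_linear_scaleC_const]

lemma bounded_linear_scaleC: "bounded_linear (\<lambda>x :: 'a::complex_normed_vector. c *\<^sub>C x)"
  by (rule bounded_linear_intro[where K = "cmod c"])
    (simp_all add: scaleC_add_right scaleR_scaleC scaleC_scaleC norm_scaleC mult.commute)

lemmas tendsto_scaleC [tendsto_intros] = bounded_linear.tendsto[OF bounded_linear_scaleC]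

lemma cinner_eqI:
  fixes x y :: "'h::complex_hilbert_space"
  assumes "\<And>z. cinner x z = cinner y z" shows "x = y"
  using assms[of "x - y"] cinner_self[of "x - y"] hilbert.diff_left[of x y "x - y"] by simp

lemma cinner_zero_iff: "cinner x x = 0 \<longleftrightarrow> x = (0 :: 'h::complex_hilbert_space)"
  by (simp add: cinner_self)

lemma norm_eq_cinner: "(norm (x :: 'h::complex_hilbert_space))\<^sup>2 = Re (cinner x x)"
  by (simp add: cinner_self)

lemma norm_add_orthogonal:
  fixes x y :: "'h::complex_hilbert_space"
  assumes "cinner x y = 0" shows "(norm (x + y))\<^sup>2 = (norm x)\<^sup>2 + (norm y)\<^sup>2"
  using assms hilbert.commute[of y x]
  by (simp add: norm_eq_cinner hilbert.add_left hilbert.add_right)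

subsection \<open>Finite-dimensional subspaces\<close>

definition orthonormal_set :: "'h::complex_hilbert_space set \<Rightarrow> bool" where
  "orthonormal_set F \<longleftrightarrow> (\<forall>x\<in>F. \<forall>y\<in>F. cinner x y = (if x = y then 1 else 0))"

lemma orthonormal_set_imp: "orthonormal_set F \<Longrightarrow> hilbert.orthonormal_or_null F id"
  by (auto simp: orthonormal_set_def hilbert.orthonormal_or_null_def)

lemma orthonormal_expansion:
  assumes F: "orthonormal_set F" "finite F" and x: "x \<in> cspan F"
  shows "x = (\<Sum>f\<in>F. cinner x f *\<^sub>C f)"
  using x
proof (induction rule: complex_vector.span_induct)
  case base
  show ?case
  proof (rule complex_vector.subspaceI)
    fix x y and c :: complex
    assume "x \<in> {x. x = (\<Sum>f\<in>F. cinner x f *\<^sub>C f)}"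
    then have x: "(\<Sum>f\<in>F. cinner x f *\<^sub>C f) = x" by simp
    show "c *\<^sub>C x \<in> {x. x = (\<Sum>f\<in>F. cinner x f *\<^sub>C f)}"
      by (simp only: hilbert.scale_left scaleC_scaleC[symmetric]
          complex_vector.scale_sum_right[symmetric] x mem_Collect_eq)
    assume "y \<in> {x. x = (\<Sum>f\<in>F. cinner x f *\<^sub>C f)}"
    then have y: "(\<Sum>f\<in>F. cinner y f *\<^sub>C f) = y" by simp
    show "x + y \<in> {x. x = (\<Sum>f\<in>F. cinner x f *\<^sub>C f)}"
      by (simp only: hilbert.add_left scaleC_add_left sum.distrib x y mem_Collect_eq)
  qed simp
next
  case (step f)
  have "(\<Sum>f'\<in>F. cinner f f' *\<^sub>C f') = (\<Sum>f'\<in>F. if f' = f then f else 0)"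
    using F step by (intro sum.cong) (auto simp: orthonormal_set_def)
  also have "\<dots> = f" using F step by simp
  finally show ?case by simp
qed

text \<open>The residual of \<open>b\<close> with respect to \<open>F\<close>, normalised.\<close>

lemma orthonormal_set_insert:
  fixes b :: "'h::complex_hilbert_space"
  assumes F: "orthonormal_set F" "finite F" and b: "b \<notin> cspan F"
  obtains r where "norm r = 1" "\<And>f. f \<in> F \<Longrightarrow> cinner r f = 0" "cspan (insert r F) = cspan (insert b F)"
proof -
  define s where "s = (\<Sum>f\<in>F. cinner b f *\<^sub>C f)"
  have s: "s \<in> cspan F" unfolding s_def
    by (intro complex_vector.span_sum complex_vector.span_scale complex_vector.span_base)
  define u where "u = b - s"
  have "u \<noteq> 0" using s b by (auto simp: u_def)
  define c where "c = complex_of_real (1 / norm u)"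
  have c: "c \<noteq> 0" using \<open>u \<noteq> 0\<close> by (simp add: c_def)
  define r where "r = c *\<^sub>C u"
  have 1: "norm r = 1" using \<open>u \<noteq> 0\<close> by (simp add: r_def c_def norm_scaleC norm_divide)
  have 2: "cinner r f = 0" if "f \<in> F" for f
    using hilbert.residual_orthogonal[OF orthonormal_set_imp[OF F(1)] F(2) that, of b]
    by (simp add: r_def u_def s_def hilbert.scale_left)
  have sF: "s \<in> cspan (insert z F)" for z
    using s complex_vector.span_mono[of F "insert z F"] by auto
  have "r \<in> cspan (insert b F)" unfolding r_def u_def
    by (intro complex_vector.span_scale complex_vector.span_diff sF complex_vector.span_base) simp
  moreover have "b = inverse c *\<^sub>C r + s" using c by (simp add: r_def u_def scaleC_scaleC)
  then have "b \<in> cspan (insert r F)"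
    using complex_vector.span_add[OF complex_vector.span_scale sF, of r r "inverse c"]
    by (simp add: complex_vector.span_base)
  ultimately have "cspan (insert r F) = cspan (insert b F)"
    unfolding complex_vector.span_eq by (auto simp: complex_vector.span_base)
  with 1 2 show ?thesis by (rule that)
qed

lemma orthonormal_set_insertI:
  assumes "orthonormal_set F" "norm r = 1" "\<And>f. f \<in> F \<Longrightarrow> cinner r f = 0"
  shows "orthonormal_set (insert r F)"
proof -
  have "cinner r r = 1" using assms(2) by (simp add: cinner_self)
  moreover have "cinner f r = 0" if "f \<in> F" for f
    using assms(3)[OF that] cinner_commute[of f r] by simp
  ultimately show ?thesis using assms(1,3) by (fastforce simp: orthonormal_set_def)
qed

lemma finite_orthonormal_basis:
  assumes "cfinite_dim (M :: 'h::complex_hilbert_space set)"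
  obtains F where "finite F" "orthonormal_set F" "cspan F = M"
proof -
  obtain B where B: "finite B" "cspan B = M" using assms by (auto simp: cfinite_dim_def)
  have "\<exists>F. finite F \<and> orthonormal_set F \<and> cspan F = cspan B"
    using B(1)
  proof (induction B rule: finite_induct)
    case empty
    then show ?case by (intro exI[of _ "{}"]) (simp add: orthonormal_set_def)
  next
    case (insert b B)
    then obtain F where F: "finite F" "orthonormal_set F" "cspan F = cspan B" by blast
    have eq: "cspan (insert b F) = cspan (insert b B)"
      using F(3) by (metis complex_vector.span_insert)
    show ?case
    proof (cases "b \<in> cspan F")
      case True
      then have "cspan (insert b F) = cspan F" by (rule complex_vector.span_redundant)
      then show ?thesis using F eq by metis
    next
      case False
      then obtain r where "norm r = 1" "\<And>f. f \<in> F \<Longrightarrow> cinner r f = 0" "cspan (insert r F) = cspan (insert b F)"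
        using orthonormal_set_insert[OF F(2,1)] by metis
      then show ?thesis using F eq orthonormal_set_insertI[of F r]
        by (intro exI[of _ "insert r F"]) simp
    qed
  qed
  then show ?thesis using that B(2) by blast
qed

text \<open>The subspace consists of the fixed points of the orthogonal projection onto it, which is
  continuous as a finite sum.\<close>

lemma cfinite_dim_closed:
  assumes "cfinite_dim (M :: 'h::complex_hilbert_space set)"
  shows "closed M"
proof -
  obtain F where F: "finite F" "orthonormal_set F" "cspan F = M"
    by (rule finite_orthonormal_basis[OF assms])
  have "(\<Sum>f\<in>F. cinner x f *\<^sub>C f) \<in> cspan F" for x
    by (intro complex_vector.span_sum complex_vector.span_scale complex_vector.span_base)
  then have "M = {x. x = (\<Sum>f\<in>F. cinner x f *\<^sub>C f)}"
    using orthonormal_expansion[OF F(2,1)] unfolding F(3)[symmetric]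
    by (metis (mono_tags, lifting) Collect_cong Collect_mem_eq)
  moreover have "closed {x. x = (\<Sum>f\<in>F. cinner x f *\<^sub>C f)}"
    by (intro closed_Collect_eq continuous_intros)
  ultimately show ?thesis by simp
qed

lemma cfinite_dim_imp_csubspace: "cfinite_dim M \<Longrightarrow> csubspace M"
  unfolding cfinite_dim_def using complex_vector.subspace_span by metis

lemma unit_vector_orthogonal:
  fixes G :: "'h::complex_hilbert_space set"
  assumes "\<not> cfinite_dim (UNIV :: 'h set)" "finite G"
  obtains u where "norm u = 1" "\<And>x. x \<in> G \<Longrightarrow> cinner u x = 0"
proof -
  have "cfinite_dim (cspan G)" using assms(2) by (auto simp: cfinite_dim_def)
  then obtain F where F: "finite F" "orthonormal_set F" "cspan F = cspan G"
    by (rule finite_orthonormal_basis)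
  have "cspan F \<noteq> UNIV" using assms(1) F(1) by (auto simp: cfinite_dim_def)
  then obtain b where "b \<notin> cspan F" by blast
  then obtain r where r: "norm r = 1" "\<And>f. f \<in> F \<Longrightarrow> cinner r f = 0"
    using orthonormal_set_insert[OF F(2,1)] by metis
  have "cinner r x = 0" if "x \<in> G" for x
  proof -
    have "x \<in> cspan F" using that F(3) by (simp add: complex_vector.span_base)
    then show ?thesis
      using orthonormal_expansion[OF F(2,1), of x] hilbert.sum_right[of r "\<lambda>f. cinner x f *\<^sub>C f" F] r(2)
      by (simp add: hilbert.scale_right)
  qed
  then show ?thesis using r(1) that by blast
qed

section \<open>Embedding separable semi-inner product spaces in \<open>\<ell>\<^sup>2\<close>\<close>

context semi_inner
begin

lemma sqrt_q_triangle: "sqrt (q (x + y)) \<le> sqrt (q x) + sqrt (q y)"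
proof (rule real_le_lsqrt)
  have "Re (g y x) = Re (g x y)" using commute[of y x] by simp
  then have "q (x + y) = q x + q y + 2 * Re (g x y)" by (simp add: add_left add_right)
  moreover have "cmod (g x y) \<le> sqrt (q x) * sqrt (q y)"
    by (rule real_le_rsqrt[of "cmod (g x y)" "q x * q y", unfolded real_sqrt_mult]) (rule Cauchy_Schwarz)
  ultimately show "q (x + y) \<le> (sqrt (q x) + sqrt (q y))\<^sup>2"
    using complex_Re_le_cmod[of "g x y"] nonneg[of x] nonneg[of y] by (simp add: power2_sum)
qed (simp add: nonneg)

text \<open>A vector is sent to its coefficients with respect to the Gram-Schmidt system of the dense
  sequence. Bessel's inequality makes this map a contraction; Parseval's identity makes it isometric
  on the dense sequence, hence everywhere. The coefficients are stored along an injection of the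
  natural numbers into the index type, with \<open>0\<close> elsewhere.\<close>

theorem ell2_embedding:
  fixes a :: "nat \<Rightarrow> 'v"
  assumes dense: "\<And>x \<epsilon>. 0 < \<epsilon> \<Longrightarrow> \<exists>n. q (x - a n) < \<epsilon>"
    and inf: "infinite (UNIV :: 'i set)"
  obtains v :: "'v \<Rightarrow> 'i ell2" where "\<And>x y. v (x + y) = v x + v y" "\<And>c x. v (c *\<^sub>C x) = c *\<^sub>C v x"
    "\<And>x y. cinner (v x) (v y) = g x y"
proof -
  obtain \<iota> :: "nat \<Rightarrow> 'i" where \<iota>: "inj \<iota>" using inf infinite_countable_subset by blast
  let ?e = "gram_schmidt a"
  define w where "w x i = (if i \<in> range \<iota> then g x (?e (inv \<iota> i)) else 0)" for x i
  define v where "v x = Abs_ell2 (w x)" for x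
  have w_\<iota>: "w x (\<iota> k) = g x (?e k)" for x k using \<iota> by (simp add: w_def)
  have fin: "L2_set (\<lambda>i. cmod (w x i)) F \<le> sqrt (q x)" if F: "finite F" for x F
  proof -
    define N where "N = \<iota> -` F"
    have N: "finite N" unfolding N_def by (rule finite_vimageI[OF F \<iota>])
    have "(\<Sum>i\<in>F. (cmod (w x i))\<^sup>2) = (\<Sum>i\<in>\<iota> ` N. (cmod (w x i))\<^sup>2)"
      by (rule sum.mono_neutral_right) (use F in \<open>auto simp: N_def w_def\<close>)
    also have "\<dots> = (\<Sum>k\<in>N. (cmod (g x (?e k)))\<^sup>2)"
      using inj_on_subset[OF \<iota>] by (subst sum.reindex) (simp_all add: w_\<iota>)
    also have "\<dots> \<le> q x" by (rule Bessel[OF gram_schmidt_orthonormal N])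
    finally show ?thesis by (simp add: L2_set_def)
  qed
  have Rep_v: "Rep_ell2 (v x) = w x" for x
    unfolding v_def by (rule Abs_ell2_inverse) (use fin in \<open>auto simp: ell2_iff_L2_set_bounded\<close>)
  have add: "v (x + y) = v x + v y" for x y
    by (simp add: Rep_ell2_inject[symmetric] plus_ell2.rep_eq Rep_v fun_eq_iff w_def add_left)
  have sc: "v (c *\<^sub>C x) = c *\<^sub>C v x" for c x
    by (simp add: Rep_ell2_inject[symmetric] scaleC_ell2.rep_eq Rep_v fun_eq_iff w_def scale_left)
  have le: "norm (v x) \<le> sqrt (q x)" for x
    by (rule norm_ell2_le) (simp add: Rep_v fin)
  have ge_a: "sqrt (q (a n)) \<le> norm (v (a n))" for n
  proof -
    have "q (a n) = (\<Sum>k\<in>{..n}. (cmod (w (a n) (\<iota> k)))\<^sup>2)"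
      by (simp only: gram_schmidt_complete w_\<iota>)
    also have "\<dots> = (\<Sum>i\<in>\<iota> ` {..n}. (cmod (w (a n) i))\<^sup>2)"
      using inj_on_subset[OF \<iota>] by (subst sum.reindex) simp_all
    finally have "sqrt (q (a n)) = L2_set (\<lambda>i. cmod (Rep_ell2 (v (a n)) i)) (\<iota> ` {..n})"
      by (simp only: L2_set_def Rep_v)
    also have "\<dots> \<le> norm (v (a n))" by (rule L2_set_le_norm_ell2) simp
    finally show ?thesis .
  qed
  have norm_v: "norm (v x) = sqrt (q x)" for x
  proof (rule antisym[OF le], rule field_le_epsilon)
    fix \<epsilon> :: real assume "0 < \<epsilon>"
    then obtain n where n: "q (x - a n) < (\<epsilon> / 2)\<^sup>2" using dense[of "(\<epsilon>/2)\<^sup>2" x] by auto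
    have s: "sqrt (q (x - a n)) \<le> \<epsilon> / 2"
      using n \<open>0 < \<epsilon>\<close> by (intro real_le_lsqrt) (auto simp: nonneg)
    have "sqrt (q x) \<le> sqrt (q (x - a n)) + sqrt (q (a n))"
      using sqrt_q_triangle[of "x - a n" "a n"] by simp
    also have "\<dots> \<le> \<epsilon> / 2 + norm (v (a n))" using s ge_a[of n] by linarith
    also have "norm (v (a n)) \<le> norm (v x) + norm (v (x - a n))"
    proof -
      have "v x = v (a n) + v (x - a n)" by (simp flip: add)
      then show ?thesis using norm_diff_ineq[of "v (a n)" "v (x - a n)"] by simp
    qed
    also have "norm (v (x - a n)) \<le> \<epsilon> / 2" using le[of "x - a n"] s by linarith
    finally show "sqrt (q x) \<le> norm (v x) + \<epsilon>" by simp
  qed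
  have "semi_inner (\<lambda>x y. cinner (v x) (v y))"
  proof
    fix x y
    show "cinner (v x) (v y) = cnj (cinner (v y) (v x))" by (rule cinner_commute)
  qed (simp_all add: add sc hilbert.add_left hilbert.scale_left hilbert.nonneg)
  then have "cinner (v x) (v y) = g x y" for x y
    by (rule polarization) (unfold_locales, simp add: norm_v nonneg flip: norm_eq_cinner)
  with add sc show ?thesis by (rule that)
qed

end

section \<open>Orthogonal projections\<close>

lemma parallelogram:
  fixes x y :: "'h::complex_hilbert_space"
  shows "(norm (x + y))\<^sup>2 + (norm (x - y))\<^sup>2 = 2 * (norm x)\<^sup>2 + 2 * (norm y)\<^sup>2"
  by (simp add: norm_eq_cinner hilbert.add_left hilbert.add_right hilbert.diff_left hilbert.diff_right)

text \<open>The projection of \<open>x\<close> is the nearest point of \<open>N\<close>. By the parallelogram law a sequence in \<open>N\<close>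
  whose distance to \<open>x\<close> tends to the infimum is a Cauchy sequence, and moving from the nearest
  point along a direction not orthogonal to \<open>x - y\<close> would come closer still.\<close>

theorem orthogonal_decomposition:
  fixes x :: "'h::complex_hilbert_space"
  assumes N: "closed N" "csubspace N"
  obtains y where "y \<in> N" "\<And>z. z \<in> N \<Longrightarrow> cinner (x - y) z = 0"
proof -
  note sub = complex_vector.subspace_0[OF N(2)] complex_vector.subspace_add[OF N(2)]
    complex_vector.subspace_scale[OF N(2)] complex_vector.subspace_diff[OF N(2)]
  define d where "d = infdist x N"
  have d_le: "d \<le> norm (x - y)" if "y \<in> N" for y
    using infdist_le[OF that, of x] by (simp add: d_def dist_norm)
  have d0: "0 \<le> d" by (simp add: d_def infdist_nonneg)
  have "\<exists>y\<in>N. norm (x - y) < d + \<epsilon>" if "\<epsilon> > 0" for \<epsilon>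
  proof (rule ccontr)
    assume "\<not> ?thesis"
    then have "d + \<epsilon> \<le> infdist x N"
      using sub(1) by (subst infdist_notempty) (auto simp: dist_norm not_less intro!: cINF_greatest)
    then show False using that by (simp add: d_def)
  qed
  then have "\<exists>y. \<forall>n. y n \<in> N \<and> norm (x - y n) < d + 1 / real (Suc n)"
    by (intro choice) (meson of_nat_0_less_iff zero_less_Suc zero_less_divide_1_iff)
  then obtain y where y: "\<And>n. y n \<in> N" "\<And>n. norm (x - y n) < d + 1 / real (Suc n)" by metis
  have apart: "(norm (y m - y n))\<^sup>2 \<le> 2 * (norm (x - y m))\<^sup>2 + 2 * (norm (x - y n))\<^sup>2 - 4 * d\<^sup>2" for m n
  proof -
    let ?mid = "(1 / 2) *\<^sub>C (y m + y n)"
    have "d \<le> norm (x - ?mid)" by (intro d_le sub y)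
    moreover have "(x - y m) + (x - y n) = 2 *\<^sub>C (x - ?mid)"
      by (simp add: complex_vector.scale_right_diff_distrib scaleC_scaleC
          scaleC_add_left[of 1 1 x, simplified])
    then have "norm ((x - y m) + (x - y n)) = 2 * norm (x - ?mid)" by (simp add: norm_scaleC)
    ultimately have "4 * d\<^sup>2 \<le> (norm ((x - y m) + (x - y n)))\<^sup>2"
      using d0 by (simp add: power_mult_distrib power_mono)
    then show ?thesis using parallelogram[of "x - y m" "x - y n"] norm_minus_commute[of "y m" "y n"] by simp
  qed
  have lim_norm: "(\<lambda>n. norm (x - y n)) \<longlonglongrightarrow> d"
  proof (rule tendsto_sandwich[of "\<lambda>_. d" _ _ "\<lambda>n. d + 1 / real (Suc n)"])
    show "(\<lambda>n. d + 1 / real (Suc n)) \<longlonglongrightarrow> d"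
      using tendsto_add[OF tendsto_const LIMSEQ_inverse_real_of_nat, of d] by (simp add: inverse_eq_divide)
  qed (use y d_le in \<open>auto intro!: always_eventually less_imp_le\<close>)
  have "Cauchy y"
  proof (rule metric_CauchyI)
    fix e :: real assume e: "0 < e"
    have "(\<lambda>n. (norm (x - y n))\<^sup>2) \<longlonglongrightarrow> d\<^sup>2" by (intro tendsto_intros lim_norm)
    then have "eventually (\<lambda>n. (norm (x - y n))\<^sup>2 < d\<^sup>2 + e\<^sup>2 / 4) sequentially"
      by (rule order_tendstoD) (use e in simp)
    then obtain M where M: "\<And>n. n \<ge> M \<Longrightarrow> (norm (x - y n))\<^sup>2 < d\<^sup>2 + e\<^sup>2 / 4"
      by (auto simp: eventually_sequentially)
    have "dist (y m) (y n) < e" if "m \<ge> M" "n \<ge> M" for m n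
    proof -
      have "(norm (y m - y n))\<^sup>2 < e\<^sup>2"
        using apart[of m n] M[OF that(1)] M[OF that(2)] by (simp add: field_simps)
      then show ?thesis using e by (simp add: dist_norm power2_less_imp_less)
    qed
    then show "\<exists>M. \<forall>m\<ge>M. \<forall>n\<ge>M. dist (y m) (y n) < e" by blast
  qed
  then obtain y' where y': "y \<longlonglongrightarrow> y'" using Cauchy_convergent convergent_def by blast
  have y'N: "y' \<in> N" using closed_sequentially[OF N(1) y(1) y'] .
  have "(\<lambda>n. norm (x - y n)) \<longlonglongrightarrow> norm (x - y')" by (intro tendsto_intros y')
  then have d: "norm (x - y') = d" using lim_norm LIMSEQ_unique by blast
  have "cinner (x - y') z = 0" if z: "z \<in> N" for z
  proof (cases "z = 0")
    case False
    define c where "c = cinner (x - y') z / cinner z z"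
    have zz: "cinner z z \<noteq> 0" using False by (simp add: cinner_zero_iff)
    have "d\<^sup>2 \<le> (norm ((x - y') - c *\<^sub>C z))\<^sup>2"
      using d_le[of "y' + c *\<^sub>C z"] sub y'N z d0 by (simp add: diff_diff_add power_mono)
    moreover have "cinner ((x - y') - c *\<^sub>C z) (c *\<^sub>C z) = 0"
      using zz by (simp add: hilbert.diff_left hilbert.scale_left hilbert.scale_right c_def)
    then have "(norm (x - y'))\<^sup>2 = (norm ((x - y') - c *\<^sub>C z))\<^sup>2 + (norm (c *\<^sub>C z))\<^sup>2"
      using norm_add_orthogonal by fastforce
    ultimately have "(norm (c *\<^sub>C z))\<^sup>2 \<le> 0" unfolding d by linarith
    then show ?thesis using False zz by (simp add: norm_scaleC c_def)
  qed simp
  with y'N show ?thesis by (rule that)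
qed

section \<open>Positive functionals are bounded\<close>

text \<open>The binomial series of the square root converges absolutely on the open unit ball.\<close>

lemma gbinomial_half_le: "\<bar>(1 / 2 :: real) gchoose k\<bar> \<le> 1"
proof (induction k)
  case (Suc k)
  have "(1 / 2 :: real) gchoose Suc k = ((1 / 2) gchoose k) * ((1 / 2 - real k) / real (Suc k))"
    by (simp add: gbinomial_prod_rev atLeast0LessThan[symmetric] field_simps)
  moreover have "\<bar>(1 / 2 - real k) / real (Suc k)\<bar> \<le> 1" by (simp add: abs_le_iff field_simps)
  ultimately show ?case using mult_mono[OF Suc] by (fastforce simp only: abs_mult)
qed simp

lemma bounded_linear_star: "bounded_linear (star :: 'a::unital_cstar_algebra \<Rightarrow> 'a)"
proof (rule bounded_linear_intro[where K = 1])
  fix x :: 'a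
  show "norm (star x) \<le> norm x * 1"
  proof (cases "x = 0")
    case True
    then show ?thesis using star_scaleC[of 0 x] by simp
  next
    case False
    have "norm (star (star x) * star x) \<le> norm x * norm (star x)"
      using norm_mult_ineq[of x "star x"] by (simp add: star_star)
    then have "norm (star x) * norm (star x) \<le> norm x * norm (star x)"
      by (simp add: cstar_identity power2_eq_square)
    moreover have "star x \<noteq> 0" using False star_star[of x] star_scaleC[of 0 x] by force
    ultimately show ?thesis by simp
  qed
qed (simp_all add: star_add star_scaleC scaleR_scaleC)

lemma star_zero: "star 0 = (0 :: 'a::unital_cstar_algebra)"
  and star_diff: "star (a - b) = star a - star (b :: 'a)"
  and star_scaleR: "star (r *\<^sub>R a) = r *\<^sub>R star (a :: 'a)"
  using bounded_linear.linear[OF bounded_linear_star]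
  by (blast intro: linear_0 linear_diff linear_scale)+

lemma star_one [simp]: "star 1 = (1 :: 'a::unital_cstar_algebra)"
  using star_mult[of "star 1" 1] by (simp add: star_star)

lemma star_power: "star (a ^ n) = star (a :: 'a::unital_cstar_algebra) ^ n"
  by (induction n) (simp_all add: star_mult power_commutes)

text \<open>The square root is the binomial series with exponent \<open>1/2\<close>. By Vandermonde's identity its
  Cauchy square has the coefficients of the binomial series with exponent \<open>1\<close>, which is \<open>1 - h\<close>.\<close>

lemma one_minus_self_adjoint_square:
  fixes h :: "'a::unital_cstar_algebra"
  assumes "norm h < 1" "star h = h"
  obtains s where "star s = s" "s * s = 1 - h"
proof -
  define c where "c k = ((1 / 2 :: real) gchoose k) *\<^sub>R (- h) ^ k" for k
  have summ: "summable (\<lambda>k. norm (c k))"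
  proof (rule summable_comparison_test')
    show "summable (\<lambda>k. norm h ^ k)" using assms(1) by (simp add: summable_geometric)
    fix k
    have "norm (c k) \<le> 1 * norm ((- h) ^ k)"
      unfolding c_def norm_scaleR by (rule mult_right_mono) (simp_all add: gbinomial_half_le)
    also have "\<dots> \<le> norm h ^ k" using norm_power_ineq[of "- h" k] by simp
    finally show "norm (norm (c k)) \<le> norm h ^ k" by simp
  qed
  define s where "s = (\<Sum>k. c k)"
  have "star (c k) = c k" for k
    using assms(2) star_diff[of 0 h] by (simp add: c_def star_scaleR star_power star_zero)
  then have "star s = s"
    using bounded_linear.suminf[OF bounded_linear_star summable_norm_cancel[OF summ]]
    by (simp add: s_def)
  moreover have "s * s = 1 - h"
  proof -
    have "(\<Sum>i\<le>k. c i * c (k - i)) = (1 gchoose k) *\<^sub>R (- h) ^ k" for k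
    proof -
      have "c i * c (k - i) = (((1 / 2) gchoose i) * ((1 / 2) gchoose (k - i))) *\<^sub>R (- h) ^ k"
        if "i \<le> k" for i
        using that by (simp add: c_def flip: power_add)
      then have "(\<Sum>i\<le>k. c i * c (k - i))
          = (\<Sum>i\<le>k. ((1 / 2) gchoose i) * ((1 / 2) gchoose (k - i))) *\<^sub>R (- h) ^ k"
        by (simp add: scaleR_sum_left)
      also have "(\<Sum>i\<le>k. ((1 / 2 :: real) gchoose i) * ((1 / 2) gchoose (k - i))) = 1 gchoose k"
        using gbinomial_Vandermonde[of "1 / 2 :: real" "1 / 2" k] by (simp add: atLeast0AtMost)
      finally show ?thesis .
    qed
    then have "(\<lambda>k. (1 gchoose k) *\<^sub>R (- h) ^ k) sums (s * s)"
      using Cauchy_product_sums[OF summ summ] by (simp add: s_def)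
    moreover have "(1 gchoose k :: real) *\<^sub>R (- h) ^ k = 0" if "k \<notin> {..1}" for k
    proof -
      have "(1 gchoose k :: real) = real (1 choose k)" 
        using binomial_gbinomial[where 'a = real and n = 1 and k = k] by simp
      then show ?thesis using that by (simp add: binomial_eq_0)
    qed
    then have "(\<lambda>k. (1 gchoose k) *\<^sub>R (- h) ^ k) sums (\<Sum>k\<le>1. (1 gchoose k :: real) *\<^sub>R (- h) ^ k)"
      by (intro sums_finite) auto
    ultimately have "s * s = (\<Sum>k\<le>1. (1 gchoose k :: real) *\<^sub>R (- h) ^ k)" by (rule sums_unique2)
    then show ?thesis by simp
  qed
  ultimately show ?thesis by (rule that)
qed

locale positive_functional =
  fixes f :: "'a::unital_cstar_algebra \<Rightarrow> complex"
  assumes add: "f (a + b) = f a + f b"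
    and scale: "f (c *\<^sub>C a) = c * f a"
    and star: "f (star a) = cnj (f a)"
    and positive: "0 \<le> Re (f (star a * a))"
begin

lemma minus: "f (- a) = - f a" and diff: "f (a - b) = f a - f b"
  using scale[of "-1" a] scale[of "-1" b] add[of a "- b"] by simp_all

text \<open>For \<open>r\<close> larger than the square of the norm of \<open>a\<close>, the element \<open>1 - (1/r) (star a * a)\<close> is the
  square of a self-adjoint \<open>s\<close>, and \<open>f\<close> is non-negative at \<open>star (s * b) * (s * b)\<close>. The margin \<open>\<delta>\<close>
  in the choice of \<open>r\<close> costs at most \<open>\<epsilon>\<close>.\<close>

lemma conjugate_bound: "Re (f (star b * (star a * a) * b)) \<le> (norm a)\<^sup>2 * Re (f (star b * b))"
proof (rule field_le_epsilon)
  fix \<epsilon> :: real assume \<epsilon>: "0 < \<epsilon>"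
  let ?m = "Re (f (star b * b))"
  define \<delta> where "\<delta> = \<epsilon> / (?m + 1)"
  define r where "r = (norm a)\<^sup>2 + \<delta>"
  have m: "0 \<le> ?m" by (rule positive)
  have \<delta>: "0 < \<delta>" using \<epsilon> m by (simp add: \<delta>_def)
  then have r: "0 < r" by (simp add: r_def add_nonneg_pos)
  let ?h = "(1 / r) *\<^sub>R (star a * a)"
  have "norm ?h < 1" using \<delta> r by (simp add: cstar_identity r_def)
  moreover have "star ?h = ?h" by (simp add: star_scaleR star_mult star_star)
  ultimately obtain s where s: "star s = s" "s * s = 1 - ?h" by (rule one_minus_self_adjoint_square)
  have "star (s * b) * (s * b) = star b * (s * s) * b" by (simp add: star_mult s(1) mult.assoc)
  also have "\<dots> = star b * b - complex_of_real (1 / r) *\<^sub>C (star b * (star a * a) * b)"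
    unfolding s(2) scaleR_scaleC
    by (simp add: algebra_simps scaleC_mult_left scaleC_mult_right)
  finally have "0 \<le> ?m - (1 / r) * Re (f (star b * (star a * a) * b))"
    using positive[of "s * b"] by (simp add: diff scale)
  then have "Re (f (star b * (star a * a) * b)) \<le> r * ?m"
    using r by (simp add: field_simps)
  also have "\<dots> \<le> (norm a)\<^sup>2 * ?m + \<epsilon>"
  proof -
    have "\<delta> * ?m \<le> \<delta> * (?m + 1)" using \<delta> by simp
    also have "\<dots> = \<epsilon>" using m by (simp add: \<delta>_def)
    finally show ?thesis by (simp add: r_def distrib_right)
  qed
  finally show "Re (f (star b * (star a * a) * b)) \<le> (norm a)\<^sup>2 * ?m + \<epsilon>" .
qed

lemma square_bound: "Re (f (star a * a)) \<le> (norm a)\<^sup>2 * Re (f 1)"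
  using conjugate_bound[of 1 a] by simp

sublocale form: semi_inner "\<lambda>a b. f (star b * a)"
proof
  fix a b c :: 'a and z
  show "f (star c * (a + b)) = f (star c * a) + f (star c * b)" by (simp add: distrib_left add)
  show "f (star b * (z *\<^sub>C a)) = z * f (star b * a)" by (simp add: scaleC_mult_right scale)
  show "f (star b * a) = cnj (f (star a * b))" by (simp add: star_mult star_star flip: star)
qed (rule positive)

end

section \<open>Extreme linear functionals below a sublinear one\<close>

definition sublinear :: "('a::real_vector \<Rightarrow> real) \<Rightarrow> bool" where
  "sublinear p \<longleftrightarrow> (\<forall>x y. p (x + y) \<le> p x + p y) \<and> (\<forall>r>0. \<forall>x. p (r *\<^sub>R x) \<le> r * p x)"

lemma sublinear_add: "sublinear p \<Longrightarrow> p (x + y) \<le> p x + p y"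
  by (simp add: sublinear_def)

lemma sublinear_zero: assumes "sublinear p" shows "p 0 = 0"
proof -
  have "p 0 \<le> r * p 0" if "r > 0" for r
    using assms that unfolding sublinear_def by (metis scaleR_zero_right)
  from this[of 2] this[of "1/2"] show ?thesis by simp
qed

lemma sublinear_scale:
  assumes "sublinear p" "0 \<le> r" shows "p (r *\<^sub>R x) = r * p x"
proof (cases "r = 0")
  case False
  have "p (inverse r *\<^sub>R (r *\<^sub>R x)) \<le> inverse r * p (r *\<^sub>R x)"
    using assms False by (simp add: sublinear_def del: scaleR_scaleR)
  then have "p x \<le> inverse r * p (r *\<^sub>R x)" using False by simp
  then show ?thesis using assms False by (auto simp: sublinear_def field_simps intro!: antisym)
qed (simp add: sublinear_zero[OF assms(1)])

lemma sublinear_minus: "sublinear p \<Longrightarrow> - p (- x) \<le> p x"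
  using sublinear_add[of p x "- x"] sublinear_zero[of p] by simp

text \<open>The linear functionals below \<open>support_face q a\<close> are those below \<open>q\<close> that take the greatest
  possible value \<open>q a\<close> at \<open>a\<close>: an exposed face of the set of functionals below \<open>q\<close>.\<close>

definition support_face :: "('a::real_vector \<Rightarrow> real) \<Rightarrow> 'a \<Rightarrow> 'a \<Rightarrow> real" where
  "support_face q a x = (INF s\<in>{0..}. q (x + s *\<^sub>R a) - s * q a)"

lemma support_face_lower:
  assumes "sublinear q" "0 \<le> s" shows "- q (- x) \<le> q (x + s *\<^sub>R a) - s * q a"
  using sublinear_add[OF assms(1), of "x + s *\<^sub>R a" "- x"] sublinear_scale[OF assms, of a] by simp

lemma support_face_le:
  assumes "sublinear q" "0 \<le> s" shows "support_face q a x \<le> q (x + s *\<^sub>R a) - s * q a"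
  unfolding support_face_def
  by (rule cINF_lower) (use assms support_face_lower in \<open>auto intro!: bdd_belowI2\<close>)

lemma support_face_greatest:
  assumes "\<And>s. 0 \<le> s \<Longrightarrow> m \<le> q (x + s *\<^sub>R a) - s * q a" shows "m \<le> support_face q a x"
  unfolding support_face_def by (rule cINF_greatest) (use assms in auto)

lemma sublinear_support_face:
  assumes q: "sublinear q" shows "sublinear (support_face q a)"
  unfolding sublinear_def
proof (intro conjI allI impI)
  fix x y
  have *: "support_face q a (x + y) \<le> (q (x + s *\<^sub>R a) - s * q a) + (q (y + s' *\<^sub>R a) - s' * q a)"
    if "0 \<le> s" "0 \<le> s'" for s s' :: real
    using support_face_le[OF q, of "s + s'" a "x + y"] that
      sublinear_add[OF q, of "x + s *\<^sub>R a" "y + s' *\<^sub>R a"]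
    by (simp add: algebra_simps)
  have "support_face q a (x + y) - (q (x + s *\<^sub>R a) - s * q a) \<le> support_face q a y" if "0 \<le> s" for s
    by (rule support_face_greatest) (use *[OF that] in \<open>auto simp: algebra_simps\<close>)
  then have "support_face q a (x + y) - support_face q a y \<le> support_face q a x"
    by (intro support_face_greatest) (auto simp: algebra_simps)
  then show "support_face q a (x + y) \<le> support_face q a x + support_face q a y" by simp
next
  fix r :: real and x assume r: "0 < r"
  have "support_face q a (r *\<^sub>R x) / r \<le> support_face q a x"
  proof (rule support_face_greatest)
    fix s :: real assume s: "0 \<le> s"
    have "r *\<^sub>R x + (r * s) *\<^sub>R a = r *\<^sub>R (x + s *\<^sub>R a)" by (simp add: scaleR_add_right)
    then have "support_face q a (r *\<^sub>R x) \<le> r * (q (x + s *\<^sub>R a) - s * q a)"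
      using support_face_le[OF q, of "r * s" a "r *\<^sub>R x"] r s sublinear_scale[OF q, of r "x + s *\<^sub>R a"]
      by (simp add: algebra_simps)
    then show "support_face q a (r *\<^sub>R x) / r \<le> q (x + s *\<^sub>R a) - s * q a"
      using r by (simp add: field_simps)
  qed
  then show "support_face q a (r *\<^sub>R x) \<le> r * support_face q a x" using r by (simp add: field_simps)
qed

lemma support_face_le_self: "sublinear q \<Longrightarrow> support_face q a x \<le> q x"
  using support_face_le[of q 0 a x] by simp

lemma support_face_direction: "sublinear q \<Longrightarrow> support_face q a (- a) \<le> - q a"
  using support_face_le[of q 1 a "- a"] by (simp add: sublinear_zero)

lemma linear_le_support_face:
  assumes "linear \<psi>" "\<And>x. \<psi> x \<le> q x" "\<psi> a = q a"
  shows "\<psi> x \<le> support_face q a x"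
proof (rule support_face_greatest)
  fix s :: real
  have "\<psi> x = \<psi> (x + s *\<^sub>R a) - s * q a"
    using assms(1,3) by (simp add: linear_add linear_scale)
  then show "\<psi> x \<le> q (x + s *\<^sub>R a) - s * q a" using assms(2)[of "x + s *\<^sub>R a"] by simp
qed

text \<open>The linear functionals below \<open>q\<close> form a face of the convex set of those below \<open>p\<close>.\<close>

definition face_below :: "('a::real_vector \<Rightarrow> real) \<Rightarrow> ('a \<Rightarrow> real) \<Rightarrow> bool" where
  "face_below p q \<longleftrightarrow> (\<forall>t \<psi>1 \<psi>2. 0 < t \<and> t < 1 \<and> linear \<psi>1 \<and> linear \<psi>2 \<and>
     (\<forall>x. \<psi>1 x \<le> p x) \<and> (\<forall>x. \<psi>2 x \<le> p x) \<and> (\<forall>x. t * \<psi>1 x + (1 - t) * \<psi>2 x \<le> q x)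
     \<longrightarrow> (\<forall>x. \<psi>1 x \<le> q x) \<and> (\<forall>x. \<psi>2 x \<le> q x))"

lemma face_belowD:
  assumes "face_below p q" "0 < t" "t < 1" "linear \<psi>1" "linear \<psi>2"
    "\<And>x. \<psi>1 x \<le> p x" "\<And>x. \<psi>2 x \<le> p x" "\<And>x. t * \<psi>1 x + (1 - t) * \<psi>2 x \<le> q x"
  shows "\<psi>1 x \<le> q x" "\<psi>2 x \<le> q x"
  using assms unfolding face_below_def by blast+

lemma face_below_self:
  assumes "\<And>x. q x = p x" shows "face_below p q"
  using assms by (simp add: face_below_def)

text \<open>A convex combination that attains the maximum at \<open>a\<close> forces both of its members to attain it.\<close>

lemma face_below_support_face:
  assumes q: "sublinear q" and face: "face_below p q"
  shows "face_below p (support_face q a)"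
  unfolding face_below_def
proof (intro allI impI, elim conjE)
  fix t :: real and \<psi>1 \<psi>2 :: "'a \<Rightarrow> real"
  assume t: "0 < t" "t < 1" and lin: "linear \<psi>1" "linear \<psi>2"
    and "\<forall>x. \<psi>1 x \<le> p x" "\<forall>x. \<psi>2 x \<le> p x"
    and le: "\<forall>x. t * \<psi>1 x + (1 - t) * \<psi>2 x \<le> support_face q a x"
  then have le_q: "\<psi>1 x \<le> q x" "\<psi>2 x \<le> q x" for x
    using face_belowD[OF face t lin, of x] order_trans[OF le[rule_format] support_face_le_self[OF q]]
    by auto
  have "t * \<psi>1 (- a) + (1 - t) * \<psi>2 (- a) \<le> - q a"
    using le support_face_direction[OF q] order_trans by blast
  then have "t * (q a - \<psi>1 a) + (1 - t) * (q a - \<psi>2 a) \<le> 0"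
    using lin by (simp add: linear_neg algebra_simps)
  moreover have "0 \<le> t * (q a - \<psi>1 a)" "0 \<le> (1 - t) * (q a - \<psi>2 a)"
    using t le_q[of a] by simp_all
  ultimately have "t * (q a - \<psi>1 a) = 0" "(1 - t) * (q a - \<psi>2 a) = 0" by linarith+
  then have "\<psi>1 a = q a" "\<psi>2 a = q a" using t by simp_all
  then show "(\<forall>x. \<psi>1 x \<le> support_face q a x) \<and> (\<forall>x. \<psi>2 x \<le> support_face q a x)"
    using lin le_q linear_le_support_face by metis
qed

lemma linear_face_extreme:
  assumes face: "face_below p \<phi>" and \<phi>: "linear \<phi>" and t: "0 < t" "t < 1"
    and \<psi>: "linear \<psi>1" "linear \<psi>2" "\<And>x. \<psi>1 x \<le> p x" "\<And>x. \<psi>2 x \<le> p x"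
    and eq: "\<And>x. \<phi> x = t * \<psi>1 x + (1 - t) * \<psi>2 x"
  shows "\<psi>1 = \<phi>"
proof -
  have "\<psi>1 x \<le> \<phi> x" for x by (rule face_belowD(1)[OF face t \<psi>]) (simp add: eq)
  from this this[of "- _"] show ?thesis
    using \<phi> \<psi>(1) by (intro ext antisym) (auto simp: linear_neg)
qed

text \<open>Among the sublinear functionals that cut out a face, start with the face on which the value at
  \<open>h\<close> is maximal and take a minimal one by Zorn's lemma; infima of chains stay in the family. A
  minimal one cannot be refined by exposing a further face, and this makes it linear.\<close>

theorem extreme_functional:
  fixes p :: "'a::real_vector \<Rightarrow> real"
  assumes p: "sublinear p"
  obtains \<phi> where "linear \<phi>" "\<And>x. \<phi> x \<le> p x" "\<phi> h = p h" "face_below p \<phi>"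
proof -
  define \<P> where "\<P> = {q. sublinear q \<and> (\<forall>x. q x \<le> p x) \<and> q (- h) \<le> - p h \<and> face_below p q}"
  define geq where "geq q r \<longleftrightarrow> (\<forall>x. r x \<le> q x)" for q r :: "'a \<Rightarrow> real"
  have start: "support_face p h \<in> \<P>"
    by (simp add: \<P>_def p sublinear_support_face support_face_le_self support_face_direction
        face_below_support_face face_below_self)
  have "\<exists>m\<in>\<P>. \<forall>q\<in>\<P>. geq m q \<longrightarrow> q = m"
  proof (rule predicate_Zorn)
    show "partial_order_on \<P> (relation_of geq \<P>)"
      by (rule partial_order_on_relation_ofI) (auto simp: geq_def fun_eq_iff intro: order_trans antisym)
    fix C assume C: "C \<in> Chains (relation_of geq \<P>)"
    then have C\<P>: "q \<in> \<P>" if "q \<in> C" for q using that by (auto simp: Chains_def relation_of_def)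
    have chain: "geq q r \<or> geq r q" if "q \<in> C" "r \<in> C" for q r
      using C that by (auto simp: Chains_def relation_of_def)
    show "\<exists>u\<in>\<P>. \<forall>q\<in>C. geq q u"
    proof (cases "C = {}")
      case True
      then show ?thesis using start by blast
    next
      case False
      then obtain q0 where q0: "q0 \<in> C" by blast
      define u where "u x = (INF q\<in>C. q x)" for x
      have "- p (- x) \<le> q x" if "q \<in> C" for q x
        using C\<P>[OF that] sublinear_minus[of q x] unfolding \<P>_def
        by (metis (mono_tags, lifting) mem_Collect_eq neg_le_iff_le order_trans)
      then have u_le: "u x \<le> q x" if "q \<in> C" for q x
        unfolding u_def using that by (intro cINF_lower) (auto intro!: bdd_belowI2)
      have u_ge: "m \<le> u x" if "\<And>q. q \<in> C \<Longrightarrow> m \<le> q x" for m x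
        unfolding u_def by (rule cINF_greatest) (use False that in auto)
      have le_sum: "u (x + y) \<le> q x + r y" if qr: "q \<in> C" "r \<in> C" for q r x y
      proof -
        obtain s where s: "s \<in> C" "s x \<le> q x" "s y \<le> r y"
          using chain[OF qr] \<open>q \<in> C\<close> \<open>r \<in> C\<close> unfolding geq_def by blast
        have "u (x + y) \<le> s x + s y"
          using u_le[OF s(1), of "x + y"] C\<P>[OF s(1)] sublinear_add[of s x y] by (simp add: \<P>_def)
        then show ?thesis using s by simp
      qed
      have "u (x + y) - q x \<le> u y" if "q \<in> C" for q x y
        by (rule u_ge) (use le_sum[OF that] in \<open>simp add: algebra_simps\<close>)
      then have "u (x + y) - u y \<le> u x" for x y
        by (intro u_ge) (simp add: algebra_simps)
      then have "u (x + y) \<le> u x + u y" for x y by (simp add: algebra_simps)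
      moreover have "u (r *\<^sub>R x) \<le> r * u x" if r: "0 < r" for r x
      proof -
        have "u (r *\<^sub>R x) / r \<le> q x" if "q \<in> C" for q
          using u_le[OF that, of "r *\<^sub>R x"] C\<P>[OF that] r
          by (simp add: \<P>_def sublinear_scale field_simps)
        then have "u (r *\<^sub>R x) / r \<le> u x" by (rule u_ge)
        then show ?thesis using r by (simp add: field_simps)
      qed
      ultimately have "sublinear u" by (simp add: sublinear_def)
      moreover have "face_below p u"
        unfolding face_below_def
      proof (intro allI impI, elim conjE)
        fix t :: real and \<psi>1 \<psi>2 :: "'a \<Rightarrow> real"
        assume *: "0 < t" "t < 1" "linear \<psi>1" "linear \<psi>2" "\<forall>x. \<psi>1 x \<le> p x" "\<forall>x. \<psi>2 x \<le> p x"
          and le: "\<forall>x. t * \<psi>1 x + (1 - t) * \<psi>2 x \<le> u x"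
        have "\<psi>1 x \<le> q x \<and> \<psi>2 x \<le> q x" if "q \<in> C" for q x
        proof -
          have "face_below p q" using C\<P>[OF that] by (simp add: \<P>_def)
          moreover have "t * \<psi>1 x + (1 - t) * \<psi>2 x \<le> q x" for x
            using le u_le[OF that] order_trans by blast
          ultimately show ?thesis using face_belowD[of p q t \<psi>1 \<psi>2 x] * by blast
        qed
        then show "(\<forall>x. \<psi>1 x \<le> u x) \<and> (\<forall>x. \<psi>2 x \<le> u x)" using u_ge by blast
      qed
      moreover have "u x \<le> p x" for x
        using u_le[OF q0, of x] C\<P>[OF q0] order_trans by (fastforce simp: \<P>_def)
      moreover have "u (- h) \<le> - p h"
        using u_le[OF q0, of "- h"] C\<P>[OF q0] by (auto simp: \<P>_def)
      ultimately have "u \<in> \<P>" by (simp add: \<P>_def)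
      then show ?thesis using u_le by (auto simp: geq_def)
    qed
  qed
  then obtain \<phi> where \<phi>: "\<phi> \<in> \<P>" and min: "\<And>q. q \<in> \<P> \<Longrightarrow> (\<And>x. q x \<le> \<phi> x) \<Longrightarrow> q = \<phi>"
    unfolding geq_def by blast
  have sub: "sublinear \<phi>" and le: "\<And>x. \<phi> x \<le> p x" and h: "\<phi> (- h) \<le> - p h" and face: "face_below p \<phi>"
    using \<phi> by (auto simp: \<P>_def)
  \<comment> \<open>Exposing a face of a minimal element changes nothing, which forces oddness.\<close>
  have odd: "\<phi> (- a) = - \<phi> a" for a
  proof -
    have "support_face \<phi> a \<in> \<P>"
      using sub face h le support_face_le_self[OF sub]
      by (auto simp: \<P>_def sublinear_support_face face_below_support_face intro: order_trans)
    then have "support_face \<phi> a = \<phi>" using min support_face_le_self[OF sub] by blast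
    then have "\<phi> (- a) \<le> - \<phi> a" using support_face_direction[OF sub, of a] by simp
    then show ?thesis using sublinear_minus[OF sub, of a] by simp
  qed
  have lin: "linear \<phi>"
  proof (rule linearI)
    fix x y
    show "\<phi> (x + y) = \<phi> x + \<phi> y"
      using sublinear_add[OF sub, of x y] sublinear_add[OF sub, of "- x" "- y"] odd[of "x + y"] odd
      by simp
  next
    fix r :: real and x
    show "\<phi> (r *\<^sub>R x) = r *\<^sub>R \<phi> x"
      using sublinear_scale[OF sub, of r x] sublinear_scale[OF sub, of "- r" x] odd[of "r *\<^sub>R x"]
      by (cases "0 \<le> r") auto
  qed
  have "\<phi> h = p h" using le[of h] h odd[of h] by simp
  with lin le show ?thesis using face by (rule that)
qed

section \<open>Representations on closed subspaces\<close>

lemma csubspace_closure: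
  fixes S :: "'h::complex_normed_vector set"
  assumes "csubspace S" shows "csubspace (closure S)"
proof (rule complex_vector.subspaceI)
  show "0 \<in> closure S" using complex_vector.subspace_0[OF assms] closure_subset by blast
next
  fix x y assume "x \<in> closure S" "y \<in> closure S"
  then obtain X Y where X: "\<And>n. X n \<in> S" "X \<longlonglongrightarrow> x" and Y: "\<And>n. Y n \<in> S" "Y \<longlonglongrightarrow> y"
    unfolding closure_sequential by blast
  have "(\<lambda>n. X n + Y n) \<longlonglongrightarrow> x + y" by (intro tendsto_intros X Y)
  moreover have "X n + Y n \<in> S" for n using complex_vector.subspace_add[OF assms X(1) Y(1)] .
  ultimately show "x + y \<in> closure S"
    unfolding closure_sequential by (intro exI[of _ "\<lambda>n. X n + Y n"]) simp
next
  fix c x assume "x \<in> closure S"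
  then obtain X where X: "\<And>n. X n \<in> S" "X \<longlonglongrightarrow> x" unfolding closure_sequential by blast
  have "(\<lambda>n. c *\<^sub>C X n) \<longlonglongrightarrow> c *\<^sub>C x" by (intro tendsto_intros X)
  moreover have "c *\<^sub>C X n \<in> S" for n using complex_vector.subspace_scale[OF assms X(1)] .
  ultimately show "c *\<^sub>C x \<in> closure S"
    unfolding closure_sequential by (intro exI[of _ "\<lambda>n. c *\<^sub>C X n"]) simp
qed

locale representation =
  fixes K :: "'h::complex_hilbert_space set"
    and \<pi> :: "'a::unital_cstar_algebra \<Rightarrow> 'h \<Rightarrow> 'h"
  assumes rep: "representation_on K \<pi>"
begin

lemma closed: "closed K" and subspace: "csubspace K"
  using rep by (simp_all add: representation_on_def)

lemma into: "x \<in> K \<Longrightarrow> \<pi> a x \<in> K"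
  and add_vec: "x \<in> K \<Longrightarrow> y \<in> K \<Longrightarrow> \<pi> a (x + y) = \<pi> a x + \<pi> a y"
  and scale_vec: "x \<in> K \<Longrightarrow> \<pi> a (c *\<^sub>C x) = c *\<^sub>C \<pi> a x"
  and bounded: "\<exists>B. \<forall>x\<in>K. norm (\<pi> a x) \<le> B * norm x"
  using rep unfolding representation_on_def bounded_clinear_on_def by blast+

lemma add: "x \<in> K \<Longrightarrow> \<pi> (a + b) x = \<pi> a x + \<pi> b x"
  and scale: "x \<in> K \<Longrightarrow> \<pi> (c *\<^sub>C a) x = c *\<^sub>C \<pi> a x"
  and mult: "x \<in> K \<Longrightarrow> \<pi> (a * b) x = \<pi> a (\<pi> b x)"
  and adjoint: "x \<in> K \<Longrightarrow> y \<in> K \<Longrightarrow> cinner (\<pi> a x) y = cinner x (\<pi> (star a) y)"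
  using rep by (simp_all add: representation_on_def)

lemmas subspace_rules = complex_vector.subspace_0[OF subspace] complex_vector.subspace_add[OF subspace]
  complex_vector.subspace_diff[OF subspace] complex_vector.subspace_scale[OF subspace]

lemma zero_vec: "\<pi> a 0 = 0"
  using scale_vec[of 0 a 0] subspace_rules(1) by simp

lemma diff_vec: "x \<in> K \<Longrightarrow> y \<in> K \<Longrightarrow> \<pi> a (x - y) = \<pi> a x - \<pi> a y"
  using add_vec[of "x - y" y a] subspace_rules(3)[of x y] by (simp add: algebra_simps)

lemma minus: "x \<in> K \<Longrightarrow> \<pi> (- a) x = - \<pi> a x"
  using scale[of x "-1" a] by simp

lemma diff: "x \<in> K \<Longrightarrow> \<pi> (a - b) x = \<pi> a x - \<pi> b x"
  using add[of x a "- b"] by (simp add: minus)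

lemma continuous: "continuous_on K (\<pi> a)"
proof -
  obtain B where B: "\<And>x. x \<in> K \<Longrightarrow> norm (\<pi> a x) \<le> B * norm x" using bounded by blast
  have "dist (\<pi> a x) (\<pi> a y) \<le> \<bar>B\<bar> * dist x y" if "x \<in> K" "y \<in> K" for x y
  proof -
    have "norm (\<pi> a (x - y)) \<le> B * norm (x - y)" by (intro B subspace_rules that)
    also have "\<dots> \<le> \<bar>B\<bar> * norm (x - y)" by (intro mult_right_mono) auto
    finally show ?thesis using that by (simp add: dist_norm diff_vec)
  qed
  then have "\<bar>B\<bar>-lipschitz_on K (\<pi> a)" by (intro lipschitz_onI) auto
  then show ?thesis by (rule lipschitz_on_continuous_on)
qed

lemma norm_square: "x \<in> K \<Longrightarrow> Re (cinner (\<pi> (star a * a) x) x) = (norm (\<pi> a x))\<^sup>2"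
  by (simp add: mult into adjoint star_star norm_eq_cinner)

end

section \<open>The Gelfand-Naimark-Segal construction\<close>

lemma separable_sequence:
  assumes "separable_space (euclidean :: 'a::metric_space topology)"
  obtains s :: "nat \<Rightarrow> 'a::metric_space" where "\<And>x e. 0 < e \<Longrightarrow> \<exists>n. dist x (s n) < e"
proof -
  obtain C :: "'a set" where C: "countable C" "closure C = UNIV"
    using assms unfolding separable_space_def by auto
  have "C \<noteq> {}" using C(2) by auto
  have "\<exists>n. dist x (from_nat_into C n) < e" if e: "0 < e" for x e
  proof -
    have "x \<in> closure C" using C(2) by simp
    then obtain y where "y \<in> C" "dist y x < e" using e closure_approachable by metis
    then show ?thesis using from_nat_into_surj[OF C(1)] by (metis dist_commute)
  qed
  then show ?thesis by (rule that)
qed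

text \<open>The operator \<open>\<sigma> a\<close> extends \<open>v b \<mapsto> v (a * b)\<close> from the range of \<open>v\<close> to its closure. It is
  specified by its inner products with the vectors \<open>v b\<close>, which determine an element of the closure
  uniquely: existence is the only analytic step, and linearity, multiplicativity and the adjoint
  relation are identities between inner products.\<close>

theorem (in positive_functional) GNS:
  assumes sep: "separable_space (euclidean :: 'a topology)"
  obtains v :: "'a \<Rightarrow> 'a ell2" and \<sigma> where
    "\<And>a b. cinner (v a) (v b) = f (star b * a)"
    "representation_on (closure (range v)) \<sigma>" "\<And>a b. \<sigma> a (v b) = v (a * b)"
proof -
  obtain s :: "nat \<Rightarrow> 'a" where s: "\<And>x e. 0 < e \<Longrightarrow> \<exists>n. dist x (s n) < e"
    by (rule separable_sequence[OF sep]) (rule that)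
  have dense: "\<exists>n. Re (f (star (x - s n) * (x - s n))) < \<epsilon>" if \<epsilon>: "0 < \<epsilon>" for x \<epsilon>
  proof -
    have f1: "0 \<le> Re (f 1)" using positive[of 1] by simp
    obtain n where n: "norm (x - s n) < sqrt (\<epsilon> / (Re (f 1) + 1))"
      using s[of "sqrt (\<epsilon> / (Re (f 1) + 1))" x] \<epsilon> f1 by (auto simp: dist_norm)
    then have "(norm (x - s n))\<^sup>2 < \<epsilon> / (Re (f 1) + 1)"
      by (metis not_le norm_ge_zero real_le_lsqrt)
    then have "(norm (x - s n))\<^sup>2 * (Re (f 1) + 1) < \<epsilon>" using f1 by (simp add: field_simps)
    then have "(norm (x - s n))\<^sup>2 * Re (f 1) < \<epsilon>" by (simp add: distrib_left) (smt (verit) zero_le_power2)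
    then show ?thesis using square_bound[of "x - s n"] by (intro exI[of _ n]) linarith
  qed
  obtain v :: "'a \<Rightarrow> 'a ell2" where v: "\<And>x y. v (x + y) = v x + v y"
    "\<And>c x. v (c *\<^sub>C x) = c *\<^sub>C v x" "\<And>a b. cinner (v a) (v b) = f (star b * a)"
    by (rule form.ell2_embedding[OF dense infinite_UNIV_char_0]) (assumption, rule that)
  define K where "K = closure (range v)"
  have v_diff: "v (a - b) = v a - v b" for a b
    unfolding eq_diff_eq using v(1)[of "a - b" b, symmetric] by (simp only: diff_add_cancel)
  have v_K: "v a \<in> K" for a unfolding K_def using closure_subset[of "range v"] by (rule subsetD) simp
  have "csubspace (range v)"
  proof (rule complex_vector.subspaceI)
    show "0 \<in> range v" using v(2)[of 0 0] by (metis complex_vector.scale_zero_left rangeI)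
  qed (auto simp: v(1,2)[symmetric])
  then have K: "csubspace K" unfolding K_def by (rule csubspace_closure)
  have orth: "z = 0" if "z \<in> K" "\<And>b. cinner z (v b) = 0" for z
  proof -
    have "closed {w. cinner z w = 0}" by (intro closed_Collect_eq continuous_intros)
    then have "K \<subseteq> {w. cinner z w = 0}" unfolding K_def using that(2) by (intro closure_minimal) auto
    then show ?thesis using that(1) cinner_zero_iff by blast
  qed
  have uniq: "z = z'" if "z \<in> K" "z' \<in> K" "\<And>b. cinner z (v b) = cinner z' (v b)" for z z'
    using orth[of "z - z'"] that complex_vector.subspace_diff[OF K] by (simp add: hilbert.diff_left)
  have norm_v: "norm (v (a * b)) \<le> norm a * norm (v b)" for a b
  proof (rule power2_le_imp_le)
    show "(norm (v (a * b)))\<^sup>2 \<le> (norm a * norm (v b))\<^sup>2"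
      using conjugate_bound[of b a] by (simp add: norm_eq_cinner v(3) star_mult mult.assoc power_mult_distrib)
  qed simp
  have adj_v: "cinner (v (a * b)) (v c) = cinner (v b) (v (star a * c))" for a b c
    by (simp add: v(3) star_mult star_star mult.assoc)
  have ex: "\<exists>z. z \<in> K \<and> (\<forall>b. cinner z (v b) = cinner x (v (star a * b))) \<and> norm z \<le> norm a * norm x"
    if x: "x \<in> K" for a x
  proof -
    obtain X where X: "\<forall>n. X n \<in> range v" "X \<longlonglongrightarrow> x"
      using x unfolding K_def closure_sequential by blast
    then have "\<forall>n. \<exists>b. X n = v b" by blast
    then obtain b where "\<forall>n. X n = v (b n)" by (rule choice[THEN exE])
    then have "X = (\<lambda>n. v (b n))" by (intro ext) simp
    then have b: "(\<lambda>n. v (b n)) \<longlonglongrightarrow> x" using X(2) by simp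
    have "Cauchy (\<lambda>n. v (a * b n))"
    proof (rule metric_CauchyI)
      fix e :: real assume e: "0 < e"
      have "Cauchy (\<lambda>n. v (b n))" using b by (rule LIMSEQ_imp_Cauchy)
      then obtain M where M: "\<And>m n. m \<ge> M \<Longrightarrow> n \<ge> M \<Longrightarrow> dist (v (b m)) (v (b n)) < e / (norm a + 1)"
        using e metric_CauchyD[of "\<lambda>n. v (b n)" "e / (norm a + 1)"] by (auto simp: add_nonneg_pos)
      have "dist (v (a * b m)) (v (a * b n)) < e" if "m \<ge> M" "n \<ge> M" for m n
      proof -
        have "dist (v (a * b m)) (v (a * b n)) \<le> norm a * dist (v (b m)) (v (b n))"
          using norm_v[of a "b m - b n"] by (simp add: dist_norm v_diff right_diff_distrib)
        also have "\<dots> \<le> norm a * (e / (norm a + 1))"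
          using M[OF that] by (intro mult_left_mono) auto
        also have "\<dots> < e"
        proof -
          have "0 < norm a + 1" by (simp add: add_nonneg_pos)
          then show ?thesis using e by (simp add: field_simps)
        qed
        finally show ?thesis .
      qed
      then show "\<exists>M. \<forall>m\<ge>M. \<forall>n\<ge>M. dist (v (a * b m)) (v (a * b n)) < e" by blast
    qed
    then obtain z where z: "(\<lambda>n. v (a * b n)) \<longlonglongrightarrow> z" using Cauchy_convergent convergent_def by blast
    have "z \<in> K" using closed_sequentially[OF _ v_K z] by (simp add: K_def)
    moreover have "cinner z (v c) = cinner x (v (star a * c))" for c
    proof (rule LIMSEQ_unique)
      show "(\<lambda>n. cinner (v (a * b n)) (v c)) \<longlonglongrightarrow> cinner z (v c)" by (intro tendsto_intros z)
      show "(\<lambda>n. cinner (v (a * b n)) (v c)) \<longlonglongrightarrow> cinner x (v (star a * c))"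
        unfolding adj_v by (intro tendsto_intros b)
    qed
    moreover have "norm z \<le> norm a * norm x"
    proof (rule LIMSEQ_le)
      show "(\<lambda>n. norm (v (a * b n))) \<longlonglongrightarrow> norm z" by (intro tendsto_intros z)
      show "(\<lambda>n. norm a * norm (v (b n))) \<longlonglongrightarrow> norm a * norm x" by (intro tendsto_intros b)
    qed (use norm_v in auto)
    ultimately show ?thesis by blast
  qed
  define \<sigma> where "\<sigma> a x = (SOME z. z \<in> K \<and> (\<forall>b. cinner z (v b) = cinner x (v (star a * b)))
    \<and> norm z \<le> norm a * norm x)" for a x
  have \<sigma>: "\<sigma> a x \<in> K" "\<And>b. cinner (\<sigma> a x) (v b) = cinner x (v (star a * b))"
    "norm (\<sigma> a x) \<le> norm a * norm x" if "x \<in> K" for a x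
    using someI_ex[OF ex[OF that, of a]] unfolding \<sigma>_def[symmetric] by blast+
  note K_rules = complex_vector.subspace_add[OF K] complex_vector.subspace_scale[OF K]
  note inner_rules = hilbert.add_left hilbert.scale_left hilbert.add_right hilbert.scale_right
  have \<sigma>_v: "\<sigma> a (v b) = v (a * b)" for a b
    by (rule uniq) (simp_all add: \<sigma> v_K adj_v)
  have "representation_on K \<sigma>"
    unfolding representation_on_def bounded_clinear_on_def
  proof (intro conjI allI ballI)
    show "closed K" by (simp add: K_def)
    fix a x assume x: "x \<in> K"
    show "\<sigma> a x \<in> K" by (rule \<sigma>(1)[OF x])
    show "\<sigma> a (x + y) = \<sigma> a x + \<sigma> a y" if "y \<in> K" for y
      by (rule uniq) (simp_all add: \<sigma> x that K_rules inner_rules)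
    show "\<sigma> a (c *\<^sub>C x) = c *\<^sub>C \<sigma> a x" for c
      by (rule uniq) (simp_all add: \<sigma> x K_rules inner_rules)
    show "\<sigma> (a + b) x = \<sigma> a x + \<sigma> b x" for b
      by (rule uniq) (simp_all add: \<sigma> x K_rules inner_rules star_add distrib_right v(1))
    show "\<sigma> (c *\<^sub>C a) x = c *\<^sub>C \<sigma> a x" for c
      by (rule uniq) (simp_all add: \<sigma> x K_rules inner_rules star_scaleC scaleC_mult_left v(2))
    show "\<sigma> (a * b) x = \<sigma> a (\<sigma> b x)" for b
      by (rule uniq) (simp_all add: \<sigma> x star_mult mult.assoc)
    have "closed {y \<in> K. cinner (\<sigma> a x) y = cinner x (\<sigma> (star a) y)}"
    proof -
      have "(norm (star a))-lipschitz_on K (\<sigma> (star a))"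
      proof (rule lipschitz_onI)
        fix y z assume yz: "y \<in> K" "z \<in> K"
        have "\<sigma> (star a) (y - z) = \<sigma> (star a) y - \<sigma> (star a) z"
          by (rule uniq) (simp_all add: \<sigma> yz complex_vector.subspace_diff[OF K] hilbert.diff_left)
        then show "dist (\<sigma> (star a) y) (\<sigma> (star a) z) \<le> norm (star a) * dist y z"
          using \<sigma>(3)[OF complex_vector.subspace_diff[OF K yz], of "star a"] by (simp add: dist_norm)
      qed simp
      then have "continuous_on K (\<sigma> (star a))" by (rule lipschitz_on_continuous_on)
      then show ?thesis
        using continuous_closed_preimage_constant[of K
            "\<lambda>y. cinner (\<sigma> a x) y - cinner x (\<sigma> (star a) y)" 0]
        by (simp add: K_def continuous_intros)
    qed
    then have "K \<subseteq> {y \<in> K. cinner (\<sigma> a x) y = cinner x (\<sigma> (star a) y)}"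
      unfolding K_def[symmetric] by (subst K_def, intro closure_minimal) (auto simp: v_K \<sigma> x \<sigma>_v)
    then show "cinner (\<sigma> a x) y = cinner x (\<sigma> (star a) y)" if "y \<in> K" for y using that by blast
  next
    fix a show "\<exists>B. \<forall>x\<in>K. norm (\<sigma> a x) \<le> B * norm x" using \<sigma>(3) by blast
  qed (fact K)
  with v(3) \<sigma>_v show ?thesis using that unfolding K_def by blast
qed

section \<open>Irreducible representations separate points\<close>

text \<open>The functionals below \<open>numrange_sup K \<pi>\<close> are real parts of those states of the algebra that factor
  through \<open>\<pi>\<close>.\<close>

definition numrange_sup :: "'h::complex_hilbert_space set \<Rightarrow> ('a \<Rightarrow> 'h \<Rightarrow> 'h) \<Rightarrow> 'a \<Rightarrow> real" where
  "numrange_sup K \<pi> a = (SUP y\<in>{y \<in> K. norm y = 1}. Re (cinner (\<pi> a y) y))"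

context representation
begin

lemma Re_cinner_le_numrange_sup:
  assumes "y \<in> K" shows "Re (cinner (\<pi> a y) y) \<le> numrange_sup K \<pi> a * (norm y)\<^sup>2"
proof (cases "y = 0")
  case False
  obtain B where B: "\<And>x. x \<in> K \<Longrightarrow> norm (\<pi> a x) \<le> B * norm x" using bounded by blast
  have "Re (cinner (\<pi> a x) x) \<le> B" if "x \<in> K" "norm x = 1" for x
    using complex_Re_le_cmod[of "cinner (\<pi> a x) x"] Cauchy_Schwarz_norm[of "\<pi> a x" x] B[OF that(1)] that(2)
    by simp
  then have bdd: "bdd_above ((\<lambda>y. Re (cinner (\<pi> a y) y)) ` {y \<in> K. norm y = 1})"
    by (intro bdd_aboveI2) auto
  define c where "c = complex_of_real (1 / norm y)"
  have "c *\<^sub>C y \<in> {y \<in> K. norm y = 1}"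
    using assms False by (simp add: c_def subspace_rules norm_scaleC norm_divide)
  then have "Re (cinner (\<pi> a (c *\<^sub>C y)) (c *\<^sub>C y)) \<le> numrange_sup K \<pi> a"
    unfolding numrange_sup_def by (intro cSUP_upper bdd)
  moreover have "cinner (\<pi> a (c *\<^sub>C y)) (c *\<^sub>C y)
      = complex_of_real (1 / (norm y)\<^sup>2) * cinner (\<pi> a y) y"
    using assms by (simp add: scale_vec hilbert.scale_left hilbert.scale_right c_def power2_eq_square)
  ultimately show ?thesis using False by (simp add: field_simps)
qed (simp add: zero_vec)

lemma numrange_sup_least:
  assumes "K \<noteq> {0}" "\<And>y. y \<in> K \<Longrightarrow> norm y = 1 \<Longrightarrow> Re (cinner (\<pi> a y) y) \<le> m"
  shows "numrange_sup K \<pi> a \<le> m"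
proof -
  obtain y where y: "y \<in> K" "y \<noteq> 0" using assms(1) subspace_rules(1) by blast
  then have "complex_of_real (1 / norm y) *\<^sub>C y \<in> {y \<in> K. norm y = 1}"
    by (simp add: subspace_rules norm_scaleC norm_divide)
  then show ?thesis unfolding numrange_sup_def using assms(2) by (intro cSUP_least) auto
qed

lemma sublinear_numrange_sup:
  assumes "K \<noteq> {0}" shows "sublinear (numrange_sup K \<pi>)"
  unfolding sublinear_def
proof (intro conjI allI impI)
  fix a b
  show "numrange_sup K \<pi> (a + b) \<le> numrange_sup K \<pi> a + numrange_sup K \<pi> b"
  proof (rule numrange_sup_least[OF assms])
    fix y assume y: "y \<in> K" "norm y = 1"
    then show "Re (cinner (\<pi> (a + b) y) y) \<le> numrange_sup K \<pi> a + numrange_sup K \<pi> b"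
      using Re_cinner_le_numrange_sup[OF y(1), of a] Re_cinner_le_numrange_sup[OF y(1), of b]
      by (simp add: add hilbert.add_left)
  qed
next
  fix r :: real and a assume "0 < r"
  show "numrange_sup K \<pi> (r *\<^sub>R a) \<le> r * numrange_sup K \<pi> a"
  proof (rule numrange_sup_least[OF assms])
    fix y assume y: "y \<in> K" "norm y = 1"
    then show "Re (cinner (\<pi> (r *\<^sub>R a) y) y) \<le> r * numrange_sup K \<pi> a"
      using Re_cinner_le_numrange_sup[OF y(1), of a] \<open>0 < r\<close>
      by (simp add: scaleR_scaleC scale hilbert.scale_left)
  qed
qed

text \<open>Domination at \<open>a\<close> and \<open>- a\<close> determines \<open>\<phi> a\<close> whenever the real part of the numerical range of
  \<open>\<pi> a\<close> is a single point. This gives the value at the unit and shows that \<open>\<phi>\<close> vanishes at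
  \<open>star a - a\<close>, so that \<open>f\<close> is hermitian.\<close>

lemma dominated_positive_functional:
  assumes unital: "\<And>x. x \<in> K \<Longrightarrow> \<pi> 1 x = x" and K: "K \<noteq> {0}"
    and \<phi>: "linear \<phi>" "\<And>a. \<phi> a \<le> numrange_sup K \<pi> a"
  defines "f \<equiv> \<lambda>a. Complex (\<phi> a) (- \<phi> (\<i> *\<^sub>C a))"
  shows "positive_functional f" "f 1 = 1"
proof -
  have le: "\<phi> a \<le> m" if "\<And>y. y \<in> K \<Longrightarrow> norm y = 1 \<Longrightarrow> Re (cinner (\<pi> a y) y) \<le> m" for a m
    using \<phi>(2)[of a] numrange_sup_least[OF K that] by linarith
  have eq: "\<phi> a = m" if "\<And>y. y \<in> K \<Longrightarrow> norm y = 1 \<Longrightarrow> Re (cinner (\<pi> a y) y) = m" for a m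
    using le[of a m] le[of "- a" "- m"] that \<phi>(1)
    by (simp add: minus hilbert.minus_left linear_neg)
  note lin = linear_add[OF \<phi>(1)] linear_diff[OF \<phi>(1)] linear_neg[OF \<phi>(1)] linear_scale[OF \<phi>(1)]
  have star: "\<phi> (star a) = \<phi> a" for a
  proof -
    have "Re (cinner (\<pi> (star a - a) y) y) = 0" if "y \<in> K" for y
      using hilbert.commute[of "\<pi> a y" y] that
      by (simp add: diff adjoint[of y y "star a"] star_star hilbert.diff_left)
    then show ?thesis using eq[of "star a - a" 0] by (simp add: lin)
  qed
  have C: "c *\<^sub>C a = Re c *\<^sub>R a + Im c *\<^sub>R (\<i> *\<^sub>C a)" for c and a :: 'a
    unfolding scaleR_scaleC scaleC_scaleC scaleC_add_left[symmetric]
    by (metis complex_eq mult.commute)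
  show "positive_functional f"
  proof
    fix a b :: 'a and c
    show "f (a + b) = f a + f b" by (simp add: f_def lin scaleC_add_right complex_eq_iff)
    have c2: "\<i> *\<^sub>C c *\<^sub>C a = Re c *\<^sub>R (\<i> *\<^sub>C a) - Im c *\<^sub>R a"
      using C[of "\<i> * c" a] by (simp add: scaleC_scaleC)
    show "f (c *\<^sub>C a) = c * f a"
      unfolding f_def c2 unfolding C[of c a] by (simp add: lin complex_eq_iff)
    have "\<i> *\<^sub>C star a = star (- (\<i> *\<^sub>C a))"
      using star_scaleC[of "- \<i>" a] by simp
    then have "\<phi> (\<i> *\<^sub>C star a) = - \<phi> (\<i> *\<^sub>C a)" by (simp only: star lin)
    then show "f (star a) = cnj (f a)" by (simp add: f_def star complex_eq_iff)
    have "\<phi> (- (star a * a)) \<le> 0"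
      by (rule le) (simp add: minus hilbert.minus_left norm_square)
    then show "0 \<le> Re (f (star a * a))" by (simp add: f_def lin)
  qed
  have "\<phi> 1 = 1" by (rule eq) (simp add: unital cinner_self)
  moreover have "\<phi> (\<i> *\<^sub>C 1) = 0"
    by (rule eq) (simp add: scale unital hilbert.scale_left cinner_self)
  ultimately show "f 1 = 1" by (simp add: f_def complex_eq_iff)
qed

end

text \<open>The representation is the GNS representation of an extreme functional \<open>\<phi>\<close>. For an invariant
  subspace \<open>N\<close>, the components \<open>\<xi>1 \<in> N\<close> and \<open>\<xi>2\<close> of the cyclic vector \<open>\<xi>\<close> decompose \<open>\<phi>\<close> as a
  convex combination of the normalised vector functionals of \<open>\<xi>1\<close> and \<open>\<xi>2\<close>. Extremality equates the
  first of these with \<open>\<phi>\<close>, from which \<open>\<xi>1\<close> is a multiple of \<open>\<xi>\<close>; so \<open>N\<close> is trivial.\<close>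

theorem separating_irreducible:
  fixes \<pi> :: "'a::unital_cstar_algebra \<Rightarrow> 'h::complex_hilbert_space \<Rightarrow> 'h"
  assumes sep: "separable_space (euclidean :: 'a topology)"
    and \<pi>: "unital_representation_on K \<pi>" and x: "x \<in> K" "\<pi> b x \<noteq> 0"
  obtains L and \<sigma> :: "'a \<Rightarrow> 'a ell2 \<Rightarrow> 'a ell2" where "irreducible_on L \<sigma>"
    "{a. \<forall>x\<in>K. \<pi> a x = 0} \<subseteq> {a. \<forall>y\<in>L. \<sigma> a y = 0}" "\<exists>y\<in>L. \<sigma> b y \<noteq> 0"
proof -
  interpret \<pi>: representation K \<pi>
    using \<pi> by unfold_locales (simp add: unital_representation_on_def)
  have unital: "\<pi> 1 x = x" if "x \<in> K" for x
    using \<pi> that by (simp add: unital_representation_on_def)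
  have K: "K \<noteq> {0}" using x \<pi>.zero_vec by auto
  let ?p = "numrange_sup K \<pi>"
  obtain \<phi> where \<phi>: "linear \<phi>" "\<And>a. \<phi> a \<le> ?p a" "\<phi> (star b * b) = ?p (star b * b)"
    and face: "face_below ?p \<phi>"
    by (rule extreme_functional[OF \<pi>.sublinear_numrange_sup[OF K], of "star b * b"]) (rule that)
  define f where "f a = Complex (\<phi> a) (- \<phi> (\<i> *\<^sub>C a))" for a
  interpret f: positive_functional f
    unfolding f_def by (rule \<pi>.dominated_positive_functional[OF unital K \<phi>(1,2)])
  have f1: "f 1 = 1"
    unfolding f_def by (rule \<pi>.dominated_positive_functional[OF unital K \<phi>(1,2)])
  have Re_f: "Re (f a) = \<phi> a" for a by (simp add: f_def)
  have le: "\<phi> a \<le> m" if "\<And>y. y \<in> K \<Longrightarrow> Re (cinner (\<pi> a y) y) \<le> m" for a m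
    using \<phi>(2)[of a] \<pi>.numrange_sup_least[OF K that] by linarith
  obtain v :: "'a \<Rightarrow> 'a ell2" and \<sigma> where v: "\<And>a b. cinner (v a) (v b) = f (star b * a)"
    and rep: "representation_on (closure (range v)) \<sigma>" and \<sigma>_v: "\<And>a b. \<sigma> a (v b) = v (a * b)"
    by (rule f.GNS[OF sep]) (rule that)
  define L where "L = closure (range v)"
  interpret \<sigma>: representation L \<sigma> using rep by unfold_locales (simp add: L_def)
  have v_L: "v a \<in> L" for a
    unfolding L_def using closure_subset[of "range v"] by (rule subsetD) simp
  have L_least: "L \<subseteq> C" if "closed C" "\<And>a. v a \<in> C" for C
    unfolding L_def using that by (intro closure_minimal) auto
  have zero: "z = 0" if "z \<in> L" "\<And>a. cinner z (v a) = 0" for z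
  proof -
    have "L \<subseteq> {w. cinner z w = 0}"
      using that(2) by (intro L_least closed_Collect_eq continuous_intros) auto
    then show ?thesis using that(1) cinner_zero_iff by blast
  qed
  define \<xi> where "\<xi> = v 1"
  have v_\<xi>: "v a = \<sigma> a \<xi>" for a by (simp add: \<xi>_def \<sigma>_v)
  have \<xi>: "\<xi> \<in> L" "norm \<xi> = 1"
    using v_L norm_eq_cinner[of \<xi>] power2_eq_imp_eq[of "norm \<xi>" 1] by (simp_all add: \<xi>_def v f1)
  \<comment> \<open>The numerical range of \<open>\<sigma>\<close> is bounded by that of \<open>\<pi>\<close>; this keeps the pieces of \<open>\<phi>\<close>
    found below among the competitors in the extremality of \<open>\<phi>\<close>.\<close>
  have contained: "Re (cinner (\<sigma> a z) z) \<le> ?p a * (norm z)\<^sup>2" if "z \<in> L" for a z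
  proof -
    have "closed {z \<in> L. Re (cinner (\<sigma> a z) z) \<le> ?p a * (norm z)\<^sup>2}"
      by (intro continuous_on_closed_Collect_le continuous_intros \<sigma>.continuous \<sigma>.closed)
    moreover have "Re (cinner (\<sigma> a (v c)) (v c)) \<le> ?p a * (norm (v c))\<^sup>2" for c
    proof -
      have "\<phi> (star c * (a * c) - ?p a *\<^sub>R (star c * c)) \<le> 0"
      proof (rule le)
        fix y assume y: "y \<in> K"
        have "cinner (\<pi> (star c * (a * c)) y) y = cinner (\<pi> a (\<pi> c y)) (\<pi> c y)"
          using y by (simp add: \<pi>.mult \<pi>.into \<pi>.adjoint star_star)
        moreover have "Re (cinner (\<pi> (star c * c) y) y) = (norm (\<pi> c y))\<^sup>2"
          by (rule \<pi>.norm_square[OF y])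
        ultimately show "Re (cinner (\<pi> (star c * (a * c) - ?p a *\<^sub>R (star c * c)) y) y) \<le> 0"
          using \<pi>.Re_cinner_le_numrange_sup[OF \<pi>.into[OF y], of a c] y
          by (simp add: \<pi>.diff \<pi>.scale hilbert.diff_left scaleR_scaleC hilbert.scale_left)
      qed
      then show ?thesis
        by (simp add: \<sigma>_v v norm_eq_cinner Re_f linear_diff[OF \<phi>(1)] linear_scale[OF \<phi>(1)])
    qed
    ultimately have "L \<subseteq> {z \<in> L. Re (cinner (\<sigma> a z) z) \<le> ?p a * (norm z)\<^sup>2}"
      using v_L by (intro L_least) auto
    then show ?thesis using that by blast
  qed
  have "irreducible_on L \<sigma>"
    unfolding irreducible_on_def
  proof (intro conjI allI impI)
    show "representation_on L \<sigma>" by (rule \<sigma>.rep)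
    show "\<exists>a. \<exists>x\<in>L. \<sigma> a x \<noteq> 0"
    proof (intro exI bexI)
      show "\<sigma> 1 \<xi> \<noteq> 0" using \<xi>(2) unfolding v_\<xi>[symmetric] \<xi>_def[symmetric] by auto
    qed (rule \<xi>(1))
    fix N assume "subrep_space L \<sigma> N"
    then have N: "N \<subseteq> L" "closed N" "csubspace N" "\<And>a y. y \<in> N \<Longrightarrow> \<sigma> a y \<in> N"
      by (auto simp: subrep_space_def)
    obtain \<xi>1 where \<xi>1: "\<xi>1 \<in> N" and "\<And>z. z \<in> N \<Longrightarrow> cinner (\<xi> - \<xi>1) z = 0"
      by (rule orthogonal_decomposition[OF N(2,3)]) (rule that)
    define \<xi>2 where "\<xi>2 = \<xi> - \<xi>1"
    have \<xi>2: "cinner \<xi>2 z = 0" "cinner z \<xi>2 = 0" if "z \<in> N" for z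
      using \<open>\<And>z. z \<in> N \<Longrightarrow> cinner (\<xi> - \<xi>1) z = 0\<close> that hilbert.commute[of z \<xi>2] by (simp_all add: \<xi>2_def)
    have L12: "\<xi>1 \<in> L" "\<xi>2 \<in> L" "\<xi> = \<xi>1 + \<xi>2"
      using N(1) \<xi>1 \<xi>(1) \<sigma>.subspace_rules by (auto simp: \<xi>2_def)
    have full: "N = L" if "\<xi> \<in> N"
      using L_least[OF N(2)] N(1,4) that by (auto simp: v_\<xi>)
    define t where "t = (norm \<xi>1)\<^sup>2"
    have t: "(norm \<xi>2)\<^sup>2 = 1 - t"
      using norm_add_orthogonal[of \<xi>1 \<xi>2] \<xi>2(2)[OF \<xi>1] L12(3) \<xi>(2) by (simp add: t_def)
    then have "t \<le> 1" using zero_le_power2[of "norm \<xi>2"] by linarith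
    then consider "t = 0" | "t = 1" | "0 < t" "t < 1" by (fastforce simp: t_def)
    then show "N = {0} \<or> N = L"
    proof cases
      case 1
      then have "\<xi> = \<xi>2" using L12(3) by (simp add: t_def)
      then have "cinner z (v a) = 0" if "z \<in> N" for z a
        using \<xi>2(2)[OF N(4)[OF that], of "star a"] \<sigma>.adjoint[of z \<xi> "star a"] N(1) \<xi>(1) that
        by (auto simp: v_\<xi> star_star)
      then have "N \<subseteq> {0}" using zero N(1) by blast
      then show ?thesis using complex_vector.subspace_0[OF N(3)] by blast
    next
      case 2
      then have "\<xi> = \<xi>1" using t L12(3) by simp
      then show ?thesis using full \<xi>1 by simp
    next
      case 3
      have cross: "cinner (\<sigma> a \<xi>1) \<xi>2 = 0" "cinner (\<sigma> a \<xi>2) \<xi>1 = 0" for a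
        using \<xi>2[OF N(4)[OF \<xi>1]] L12 by (simp_all add: \<sigma>.adjoint[of \<xi>2 \<xi>1])
      define \<psi>1 where "\<psi>1 a = Re (cinner (\<sigma> a \<xi>1) \<xi>1) / t" for a
      define \<psi>2 where "\<psi>2 a = Re (cinner (\<sigma> a \<xi>2) \<xi>2) / (1 - t)" for a
      have "\<psi>1 = \<phi>"
      proof (rule linear_face_extreme[OF face \<phi>(1) 3])
        show "linear \<psi>1" "linear \<psi>2"
          unfolding \<psi>1_def \<psi>2_def using L12
          by (auto intro!: linearI simp: \<sigma>.add \<sigma>.scale hilbert.add_left add_divide_distrib
              scaleR_scaleC hilbert.scale_left)
        show "\<psi>1 a \<le> ?p a" "\<psi>2 a \<le> ?p a" for a
          using contained[OF L12(1), of a] contained[OF L12(2), of a] 3 unfolding t \<psi>1_def \<psi>2_def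
          by (simp_all add: field_simps flip: t_def)
        have "\<phi> a = Re (cinner (\<sigma> a \<xi>) \<xi>)" for a
          using v[of a 1] by (simp add: Re_f flip: \<xi>_def v_\<xi>)
        then show "\<phi> a = t * \<psi>1 a + (1 - t) * \<psi>2 a" for a
          using 3 L12(1,2) unfolding L12(3) \<psi>1_def \<psi>2_def
          by (simp add: \<sigma>.add_vec hilbert.add_left hilbert.add_right cross)
      qed
      then have Re1: "Re (cinner (\<sigma> a \<xi>1) \<xi>1) = t * \<phi> a" for a
        using 3 by (auto simp: \<psi>1_def fun_eq_iff field_simps)
      \<comment> \<open>The imaginary parts follow by applying the real identity to \<open>\<i> a\<close>.\<close>
      then have f_eq: "cinner (\<sigma> a \<xi>1) \<xi>1 = t * f a" for a
        using Re1[of a] Re1[of "\<i> *\<^sub>C a"] L12(1)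
        by (simp add: complex_eq_iff f_def \<sigma>.scale hilbert.scale_left)
      have "\<xi>1 - t *\<^sub>C \<xi> = 0"
      proof (rule zero)
        show "\<xi>1 - t *\<^sub>C \<xi> \<in> L" using L12 \<xi> by (intro \<sigma>.subspace_rules)
        fix a
        have "cinner \<xi>1 (v a) = cinner (\<sigma> (star a) \<xi>1) \<xi>"
          using \<sigma>.adjoint[OF L12(1) \<xi>(1), of "star a"] by (simp add: v_\<xi> star_star)
        also have "\<dots> = t * f (star a)" by (simp add: L12(3) hilbert.add_right cross f_eq)
        also have "f (star a) = cinner \<xi> (v a)" by (simp add: \<xi>_def v)
        finally show "cinner (\<xi>1 - t *\<^sub>C \<xi>) (v a) = 0"
          by (simp add: hilbert.diff_left hilbert.scale_left)
      qed
      then have "inverse (complex_of_real t) *\<^sub>C \<xi>1 = \<xi>" using 3 by (simp add: scaleC_scaleC)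
      then show ?thesis using full complex_vector.subspace_scale[OF N(3) \<xi>1] by metis
    qed
  qed
  moreover have "\<sigma> a y = 0" if a: "\<And>x. x \<in> K \<Longrightarrow> \<pi> a x = 0" and y: "y \<in> L" for a y
  proof (rule zero)
    fix c
    have "\<phi> (star c * (a * (star a * c))) \<le> 0"
    proof (rule le)
      fix y assume y: "y \<in> K"
      have "\<pi> (star c * (a * (star a * c))) y = \<pi> (star c) (\<pi> a (\<pi> (star a * c) y))"
        using y by (simp add: \<pi>.mult \<pi>.into)
      also have "\<dots> = 0" using a y by (simp add: \<pi>.into \<pi>.zero_vec)
      finally show "Re (cinner (\<pi> (star c * (a * (star a * c))) y) y) \<le> 0" by simp
    qed
    then have "(norm (v (star a * c)))\<^sup>2 \<le> 0"
      by (simp add: norm_eq_cinner v star_mult star_star mult.assoc Re_f)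
    then have "v (star a * c) = 0" by simp
    then show "cinner (\<sigma> a y) (v c) = 0" by (simp add: \<sigma>.adjoint y v_L \<sigma>_v)
  qed (rule \<sigma>.into[OF y])
  moreover have "\<sigma> b \<xi> \<noteq> 0"
  proof
    assume "\<sigma> b \<xi> = 0"
    then have "\<phi> (star b * b) = 0" using v[of b b] by (simp add: v_\<xi> flip: Re_f)
    then have "?p (star b * b) = 0" using \<phi>(3) by simp
    then have "(norm (\<pi> b x))\<^sup>2 \<le> 0"
      using \<pi>.Re_cinner_le_numrange_sup[OF x(1), of "star b * b"] \<pi>.norm_square[OF x(1)] by simp
    then show False using x(2) by simp
  qed
  ultimately show ?thesis using \<xi>(1) by (intro that) auto
qed

corollary separating_spectrum:
  fixes \<pi> :: "'a::unital_cstar_algebra \<Rightarrow> 'h::complex_hilbert_space \<Rightarrow> 'h"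
  assumes "separable_space (euclidean :: 'a topology)" "unital_representation_on K \<pi>"
    "x \<in> K" "\<pi> b x \<noteq> 0"
  obtains c where "c \<in> spectrum" "{a. \<forall>x\<in>K. \<pi> a x = 0} \<subseteq> class_kernel c" "b \<notin> class_kernel c"
proof -
  obtain L and \<sigma> :: "'a \<Rightarrow> 'a ell2 \<Rightarrow> 'a ell2" where irr: "irreducible_on L \<sigma>"
    and ker: "{a. \<forall>x\<in>K. \<pi> a x = 0} \<subseteq> {a. \<forall>y\<in>L. \<sigma> a y = 0}" and b: "\<exists>y\<in>L. \<sigma> b y \<noteq> 0"
    by (rule separating_irreducible[OF assms]) (rule that)
  define c where "c = irrep_equiv `` {(L, \<sigma>)}"
  have r: "(L, \<sigma>) \<in> irreps" using irr by (simp add: irreps_def)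
  then have c: "c \<in> spectrum" unfolding c_def spectrum_def by (rule quotientI)
  have "(L, \<sigma>) \<in> c" unfolding c_def using equiv_class_self[OF equiv_irrep_equiv r] .
  then have "class_kernel c = {a. \<forall>y\<in>L. \<sigma> a y = 0}"
    using class_kernel_eq[OF c] by (simp add: rep_kernel_def)
  then show ?thesis using that[OF c] ker b by blast
qed

section \<open>Finite-dimensional quotients\<close>

text \<open>Each functional accounts for at most one dimension of the range: if it does not vanish at some
  \<open>e \<in> J\<close>, then \<open>J\<close> is spanned by \<open>e\<close> and the kernel of the functional in \<open>J\<close>.\<close>

lemma cfinite_dim_image:
  fixes T :: "'a::complex_vector \<Rightarrow> 'b::complex_vector"
  assumes "finite I" and J: "csubspace J"
    and l: "\<And>i a b. i \<in> I \<Longrightarrow> a \<in> J \<Longrightarrow> b \<in> J \<Longrightarrow> l i (a + b) = l i a + l i b"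
      "\<And>i a c. i \<in> I \<Longrightarrow> a \<in> J \<Longrightarrow> l i (c *\<^sub>C a) = c * (l i a :: complex)"
    and T: "\<And>a b. a \<in> J \<Longrightarrow> b \<in> J \<Longrightarrow> T (a + b) = T a + T b"
      "\<And>a c. a \<in> J \<Longrightarrow> T (c *\<^sub>C a) = c *\<^sub>C T a"
    and ker: "\<And>a. a \<in> J \<Longrightarrow> (\<And>i. i \<in> I \<Longrightarrow> l i a = 0) \<Longrightarrow> T a = 0"
  shows "cfinite_dim (T ` J)"
  using assms
proof (induction I arbitrary: J rule: finite_induct)
  case empty
  have "T ` J = cspan {}" using empty.prems(6) complex_vector.subspace_0[OF empty.prems(1)] by auto
  then show ?case unfolding cfinite_dim_def by (metis finite.emptyI)
next
  case (insert i I)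
  note J = complex_vector.subspace_0[OF insert.prems(1)] complex_vector.subspace_add[OF insert.prems(1)]
    complex_vector.subspace_scale[OF insert.prems(1)] complex_vector.subspace_diff[OF insert.prems(1)]
  define J' where "J' = {a \<in> J. l i a = 0}"
  have l0: "l i 0 = 0" using insert.prems(3)[of i 0 0] J(1) by simp
  have J': "csubspace J'"
    unfolding J'_def
    by (rule complex_vector.subspaceI) (auto simp: J l0 insert.prems(2,3))
  have "cfinite_dim (T ` J')"
  proof (rule insert.IH[OF J'])
    show "T a = 0" if "a \<in> J'" "\<And>i. i \<in> I \<Longrightarrow> l i a = 0" for a
      using that insert.prems(6)[of a] by (auto simp: J'_def)
  qed (use insert.prems in \<open>auto simp: J'_def\<close>)
  then obtain B where B: "finite B" "cspan B = T ` J'" by (auto simp: cfinite_dim_def)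
  show ?case
  proof (cases "J' = J")
    case True
    then show ?thesis using B by (auto simp: cfinite_dim_def)
  next
    case False
    then obtain e where e: "e \<in> J" "l i e \<noteq> 0" by (auto simp: J'_def)
    have TJ: "csubspace (T ` J)"
    proof (rule complex_vector.subspaceI)
      show "0 \<in> T ` J" using insert.prems(5)[of 0 0] J(1) by force
    qed (auto simp: J simp flip: insert.prems(4,5))
    have "cspan (insert (T e) B) = T ` J"
    proof
      have "B \<subseteq> T ` J" using B(2) complex_vector.span_superset[of B] by (auto simp: J'_def)
      then show "cspan (insert (T e) B) \<subseteq> T ` J"
        using e(1) by (intro complex_vector.span_minimal TJ) auto
      show "T ` J \<subseteq> cspan (insert (T e) B)"
      proof clarify
        fix a assume a: "a \<in> J"
        define c where "c = l i a / l i e"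
        have ce: "- c *\<^sub>C e \<in> J" using e J by blast
        have "l i (a + (- c) *\<^sub>C e) = 0"
          using a e ce insert.prems(2)[of i a "- c *\<^sub>C e"] insert.prems(3)[of i e "- c"]
          by (simp add: c_def)
        then have "a + (- c) *\<^sub>C e \<in> J'" using J(2)[OF a ce] by (simp add: J'_def)
        then have "T (a + (- c) *\<^sub>C e) \<in> cspan B" unfolding B(2) by (rule imageI)
        then have "T (a + (- c) *\<^sub>C e) \<in> cspan (insert (T e) B)"
          using complex_vector.span_mono[of B "insert (T e) B"] by auto
        moreover have "T a = T (a + (- c) *\<^sub>C e) + c *\<^sub>C T e"
          using a e ce insert.prems(4)[of a "- c *\<^sub>C e"] insert.prems(5)[of e "- c"] by simp
        ultimately show "T a \<in> cspan (insert (T e) B)"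
          by (simp add: complex_vector.span_add complex_vector.span_scale complex_vector.span_base)
      qed
    qed
    then show ?thesis using B(1) by (auto simp: cfinite_dim_def)
  qed
qed

text \<open>The kernel of a finite-dimensional representation is cut out by its finitely many matrix
  coefficients with respect to an orthonormal basis.\<close>

lemma cfinite_dim_image_of_kernel:
  fixes \<sigma> :: "'a::unital_cstar_algebra \<Rightarrow> 'h::complex_hilbert_space \<Rightarrow> 'h"
  assumes \<sigma>: "representation_on K \<sigma>" and K: "cfinite_dim K" and J: "csubspace J"
    and T: "\<And>a b. a \<in> J \<Longrightarrow> b \<in> J \<Longrightarrow> T (a + b) = T a + (T b :: 'b::complex_vector)"
      "\<And>a c. a \<in> J \<Longrightarrow> T (c *\<^sub>C a) = c *\<^sub>C T a"
    and ker: "\<And>a. a \<in> J \<Longrightarrow> (\<And>x. x \<in> K \<Longrightarrow> \<sigma> a x = 0) \<Longrightarrow> T a = 0"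
  shows "cfinite_dim (T ` J)"
proof -
  interpret \<sigma>: representation K \<sigma> by unfold_locales fact
  obtain F where F: "finite F" "orthonormal_set F" "cspan F = K"
    by (rule finite_orthonormal_basis[OF K])
  have FK: "F \<subseteq> K" using F(3) complex_vector.span_superset by blast
  define l where "l = (\<lambda>(e, e') a. cinner (\<sigma> a e) e')"
  show ?thesis
  proof (rule cfinite_dim_image[of "F \<times> F" J l])
    fix a assume a: "a \<in> J" "\<And>i. i \<in> F \<times> F \<Longrightarrow> l i a = 0"
    have "\<sigma> a e = 0" if e: "e \<in> F" for e
    proof -
      have "\<sigma> a e \<in> cspan F" using e FK \<sigma>.into F(3) by blast
      moreover have "cinner (\<sigma> a e) e' = 0" if "e' \<in> F" for e'
        using a(2)[of "(e, e')"] e that by (simp add: l_def)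
      ultimately show ?thesis using orthonormal_expansion[OF F(2,1), of "\<sigma> a e"] by simp
    qed
    moreover have "csubspace {x \<in> K. \<sigma> a x = 0}"
      by (rule complex_vector.subspaceI)
        (auto simp: \<sigma>.subspace_rules \<sigma>.zero_vec \<sigma>.add_vec \<sigma>.scale_vec)
    ultimately have "cspan F \<subseteq> {x \<in> K. \<sigma> a x = 0}"
      using FK by (intro complex_vector.span_minimal) auto
    then show "T a = 0" using ker[OF a(1)] F(3) by blast
  qed (use F FK J T in \<open>auto simp: l_def \<sigma>.add \<sigma>.scale hilbert.add_left hilbert.scale_left\<close>)
qed

text \<open>The orbit of a vector under the algebra has finite dimension, so it is a closed invariant
  subspace; irreducibility makes it everything.\<close>

lemma irreducible_cfinite_dim:
  fixes \<pi> :: "'a::unital_cstar_algebra \<Rightarrow> 'h::complex_hilbert_space \<Rightarrow> 'h"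
    and \<sigma> :: "'a \<Rightarrow> 'k::complex_hilbert_space \<Rightarrow> 'k"
  assumes \<pi>: "representation_on K \<pi>" "cfinite_dim K" and \<sigma>: "irreducible_on L \<sigma>"
    and ker: "{a. \<forall>x\<in>K. \<pi> a x = 0} \<subseteq> {a. \<forall>y\<in>L. \<sigma> a y = 0}"
  shows "cfinite_dim L"
proof -
  interpret \<sigma>: representation L \<sigma> using \<sigma> by unfold_locales (simp add: irreducible_on_def)
  obtain a0 y where y: "y \<in> L" "\<sigma> a0 y \<noteq> 0" using \<sigma> by (auto simp: irreducible_on_def)
  let ?M = "(\<lambda>a. \<sigma> a y) ` UNIV"
  have fd: "cfinite_dim ?M"
    by (rule cfinite_dim_image_of_kernel[OF \<pi>])
      (use ker y in \<open>auto simp: \<sigma>.add \<sigma>.scale\<close>)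
  have "subrep_space L \<sigma> ?M"
    unfolding subrep_space_def
    using y cfinite_dim_closed[OF fd] cfinite_dim_imp_csubspace[OF fd]
    by (auto simp: \<sigma>.into simp flip: \<sigma>.mult)
  then have "?M = {0} \<or> ?M = L" using \<sigma> by (auto simp: irreducible_on_def)
  then show ?thesis using fd y(2) by auto
qed

text \<open>The vectors fixed by the image of the unit form an invariant subspace that contains every
  \<open>\<sigma> a y\<close>.\<close>

lemma irreducible_unital:
  assumes "irreducible_on K \<sigma>" "x \<in> K"
  shows "\<sigma> 1 x = x"
proof -
  interpret \<sigma>: representation K \<sigma> using assms by unfold_locales (simp add: irreducible_on_def)
  have "closed {x \<in> K. \<sigma> 1 x - x = 0}"
    by (intro continuous_closed_preimage_constant continuous_intros \<sigma>.continuous \<sigma>.closed)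
  moreover have "csubspace {x \<in> K. \<sigma> 1 x - x = 0}"
    by (rule complex_vector.subspaceI)
      (auto simp: \<sigma>.subspace_rules \<sigma>.zero_vec \<sigma>.add_vec \<sigma>.scale_vec)
  ultimately have "subrep_space K \<sigma> {x \<in> K. \<sigma> 1 x - x = 0}"
    unfolding subrep_space_def by (auto simp: \<sigma>.into simp flip: \<sigma>.mult)
  then have "{x \<in> K. \<sigma> 1 x - x = 0} = {0} \<or> {x \<in> K. \<sigma> 1 x - x = 0} = K"
    using assms(1) unfolding irreducible_on_def by blast
  moreover obtain a y where "y \<in> K" "\<sigma> a y \<noteq> 0" using assms(1) by (auto simp: irreducible_on_def)
  then have "\<sigma> a y \<in> {x \<in> K. \<sigma> 1 x - x = 0}" "\<sigma> a y \<noteq> 0"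
    by (auto simp: \<sigma>.into simp flip: \<sigma>.mult)
  ultimately show ?thesis using assms(2) by fastforce
qed

section \<open>Shifting along an orthonormal sequence\<close>

definition orthonormal_seq :: "(nat \<Rightarrow> 'h::complex_hilbert_space) \<Rightarrow> bool" where
  "orthonormal_seq e \<longleftrightarrow> (\<forall>i j. cinner (e i) (e j) = (if i = j then 1 else 0))"

text \<open>The operator that sends each \<open>a k\<close> to \<open>b k\<close> and annihilates the orthogonal complement of the
  sequence \<open>a\<close>.\<close>

definition partial_isometry ::
  "(nat \<Rightarrow> 'h) \<Rightarrow> (nat \<Rightarrow> 'h) \<Rightarrow> 'h \<Rightarrow> 'h::complex_hilbert_space" where
  "partial_isometry a b x = (\<Sum>k. cinner x (a k) *\<^sub>C b k)"

lemma orthonormal_seqD: "orthonormal_seq e \<Longrightarrow> cinner (e i) (e j) = (if i = j then 1 else 0)"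
  by (simp add: orthonormal_seq_def)

lemma orthonormal_seq_Bessel:
  assumes "orthonormal_seq a" "finite F"
  shows "(\<Sum>k\<in>F. (cmod (cinner x (a k)))\<^sup>2) \<le> (norm x)\<^sup>2"
  using hilbert.Bessel[of F a x] assms
  by (simp add: norm_eq_cinner hilbert.orthonormal_or_null_def orthonormal_seq_def)

lemma norm_sum_orthonormal:
  assumes b: "orthonormal_seq b" and F: "finite F"
  shows "(norm (\<Sum>k\<in>F. c k *\<^sub>C b k))\<^sup>2 = (\<Sum>k\<in>F. (cmod (c k))\<^sup>2)"
proof -
  have "cinner (\<Sum>k\<in>F. c k *\<^sub>C b k) (\<Sum>k\<in>F. c k *\<^sub>C b k)
      = (\<Sum>k\<in>F. c k * (\<Sum>j\<in>F. cnj (c j) * cinner (b k) (b j)))"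
    by (simp only: hilbert.sum_left hilbert.scale_left) (simp only: hilbert.sum_right hilbert.scale_right)
  also have "\<dots> = (\<Sum>k\<in>F. c k * (\<Sum>j\<in>F. if j = k then cnj (c k) else 0))"
    by (intro sum.cong refl arg_cong2[of _ _ _ _ "(*)"]) (auto simp: orthonormal_seqD[OF b])
  also have "\<dots> = (\<Sum>k\<in>F. complex_of_real ((cmod (c k))\<^sup>2))"
    using F by (intro sum.cong refl) (simp only: sum.delta complex_norm_square if_True)
  finally show ?thesis by (simp add: norm_eq_cinner)
qed

context
  fixes a b :: "nat \<Rightarrow> 'h::complex_hilbert_space"
  assumes a: "orthonormal_seq a" and b: "orthonormal_seq b"
begin

lemma partial_isometry_summable: "summable (\<lambda>k. cinner x (a k) *\<^sub>C b k)"
proof -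
  have "summable (\<lambda>k. (cmod (cinner x (a k)))\<^sup>2)"
    using orthonormal_seq_Bessel[OF a] by (intro summableI_nonneg_bounded) auto
  then have "\<exists>N. \<forall>m\<ge>N. \<forall>n. norm (\<Sum>k=m..<n. cinner x (a k) *\<^sub>C b k) < \<epsilon>" if \<epsilon>: "0 < \<epsilon>" for \<epsilon>
  proof -
    obtain N where N: "\<And>m n. m \<ge> N \<Longrightarrow> norm (\<Sum>k=m..<n. (cmod (cinner x (a k)))\<^sup>2) < \<epsilon>\<^sup>2"
      using \<open>summable (\<lambda>k. (cmod (cinner x (a k)))\<^sup>2)\<close> \<epsilon> unfolding summable_Cauchy
      by (meson zero_less_power)
    have "norm (\<Sum>k=m..<n. cinner x (a k) *\<^sub>C b k) < \<epsilon>" if "m \<ge> N" for m n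
    proof (rule power2_less_imp_less)
      show "(norm (\<Sum>k=m..<n. cinner x (a k) *\<^sub>C b k))\<^sup>2 < \<epsilon>\<^sup>2"
        using N[OF that, of n] by (simp add: norm_sum_orthonormal[OF b] sum_nonneg)
    qed (use \<epsilon> in simp)
    then show ?thesis by blast
  qed
  then show ?thesis unfolding summable_Cauchy by blast
qed

lemma partial_isometry_bounded_linear: "bounded_linear (partial_isometry a b)"
  and partial_isometry_scale: "partial_isometry a b (c *\<^sub>C x) = c *\<^sub>C partial_isometry a b x"
proof -
  have scale: "partial_isometry a b (c *\<^sub>C x) = c *\<^sub>C partial_isometry a b x" for c x
    unfolding partial_isometry_def
    by (subst bounded_linear.suminf[OF bounded_linear_scaleC partial_isometry_summable])
      (simp only: hilbert.scale_left scaleC_scaleC)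
  show "bounded_linear (partial_isometry a b)"
  proof (rule bounded_linear_intro[where K = 1])
    fix x y
    show "partial_isometry a b (x + y) = partial_isometry a b x + partial_isometry a b y"
      unfolding partial_isometry_def
      by (subst suminf_add[OF partial_isometry_summable partial_isometry_summable])
        (simp only: hilbert.add_left scaleC_add_left)
    show "partial_isometry a b (r *\<^sub>R x) = r *\<^sub>R partial_isometry a b x" for r
      by (simp add: scaleR_scaleC scale)
    have "norm (\<Sum>k<n. cinner x (a k) *\<^sub>C b k) \<le> norm x" for n
      by (rule power2_le_imp_le)
        (use orthonormal_seq_Bessel[OF a, of "{..<n}" x] in \<open>simp_all add: norm_sum_orthonormal[OF b]\<close>)
    moreover have "(\<lambda>n. norm (\<Sum>k<n. cinner x (a k) *\<^sub>C b k)) \<longlonglongrightarrow> norm (partial_isometry a b x)"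
      unfolding partial_isometry_def
      by (intro tendsto_norm summable_LIMSEQ partial_isometry_summable)
    ultimately show "norm (partial_isometry a b x) \<le> norm x * 1"
      by (simp add: LIMSEQ_le_const2)
  qed
  show "partial_isometry a b (c *\<^sub>C x) = c *\<^sub>C partial_isometry a b x" by (rule scale)
qed

lemma partial_isometry_cinner:
  "(\<lambda>k. cinner x (a k) * cinner (b k) y) sums cinner (partial_isometry a b x) y"
proof -
  have "bounded_linear (\<lambda>z. cinner z y)"
    by (rule bounded_bilinear.bounded_linear_left[OF bounded_bilinear_cinner])
  from bounded_linear.sums[OF this summable_sums[OF partial_isometry_summable[of x]]]
  show ?thesis by (simp add: partial_isometry_def hilbert.scale_left)
qed

lemma partial_isometry_component: "cinner (partial_isometry a b x) (b j) = cinner x (a j)"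
proof -
  have "(\<lambda>k. cinner x (a k) * cinner (b k) (b j)) = (\<lambda>k. if k = j then cinner x (a k) else 0)"
    by (auto simp: orthonormal_seqD[OF b])
  then have "(\<lambda>k. cinner x (a k) * cinner (b k) (b j)) sums cinner x (a j)"
    using sums_single[of j "\<lambda>k. cinner x (a k)"] by simp
  then show ?thesis using partial_isometry_cinner sums_unique2 by blast
qed

lemma partial_isometry_comp:
  "partial_isometry b c (partial_isometry a b x) = partial_isometry a c x"
  by (simp add: partial_isometry_def[of b c] partial_isometry_component)
    (simp add: partial_isometry_def)

end

lemma partial_isometry_adjoint:
  assumes a: "orthonormal_seq a" and b: "orthonormal_seq b"
  shows "cinner (partial_isometry a b x) y = cinner x (partial_isometry b a y)"
proof -
  have "(\<lambda>k. cnj (cinner y (b k) * cinner (a k) x)) sums cnj (cinner (partial_isometry b a y) x)"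
    by (rule bounded_linear.sums[OF bounded_linear_cnj partial_isometry_cinner[OF b a]])
  also have "(\<lambda>k. cnj (cinner y (b k) * cinner (a k) x)) = (\<lambda>k. cinner x (a k) * cinner (b k) y)"
    using hilbert.commute[of x "a _"] hilbert.commute[of "b _" y] by (simp add: mult.commute)
  finally have "(\<lambda>k. cinner x (a k) * cinner (b k) y) sums cinner x (partial_isometry b a y)"
    by (simp flip: hilbert.commute)
  then show ?thesis using partial_isometry_cinner[OF a b] sums_unique2 by blast
qed

text \<open>\<open>V\<close> shifts the sequence \<open>e\<close> by \<open>n\<close> places and is the identity on its orthogonal complement; \<open>Vs\<close> is
  its adjoint. With \<open>P\<close> the projection onto the closed span of \<open>e\<close> and \<open>S\<close> the shift there,
  \<open>V = 1 - P + S\<close>.\<close>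

lemma shift_isometry:
  fixes e :: "nat \<Rightarrow> 'h::complex_hilbert_space"
  assumes e: "orthonormal_seq e"
  obtains V Vs :: "'h \<Rightarrow> 'h" where "bounded_linear V" "bounded_linear Vs"
    "\<And>c x. V (c *\<^sub>C x) = c *\<^sub>C V x" "\<And>c x. Vs (c *\<^sub>C x) = c *\<^sub>C Vs x"
    "\<And>x y. cinner (V x) y = cinner x (Vs y)" "\<And>x. Vs (V x) = x"
    "\<And>y. V (Vs y) = y - (\<Sum>k<n. cinner y (e k) *\<^sub>C e k)" "\<And>j. j < n \<Longrightarrow> Vs (e j) = 0"
    "\<And>x. (\<And>k. cinner x (e k) = 0) \<Longrightarrow> V x = x \<and> Vs x = x"
proof -
  define e' where "e' k = e (k + n)" for k
  have e': "orthonormal_seq e'" using e by (simp add: orthonormal_seq_def e'_def)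
  define P where "P = partial_isometry e e"
  define S where "S = partial_isometry e e'"
  define Ss where "Ss = partial_isometry e' e"
  note defs = P_def S_def Ss_def
  have bl: "bounded_linear P" "bounded_linear S" "bounded_linear Ss"
    by (simp_all add: defs partial_isometry_bounded_linear e e')
  note lin = bl[THEN bounded_linear.linear]
  have sc: "P (c *\<^sub>C x) = c *\<^sub>C P x" "S (c *\<^sub>C x) = c *\<^sub>C S x" "Ss (c *\<^sub>C x) = c *\<^sub>C Ss x" for c x
    by (simp_all add: defs partial_isometry_scale e e')
  have adj: "cinner (P x) y = cinner x (P y)" "cinner (S x) y = cinner x (Ss y)" for x y
    by (simp_all add: defs partial_isometry_adjoint e e')
  have P_comp: "cinner (P x) (e j) = cinner x (e j)" for x j
    unfolding P_def by (rule partial_isometry_component[OF e e])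
  have PP: "P (P x) = P x" and PSs: "P (Ss x) = Ss x" and SP: "S (P x) = S x" and SsS: "Ss (S x) = P x" for x
    by (simp_all add: defs partial_isometry_comp e e')
  have SsP: "Ss (P x) = Ss x" for x
    using P_comp by (simp add: Ss_def partial_isometry_def e'_def)
  have PS: "P (S x) = S x" for x
    by (rule cinner_eqI) (simp add: adj SsP)
  have SSs: "S (Ss x) = P x - (\<Sum>k<n. cinner x (e k) *\<^sub>C e k)" for x
  proof -
    have "S (Ss x) = partial_isometry e' e' x" by (simp add: defs partial_isometry_comp e e')
    also have "\<dots> = P x - (\<Sum>k<n. cinner x (e k) *\<^sub>C e k)"
      using suminf_split_initial_segment[OF partial_isometry_summable[OF e e], of x n]
      by (simp add: P_def partial_isometry_def e'_def)
    finally show ?thesis .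
  qed
  define V where "V x = x - P x + S x" for x
  define Vs where "Vs x = x - P x + Ss x" for x
  show ?thesis
  proof (rule that[of V Vs])
    show "bounded_linear V" "bounded_linear Vs"
      unfolding V_def[abs_def] Vs_def[abs_def]
      by (intro bounded_linear_add bounded_linear_sub bounded_linear_ident bl)+
    show "V (c *\<^sub>C x) = c *\<^sub>C V x" "Vs (c *\<^sub>C x) = c *\<^sub>C Vs x" for c x
      by (simp_all add: V_def Vs_def sc scaleC_add_right complex_vector.scale_right_diff_distrib)
    show "cinner (V x) y = cinner x (Vs y)" for x y
      by (simp add: V_def Vs_def hilbert.add_left hilbert.diff_left hilbert.add_right
          hilbert.diff_right adj)
    have "P (V x) = S x" "Ss (V x) = P x" for x
      by (simp_all add: V_def lin[THEN linear_add] lin[THEN linear_diff] PP PS SsP SsS)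
    then show "Vs (V x) = x" for x by (simp add: Vs_def V_def)
    have "P (Vs y) = Ss y" "S (Vs y) = S (Ss y)" for y
      by (simp_all add: Vs_def lin[THEN linear_add] lin[THEN linear_diff] PP PSs SP)
    then show "V (Vs y) = y - (\<Sum>k<n. cinner y (e k) *\<^sub>C e k)" for y
      by (simp add: V_def[of "Vs y"] SSs) (simp add: Vs_def)
    show "Vs (e j) = 0" if j: "j < n" for j
    proof -
      have "P (e j) = e j"
      proof -
        have "(\<lambda>k. cinner (e j) (e k) *\<^sub>C e k) = (\<lambda>k. if k = j then e k else 0)"
          by (auto simp: orthonormal_seqD[OF e])
        then show ?thesis
          using sums_unique[OF sums_single[of j e]] by (simp add: P_def partial_isometry_def)
      qed
      moreover have "cinner (e j) (e' k) = 0" for k using j by (simp add: e'_def orthonormal_seqD[OF e])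
      then have "Ss (e j) = 0" by (simp add: Ss_def partial_isometry_def)
      ultimately show ?thesis by (simp add: Vs_def)
    qed
    show "V x = x \<and> Vs x = x" if "\<And>k. cinner x (e k) = 0" for x
      using that by (simp add: V_def Vs_def defs partial_isometry_def e'_def)
  qed
qed

text \<open>In infinite dimension there is always a unit vector orthogonal to \<open>G\<close> and to the finitely many
  vectors chosen so far.\<close>

lemma orthonormal_seq_orthogonal_to:
  fixes G :: "'h::complex_hilbert_space set"
  assumes inf: "\<not> cfinite_dim (UNIV :: 'h set)" and G: "finite G"
  obtains e where "orthonormal_seq e" "\<And>x k. x \<in> G \<Longrightarrow> cinner x (e k) = 0"
proof -
  have "\<exists>e :: nat \<Rightarrow> 'h. \<forall>n. norm (e n) = 1 \<and> (\<forall>x\<in>G \<union> e ` {..<n}. cinner (e n) x = 0)"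
  proof (rule dependent_wellorder_choice[where
        P = "\<lambda>e n u. norm u = 1 \<and> (\<forall>x\<in>G \<union> e ` {..<n}. cinner u x = 0)"])
    fix f e :: "nat \<Rightarrow> 'h" and n u
    assume "\<And>k. k < n \<Longrightarrow> f k = e k"
    then have "f ` {..<n} = e ` {..<n}" by (intro image_cong) auto
    then show "(norm u = 1 \<and> (\<forall>x\<in>G \<union> f ` {..<n}. cinner u x = 0))
        = (norm u = 1 \<and> (\<forall>x\<in>G \<union> e ` {..<n}. cinner u x = 0))" by simp
  next
    fix e :: "nat \<Rightarrow> 'h" and n
    have "finite (G \<union> e ` {..<n})" using G by simp
    then obtain u where "norm u = 1" "\<And>x. x \<in> G \<union> e ` {..<n} \<Longrightarrow> cinner u x = 0"
      by (rule unit_vector_orthogonal[OF inf]) (rule that)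
    then show "\<exists>u. norm u = 1 \<and> (\<forall>x\<in>G \<union> e ` {..<n}. cinner u x = 0)" by blast
  qed
  then obtain e :: "nat \<Rightarrow> 'h" where "\<forall>n. norm (e n) = 1 \<and> (\<forall>x\<in>G \<union> e ` {..<n}. cinner (e n) x = 0)"
    by (rule exE)
  then have e: "\<And>n. norm (e n) = 1" "\<And>n x. x \<in> G \<union> e ` {..<n} \<Longrightarrow> cinner (e n) x = 0" by simp_all
  have "cinner (e i) (e j) = 0" if "i \<noteq> j" for i j
    using e(2)[of "e j" i] e(2)[of "e i" j] hilbert.commute[of "e i" "e j"] that
    by (cases "i < j") auto
  then have "orthonormal_seq e" using e(1) by (simp add: orthonormal_seq_def cinner_self)
  moreover have "cinner x (e k) = 0" if "x \<in> G" for x k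
    using e(2)[of x k] that hilbert.commute[of x "e k"] by simp
  ultimately show ?thesis by (rule that)
qed

section \<open>Perturbing a representation on finitely many vectors\<close>

text \<open>With \<open>V\<close> as in \<open>shift_isometry\<close> and \<open>W\<close> an isometry of \<open>L\<close> onto the span of the first \<open>n\<close>
  members of \<open>e\<close>, the ranges of \<open>V\<close> and \<open>W\<close> are complementary, and \<open>\<rho>\<close> is the direct sum of \<open>\<pi>\<close> and
  \<open>\<sigma>\<close> transported along \<open>V\<close> and \<open>W\<close>. The sequence \<open>e\<close> is orthogonal to all vectors that occur in
  the data \<open>D\<close>, where \<open>V\<close> is therefore the identity.\<close>

theorem insert_finite_dim_subrep:
  fixes \<pi> :: "'a::unital_cstar_algebra \<Rightarrow> 'h::complex_hilbert_space \<Rightarrow>\<^sub>L 'h"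
    and \<sigma> :: "'a \<Rightarrow> 'k::complex_hilbert_space \<Rightarrow> 'k"
  assumes inf: "\<not> cfinite_dim (UNIV :: 'h set)" and \<pi>: "\<pi> \<in> Rep"
    and \<sigma>: "unital_representation_on L \<sigma>" "cfinite_dim L" "L \<noteq> {0}"
    and D: "finite D"
  obtains \<rho> where "\<rho> \<in> Rep" "\<rho> \<notin> WM" "\<And>a x. (a, x) \<in> D \<Longrightarrow> \<rho> a x = \<pi> a x"
proof -
  interpret \<pi>: representation UNIV "\<lambda>a. blinfun_apply (\<pi> a)"
    using \<pi> by unfold_locales (simp add: Rep_def unital_representation_on_def)
  have \<pi>1: "\<pi> 1 x = x" for x using \<pi> by (simp add: Rep_def unital_representation_on_def)
  interpret \<sigma>: representation L \<sigma>
    using \<sigma>(1) by unfold_locales (simp add: unital_representation_on_def)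
  have \<sigma>1: "\<sigma> 1 z = z" if "z \<in> L" for z using \<sigma>(1) that by (simp add: unital_representation_on_def)
  define G where "G = snd ` D \<union> (\<lambda>(a, x). \<pi> a x) ` D"
  have "finite G" using D by (simp add: G_def)
  then obtain e where e: "orthonormal_seq e" and eG: "\<And>x k. x \<in> G \<Longrightarrow> cinner x (e k) = 0"
    using orthonormal_seq_orthogonal_to[OF inf] by metis
  obtain F where F: "finite F" "orthonormal_set F" "cspan F = L"
    by (rule finite_orthonormal_basis[OF \<sigma>(2)])
  define n where "n = card F"
  obtain h where h: "bij_betw h {..<n} F"
    using ex_bij_betw_nat_finite[OF F(1)] by (auto simp: n_def atLeast0LessThan)
  have hF: "h i \<in> F" if "i < n" for i using h that by (auto simp: bij_betw_def)
  have FL: "F \<subseteq> L" using F(3) complex_vector.span_superset by blast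
  have h_orth: "cinner (h i) (h j) = (if i = j then 1 else 0)" if "i < n" "j < n" for i j
    using F(2) hF[OF that(1)] hF[OF that(2)] h that
    by (auto simp: orthonormal_set_def bij_betw_def inj_on_def)
  have expand: "(\<Sum>i<n. cinner z (h i) *\<^sub>C h i) = z" if "z \<in> L" for z
    using orthonormal_expansion[OF F(2,1), of z] that F(3)
      sum.reindex_bij_betw[OF h, of "\<lambda>f. cinner z f *\<^sub>C f"] by simp
  obtain V Vs where V: "bounded_linear V" "bounded_linear Vs"
    "\<And>c x. V (c *\<^sub>C x) = c *\<^sub>C V x" "\<And>c x. Vs (c *\<^sub>C x) = c *\<^sub>C Vs x"
    "\<And>x y. cinner (V x) y = cinner x (Vs y)" "\<And>x. Vs (V x) = x"
    "\<And>y. V (Vs y) = y - (\<Sum>k<n. cinner y (e k) *\<^sub>C e k)" "\<And>j. j < n \<Longrightarrow> Vs (e j) = 0"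
    and V_id: "\<And>x. (\<And>k. cinner x (e k) = 0) \<Longrightarrow> V x = x \<and> Vs x = x"
    using shift_isometry[OF e, of n] by blast
  define W where "W z = (\<Sum>i<n. cinner z (h i) *\<^sub>C e i)" for z
  define Ws where "Ws y = (\<Sum>i<n. cinner y (e i) *\<^sub>C h i)" for y
  note cinner_left = bounded_bilinear.bounded_linear_left[OF bounded_bilinear_cinner]
  have W: "bounded_linear W" and Ws: "bounded_linear Ws"
    unfolding W_def[abs_def] Ws_def[abs_def]
    by (intro bounded_linear_sum bounded_linear_compose[OF bounded_linear_scaleC_const] cinner_left)+
  note lin = V(1,2)[THEN bounded_linear.linear] W[THEN bounded_linear.linear] Ws[THEN bounded_linear.linear]
  note add = lin[THEN linear_add]
  note zero = lin[THEN linear_0]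
  have W_scale: "W (c *\<^sub>C z) = c *\<^sub>C W z" and Ws_scale: "Ws (c *\<^sub>C y) = c *\<^sub>C Ws y" for c z y
    by (simp_all add: W_def Ws_def hilbert.scale_left complex_vector.scale_sum_right scaleC_scaleC)
  have Ws_L: "Ws y \<in> L" for y
    unfolding Ws_def using FL hF by (intro complex_vector.subspace_sum \<sigma>.subspace \<sigma>.subspace_rules) auto
  have W_adj: "cinner (W z) y = cinner z (Ws y)" for z y
    by (auto simp: W_def Ws_def hilbert.sum_left hilbert.sum_right hilbert.scale_left hilbert.scale_right
        intro!: sum.cong simp flip: hilbert.commute)
  have Ws_e: "Ws (e i) = h i" if "i < n" for i
  proof -
    have "Ws (e i) = (\<Sum>j<n. if j = i then h i else 0)"
      unfolding Ws_def by (intro sum.cong) (auto simp: orthonormal_seqD[OF e])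
    then show ?thesis using that by simp
  qed
  have WsW: "Ws (W z) = z" if "z \<in> L" for z
  proof -
    have "Ws (W z) = (\<Sum>i<n. cinner z (h i) *\<^sub>C Ws (e i))"
      by (simp add: W_def[of z] linear_sum[OF lin(4)] Ws_scale)
    then show ?thesis using expand[OF that] by (simp add: Ws_e)
  qed
  have W_h: "W (h i) = e i" if "i < n" for i
  proof -
    have "W (h i) = (\<Sum>j<n. if j = i then e i else 0)"
      unfolding W_def using that by (intro sum.cong) (auto simp: h_orth)
    then show ?thesis using that by simp
  qed
  have sum1: "V (Vs y) + W (Ws y) = y" for y
    by (simp add: V(7) Ws_def[of y] linear_sum[OF lin(3)] W_scale W_h)
  have VsW: "Vs (W z) = 0" for z
    by (simp add: W_def linear_sum[OF lin(2)] V(4) V(8))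
  have WsV: "Ws (V x) = 0" for x
  proof -
    have "cinner (Ws (V x)) (Ws (V x)) = cnj (cinner (V x) (W (Ws (V x))))"
      using hilbert.commute[of "Ws (V x)" "Ws (V x)"] W_adj[of "Ws (V x)" "V x"] hilbert.commute
      by metis
    then show ?thesis by (simp add: V(5) VsW cinner_zero_iff)
  qed
  define T where "T a y = V (\<pi> a (Vs y)) + W (\<sigma> a (Ws y))" for a y
  have T_add: "T a (x + y) = T a x + T a y" for a x y
    by (simp add: T_def add \<pi>.add_vec \<sigma>.add_vec Ws_L)
  have T_scale: "T a (c *\<^sub>C x) = c *\<^sub>C T a x" for a c x
    by (simp add: T_def V(3,4) W_scale Ws_scale \<pi>.scale_vec \<sigma>.scale_vec Ws_L scaleC_add_right)
  have Vs_T: "Vs (T a y) = \<pi> a (Vs y)" and Ws_T: "Ws (T a y) = \<sigma> a (Ws y)" for a y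
    by (simp_all add: T_def add V(6) VsW WsV WsW \<sigma>.into Ws_L)
  have T_bl: "bounded_linear (T a)" for a
  proof -
    obtain B where B: "\<And>z. z \<in> L \<Longrightarrow> norm (\<sigma> a z) \<le> B * norm z" using \<sigma>.bounded by blast
    obtain C where C: "\<And>y. norm (Ws y) \<le> norm y * C" using bounded_linear.bounded[OF Ws] by blast
    have "bounded_linear (\<lambda>y. \<sigma> a (Ws y))"
    proof (rule bounded_linear_intro[where K = "C * \<bar>B\<bar>"])
      fix x y and r :: real
      show "\<sigma> a (Ws (x + y)) = \<sigma> a (Ws x) + \<sigma> a (Ws y)" by (simp add: add \<sigma>.add_vec Ws_L)
      show "\<sigma> a (Ws (r *\<^sub>R x)) = r *\<^sub>R \<sigma> a (Ws x)"
        by (simp add: scaleR_scaleC Ws_scale \<sigma>.scale_vec Ws_L)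
      have "norm (\<sigma> a (Ws x)) \<le> \<bar>B\<bar> * norm (Ws x)"
        using B[OF Ws_L, of x] mult_right_mono[OF abs_ge_self[of B], of "norm (Ws x)"] by simp
      also have "\<dots> \<le> \<bar>B\<bar> * (norm x * C)" by (intro mult_left_mono C) simp
      finally show "norm (\<sigma> a (Ws x)) \<le> norm x * (C * \<bar>B\<bar>)" by (simp add: mult_ac)
    qed
    then show ?thesis unfolding T_def[abs_def]
      by (intro bounded_linear_add bounded_linear_compose[OF V(1)] bounded_linear_compose[OF W]
          bounded_linear_compose[OF blinfun.bounded_linear_right] V(2))
  qed
  define \<rho> where "\<rho> a = Blinfun (T a)" for a
  have \<rho>: "blinfun_apply (\<rho> a) = T a" for a
    unfolding \<rho>_def by (rule bounded_linear_Blinfun_apply[OF T_bl])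
  have T_rep: "unital_representation_on UNIV T"
    unfolding unital_representation_on_def representation_on_def bounded_clinear_on_def
  proof (intro conjI allI ballI)
    fix a b x y and c
    show "T a (x + y) = T a x + T a y" "T a (c *\<^sub>C x) = c *\<^sub>C T a x" by (fact T_add T_scale)+
    show "T (a + b) x = T a x + T b x"
      by (simp add: T_def \<pi>.add \<sigma>.add Ws_L add)
    show "T (c *\<^sub>C a) x = c *\<^sub>C T a x"
      by (simp add: T_def \<pi>.scale \<sigma>.scale Ws_L V(3) W_scale scaleC_add_right)
    show "T (a * b) x = T a (T b x)"
      unfolding T_def[of a] Vs_T Ws_T by (simp add: T_def \<pi>.mult \<sigma>.mult Ws_L)
    have "cinner (T a x) y = cinner (\<pi> a (Vs x)) (Vs y) + cinner (\<sigma> a (Ws x)) (Ws y)"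
      by (simp add: T_def hilbert.add_left V(5) W_adj)
    also have "\<dots> = cinner (Vs x) (\<pi> (star a) (Vs y)) + cinner (Ws x) (\<sigma> (star a) (Ws y))"
      by (simp add: \<pi>.adjoint \<sigma>.adjoint Ws_L)
    also have "\<dots> = cinner x (T (star a) y)"
    proof -
      have "cinner (Vs x) u = cinner x (V u)" for u
        using V(5)[of u x] hilbert.commute by metis
      moreover have "cinner (Ws x) u = cinner x (W u)" for u
        using W_adj[of u x] hilbert.commute by metis
      ultimately show ?thesis by (simp add: T_def hilbert.add_right)
    qed
    finally show "cinner (T a x) y = cinner x (T (star a) y)" .
    show "T 1 x = x" by (simp add: T_def \<pi>1 \<sigma>1 Ws_L sum1)
  next
    fix a
    show "\<exists>B. \<forall>x\<in>UNIV. norm (T a x) \<le> B * norm x"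
      using bounded_linear.bounded[OF T_bl, of a] by (metis mult.commute)
  qed simp_all
  then have "\<rho> \<in> Rep" by (simp add: Rep_def \<rho>)
  moreover have "\<rho> \<notin> WM"
  proof
    assume "\<rho> \<in> WM"
    then have wm: "M = {0}" if "subrep_space UNIV T M" "cfinite_dim M" for M
      using that by (auto simp: WM_def weakly_mixing_on_def \<rho>)
    have fd: "cfinite_dim (W ` L)"
    proof (rule cfinite_dim_image[of "{..<n}" L "\<lambda>i z. cinner z (h i)"])
      show "W z = 0" if "\<And>i. i \<in> {..<n} \<Longrightarrow> cinner z (h i) = 0" for z
        using that by (simp add: W_def)
    qed (simp_all add: \<sigma>.subspace hilbert.add_left hilbert.scale_left add W_scale)
    have "T a (W z) = W (\<sigma> a z)" if "z \<in> L" for a z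
      using that by (simp add: T_def VsW WsW zero blinfun.zero_right)
    then have "subrep_space UNIV T (W ` L)"
      unfolding subrep_space_def
      using cfinite_dim_closed[OF fd] cfinite_dim_imp_csubspace[OF fd] \<sigma>.into by auto
    then have "W ` L = {0}" using fd by (rule wm)
    then have "W z = 0" if "z \<in> L" for z using that by auto
    then have "z = 0" if "z \<in> L" for z using WsW[OF that] that zero(4) by metis
    then show False using \<sigma>(3) \<sigma>.subspace_rules(1) by blast
  qed
  moreover have "\<rho> a x = \<pi> a x" if "(a, x) \<in> D" for a x
  proof -
    have G: "x \<in> G" "\<pi> a x \<in> G" using that by (force simp: G_def)+
    have "Ws x = 0" using eG[OF G(1)] by (simp add: Ws_def)
    then show ?thesis
      using V_id[OF eG[OF G(1)]] V_id[OF eG[OF G(2)]]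
      by (simp add: \<rho> T_def zero \<sigma>.zero_vec)
  qed
  ultimately show ?thesis by (rule that)
qed

section \<open>The topology of the space of representations\<close>

lemma openin_product_topology_finite:
  assumes "openin (product_topology X UNIV) T" "p \<in> T"
  obtains I U where "finite I" "\<And>i. openin (X i) (U i)" "\<And>i. p i \<in> U i"
    "{p'. (\<forall>i. p' i \<in> topspace (X i)) \<and> (\<forall>i\<in>I. p' i \<in> U i)} \<subseteq> T"
proof -
  obtain U where U: "finite {i \<in> UNIV. U i \<noteq> topspace (X i)}" "\<forall>i\<in>UNIV. openin (X i) (U i)"
    "p \<in> Pi\<^sub>E UNIV U" "Pi\<^sub>E UNIV U \<subseteq> T"
    using assms unfolding openin_product_topology_alt by blast
  show ?thesis
  proof (rule that[OF U(1), of U])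
    show "{p'. (\<forall>i. p' i \<in> topspace (X i)) \<and> (\<forall>i\<in>{i \<in> UNIV. U i \<noteq> topspace (X i)}. p' i \<in> U i)} \<subseteq> T"
    proof clarify
      fix p' assume *: "\<forall>i. p' i \<in> topspace (X i)" "\<forall>i\<in>{i \<in> UNIV. U i \<noteq> topspace (X i)}. p' i \<in> U i"
      have "p' i \<in> U i" for i using * by (cases "U i = topspace (X i)") auto
      then show "p' \<in> T" using U(4) by auto
    qed
  qed (use U in auto)
qed

text \<open>The perturbed representation agrees with \<open>\<pi>\<close> exactly on finitely many vectors. Neighbourhoods are
  therefore described here by exact agreement, which is stronger than closeness on a finite set of
  vectors.\<close>

lemma strong_operator_neighbourhood:
  assumes "openin strong_operator_topology U" "T \<in> U"
  obtains D where "finite D" "{T'. \<forall>x\<in>D. blinfun_apply T' x = T x} \<subseteq> U"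
proof -
  obtain O' where O': "open O'" "U = blinfun_apply -` O'"
    using assms(1) unfolding strong_operator_topology_def openin_pullback_topology by auto
  then have "openin (product_topology (\<lambda>_. euclidean) UNIV) O'" "blinfun_apply T \<in> O'"
    using assms(2) by (auto simp: euclidean_product_topology)
  then obtain D X where "finite D" and X: "\<And>x. blinfun_apply T x \<in> X x"
    "{g. (\<forall>x. g x \<in> topspace euclidean) \<and> (\<forall>x\<in>D. g x \<in> X x)} \<subseteq> O'"
    by (rule openin_product_topology_finite) (rule that)
  have "{T'. \<forall>x\<in>D. blinfun_apply T' x = T x} \<subseteq> U"
  proof clarify
    fix T' assume "\<forall>x\<in>D. blinfun_apply T' x = T x"
    then have "\<forall>x\<in>D. blinfun_apply T' x \<in> X x" using X(1) by simp
    then show "T' \<in> U" using X(2) O'(2) by auto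
  qed
  with \<open>finite D\<close> show ?thesis by (rule that)
qed

lemma Rep_neighbourhood:
  assumes "openin Rep_topology U" "\<pi> \<in> U"
  obtains D where "finite D" "{\<rho> \<in> Rep. \<forall>(a, x)\<in>D. blinfun_apply (\<rho> a) x = \<pi> a x} \<subseteq> U"
proof -
  obtain T where T: "openin (product_topology (\<lambda>_. strong_operator_topology) UNIV) T" "U = T \<inter> Rep"
    using assms(1) by (auto simp: Rep_topology_def openin_subtopology)
  then have "\<pi> \<in> T" using assms(2) by simp
  obtain I X where I: "finite I" "\<And>a. openin strong_operator_topology (X a)" "\<And>a. \<pi> a \<in> X a"
    and sub: "{\<rho>. (\<forall>a. \<rho> a \<in> topspace strong_operator_topology) \<and> (\<forall>a\<in>I. \<rho> a \<in> X a)} \<subseteq> T"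
    by (rule openin_product_topology_finite[OF T(1) \<open>\<pi> \<in> T\<close>]) (rule that)
  have "\<forall>a. \<exists>D. finite D \<and> {T'. \<forall>x\<in>D. blinfun_apply T' x = \<pi> a x} \<subseteq> X a"
    by (rule allI, rule strong_operator_neighbourhood[OF I(2,3)]) blast
  then obtain D where "\<forall>a. finite (D a) \<and> {T'. \<forall>x\<in>D a. blinfun_apply T' x = \<pi> a x} \<subseteq> X a"
    by (rule choice[THEN exE])
  then have D: "\<And>a. finite (D a)" "\<And>a. {T'. \<forall>x\<in>D a. blinfun_apply T' x = \<pi> a x} \<subseteq> X a" by simp_all
  show ?thesis
  proof (rule that[of "Sigma I D"])
    show "{\<rho> \<in> Rep. \<forall>(a, x)\<in>Sigma I D. blinfun_apply (\<rho> a) x = \<pi> a x} \<subseteq> U"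
    proof clarify
      fix \<rho> assume \<rho>: "\<rho> \<in> Rep" "\<forall>(a, x)\<in>Sigma I D. blinfun_apply (\<rho> a) x = \<pi> a x"
      have "\<rho> a \<in> X a" if "a \<in> I" for a using \<rho>(2) D(2)[of a] that by auto
      then have "\<rho> \<in> T" using sub by (auto simp: strong_operator_topology_topspace)
      then show "\<rho> \<in> U" using T(2) \<rho>(1) by simp
    qed
  qed (use I D in auto)
qed

lemma topspace_Rep_topology: "topspace Rep_topology = Rep"
  by (simp add: Rep_topology_def strong_operator_topology_topspace)

lemma openin_Rep_nonzero: "openin Rep_topology {\<rho> \<in> Rep. blinfun_apply (\<rho> a) x \<noteq> 0}"
proof -
  have "continuous_map Rep_topology strong_operator_topology (\<lambda>\<rho>. \<rho> a)"
    unfolding Rep_topology_def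
    by (rule continuous_map_from_subtopology[OF continuous_map_product_projection]) simp
  from continuous_map_compose[OF this strong_operator_topology_continuous_evaluation[of x]]
  have "continuous_map Rep_topology euclidean (\<lambda>\<rho>. blinfun_apply (\<rho> a) x)"
    by (simp add: o_def)
  from openin_continuous_map_preimage[OF this, of "- {0}"] show ?thesis
    by (simp add: topspace_Rep_topology open_Compl)
qed

section \<open>Weakly mixing representations\<close>

lemma not_WM_iff:
  assumes "\<pi> \<in> Rep"
  shows "\<pi> \<notin> WM \<longleftrightarrow> (\<exists>M. subrep_space UNIV (\<lambda>a. blinfun_apply (\<pi> a)) M \<and> cfinite_dim M \<and> M \<noteq> {0})"
  using assms by (auto simp: WM_def weakly_mixing_on_def Rep_def)

lemma unital_representation_on_subrep:
  assumes "unital_representation_on K \<pi>" "subrep_space K \<pi> M"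
  shows "unital_representation_on M \<pi>"
proof -
  have M: "M \<subseteq> K" "closed M" "csubspace M" "\<And>a x. x \<in> M \<Longrightarrow> \<pi> a x \<in> M"
    using assms(2) by (auto simp: subrep_space_def)
  have "bounded_clinear_on M (\<pi> a)" for a
    using assms(1) M(1,4) unfolding unital_representation_on_def representation_on_def bounded_clinear_on_def
    by (meson subsetD)
  then show ?thesis
    using assms(1) M unfolding unital_representation_on_def representation_on_def by (meson subsetD)
qed

lemma class_kernel_csubspace:
  fixes d :: "'a::unital_cstar_algebra rep set"
  assumes d: "d \<in> spectrum" shows "csubspace (class_kernel d)"
proof -
  obtain L \<tau> where "(L, \<tau>) \<in> d" and L: "irreducible_on L \<tau>" "class_kernel d = {a. \<forall>x\<in>L. \<tau> a x = 0}"
    by (rule spectrumE[OF d]) (rule that)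
  interpret \<tau>: representation L \<tau> using L(1) by unfold_locales (simp add: irreducible_on_def)
  have "\<tau> 0 x = 0" if "x \<in> L" for x using \<tau>.scale[OF that, of 0 0] by simp
  then show ?thesis
    unfolding L(2) by (intro complex_vector.subspaceI) (simp_all add: \<tau>.add \<tau>.scale)
qed

text \<open>\<open>J\<close> is the intersection of the kernels of all classes other than \<open>c\<close>. That it is not contained in
  the kernel of \<open>c\<close> says precisely that \<open>c\<close> is not in the closure of the other classes.\<close>

lemma isolated_point_ideal:
  fixes c :: "'a::unital_cstar_algebra rep set"
  assumes c: "c \<in> spectrum" and open_c: "openin spectrum_topology {c}"
  obtains J where "csubspace J" "\<And>a b. a \<in> J \<Longrightarrow> b * a \<in> J" "\<not> J \<subseteq> class_kernel c"
    "\<And>d. d \<in> spectrum \<Longrightarrow> J \<inter> class_kernel c \<subseteq> class_kernel d"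
proof -
  define J where "J = (\<Inter>d\<in>spectrum - {c}. class_kernel d)"
  have "hull_kernel (spectrum - {c}) = spectrum - {c}"
    using open_c by (simp add: openin_spectrum_topology)
  then have "c \<notin> hull_kernel (spectrum - {c})" by blast
  then have "\<not> J \<subseteq> class_kernel c" using c by (simp add: hull_kernel_def J_def)
  moreover have "csubspace J"
    unfolding J_def by (rule complex_vector.subspace_Inter) (auto intro: class_kernel_csubspace)
  moreover have "b * a \<in> J" if "a \<in> J" for a b
    using that by (auto simp: J_def intro: class_kernel_ideal(2))
  moreover have "J \<inter> class_kernel c \<subseteq> class_kernel d" if "d \<in> spectrum" for d
    using that by (cases "d = c") (auto simp: J_def)
  ultimately show ?thesis by (intro that)
qed

text \<open>The class comes from separation at the unit, and has finite dimension because its kernel contains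
  that of \<open>\<pi>\<close>.\<close>

lemma finite_dim_rep_spectrum_fin:
  fixes \<pi> :: "'a::unital_cstar_algebra \<Rightarrow> 'h::complex_hilbert_space \<Rightarrow> 'h"
  assumes sep: "separable_space (euclidean :: 'a topology)"
    and \<pi>: "unital_representation_on M \<pi>" and M: "cfinite_dim M" "M \<noteq> {0}"
  obtains c where "c \<in> spectrum_fin" "{a. \<forall>x\<in>M. \<pi> a x = 0} \<subseteq> class_kernel c"
proof -
  obtain x where x: "x \<in> M" "x \<noteq> 0"
    using M complex_vector.subspace_0[OF cfinite_dim_imp_csubspace[OF M(1)]] by blast
  then have "\<pi> 1 x \<noteq> 0" using \<pi> by (simp add: unital_representation_on_def)
  then obtain c where c: "c \<in> spectrum" "{a. \<forall>x\<in>M. \<pi> a x = 0} \<subseteq> class_kernel c"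
    using separating_spectrum[OF sep \<pi> x(1), of 1] by blast
  obtain K \<sigma> where K: "(K, \<sigma>) \<in> c" "irreducible_on K \<sigma>" "class_kernel c = {a. \<forall>x\<in>K. \<sigma> a x = 0}"
    by (rule spectrumE[OF c(1)])
  have "cfinite_dim K"
    by (rule irreducible_cfinite_dim[OF _ M(1) K(2)])
      (use \<pi> c(2) K(3) in \<open>simp_all add: unital_representation_on_def\<close>)
  then have "c \<in> spectrum_fin" using c(1) K(1) by (auto simp: spectrum_fin_def)
  then show ?thesis using c(2) by (rule that)
qed

text \<open>The subspace \<open>\<rho>(J) x\<close> is finite-dimensional: elements of \<open>J\<close> in the kernel of \<open>c\<close> lie in the kernel
  of every class, hence in that of \<open>\<rho>\<close>, because the irreducible representations separate points.\<close>

lemma nonzero_on_ideal_not_WM: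
  fixes \<rho> :: "'a::unital_cstar_algebra \<Rightarrow> 'h::complex_hilbert_space \<Rightarrow>\<^sub>L 'h"
  assumes sep: "separable_space (euclidean :: 'a topology)"
    and c: "c \<in> spectrum_fin" and J: "csubspace J" "\<And>a b. a \<in> J \<Longrightarrow> b * a \<in> J"
      "\<And>d. d \<in> spectrum \<Longrightarrow> J \<inter> class_kernel c \<subseteq> class_kernel d"
    and \<rho>: "\<rho> \<in> Rep" and a: "a \<in> J" "\<rho> a x \<noteq> 0"
  shows "\<rho> \<notin> WM"
proof -
  obtain K \<sigma> where K: "c \<in> spectrum" "(K, \<sigma>) \<in> c" "cfinite_dim K"
    using c by (auto simp: spectrum_fin_def)
  then have K_irr: "irreducible_on K \<sigma>"
    using in_quotient_imp_subset[OF equiv_irrep_equiv, of c] by (auto simp: spectrum_def irreps_def)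
  have \<rho>_unital: "unital_representation_on UNIV (\<lambda>a. blinfun_apply (\<rho> a))"
    using \<rho> by (simp add: Rep_def)
  interpret \<rho>: representation UNIV "\<lambda>a. blinfun_apply (\<rho> a)"
    using \<rho>_unital by unfold_locales (simp add: unital_representation_on_def)
  let ?Y = "(\<lambda>g. blinfun_apply (\<rho> g) x) ` J"
  have fd: "cfinite_dim ?Y"
  proof (rule cfinite_dim_image_of_kernel[OF _ K(3) J(1)])
    show "representation_on K \<sigma>" using K_irr by (simp add: irreducible_on_def)
    fix g assume "g \<in> J" "\<And>x. x \<in> K \<Longrightarrow> \<sigma> g x = 0"
    then have "g \<in> J \<inter> class_kernel c"
      using class_kernel_eq[OF K(1,2)] by (simp add: rep_kernel_def)
    then have "g \<in> class_kernel d" if "d \<in> spectrum" for d using J(3)[OF that] by blast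
    then show "blinfun_apply (\<rho> g) x = 0"
      using separating_spectrum[OF sep \<rho>_unital UNIV_I, of g x] by blast
  qed (simp_all add: \<rho>.add \<rho>.scale)
  have "subrep_space UNIV (\<lambda>a. blinfun_apply (\<rho> a)) ?Y"
    unfolding subrep_space_def
    using cfinite_dim_closed[OF fd] cfinite_dim_imp_csubspace[OF fd] J(2)
    by (auto simp flip: \<rho>.mult)
  moreover have "?Y \<noteq> {0}" using a by blast
  ultimately show ?thesis using not_WM_iff[OF \<rho>] fd by blast
qed

theorem closedin_WM:
  assumes sep: "separable_space (euclidean :: 'a::unital_cstar_algebra topology)"
    and isolated: "\<forall>c \<in> (spectrum_fin :: 'a rep set set). openin spectrum_topology {c}"
  shows "closedin Rep_topology (WM :: ('a \<Rightarrow> 'h::complex_hilbert_space \<Rightarrow>\<^sub>L 'h) set)"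
proof -
  let ?WM = "WM :: ('a \<Rightarrow> 'h \<Rightarrow>\<^sub>L 'h) set"
  have "\<exists>U. openin Rep_topology U \<and> \<pi> \<in> U \<and> U \<subseteq> Rep - ?WM" if \<pi>: "\<pi> \<in> Rep - ?WM" for \<pi>
  proof -
    have unital: "unital_representation_on UNIV (\<lambda>a. blinfun_apply (\<pi> a))"
      using \<pi> by (simp add: Rep_def)
    obtain M where M: "subrep_space UNIV (\<lambda>a. blinfun_apply (\<pi> a)) M" "cfinite_dim M" "M \<noteq> {0}"
      using \<pi> not_WM_iff[of \<pi>] by auto
    obtain c :: "'a rep set" where c: "c \<in> spectrum_fin"
      "{a. \<forall>x\<in>M. blinfun_apply (\<pi> a) x = 0} \<subseteq> class_kernel c"
      by (rule finite_dim_rep_spectrum_fin[OF sep unital_representation_on_subrep[OF unital M(1)] M(2,3)])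
    have "c \<in> spectrum" "openin spectrum_topology {c}"
      using c(1) isolated by (auto simp: spectrum_fin_def)
    then obtain J where J: "csubspace J" "\<And>a b. a \<in> J \<Longrightarrow> b * a \<in> J" "\<not> J \<subseteq> class_kernel c"
      "\<And>d. d \<in> spectrum \<Longrightarrow> J \<inter> class_kernel c \<subseteq> class_kernel d"
      by (rule isolated_point_ideal) (rule that)
    then obtain a x where a: "a \<in> J" "blinfun_apply (\<pi> a) x \<noteq> 0" using c(2) by blast
    show ?thesis
    proof (intro exI conjI)
      show "openin Rep_topology {\<rho> \<in> Rep. blinfun_apply (\<rho> a) x \<noteq> 0}" by (rule openin_Rep_nonzero)
      show "\<pi> \<in> {\<rho> \<in> Rep. blinfun_apply (\<rho> a) x \<noteq> 0}" using \<pi> a by simp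
      show "{\<rho> \<in> Rep. blinfun_apply (\<rho> a) x \<noteq> 0} \<subseteq> Rep - ?WM"
        using nonzero_on_ideal_not_WM[OF sep c(1) J(1,2,4) _ a(1)] by auto
    qed
  qed
  then have "openin Rep_topology (Rep - ?WM)" by (subst openin_subopen) blast
  moreover have "?WM \<subseteq> Rep" by (auto simp: WM_def)
  ultimately show ?thesis by (simp add: closedin_def topspace_Rep_topology)
qed

theorem interior_of_WM:
  assumes "(spectrum_fin :: 'a::unital_cstar_algebra rep set set) \<noteq> {}"
    and inf: "\<not> cfinite_dim (UNIV :: 'h::complex_hilbert_space set)"
  shows "Rep_topology interior_of (WM :: ('a \<Rightarrow> 'h \<Rightarrow>\<^sub>L 'h) set) = {}"
proof (rule ccontr)
  let ?WM = "WM :: ('a \<Rightarrow> 'h \<Rightarrow>\<^sub>L 'h) set"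
  assume "\<not> ?thesis"
  then obtain \<pi> where \<pi>: "\<pi> \<in> Rep_topology interior_of ?WM" by blast
  obtain D where D: "finite D" "{\<rho> \<in> Rep. \<forall>(a, x)\<in>D. blinfun_apply (\<rho> a) x = \<pi> a x}
      \<subseteq> Rep_topology interior_of ?WM"
    by (rule Rep_neighbourhood[OF openin_interior_of \<pi>]) (rule that)
  obtain c :: "'a rep set" where "c \<in> spectrum_fin" using assms(1) by blast
  then obtain K \<sigma> where c: "c \<in> spectrum" "(K, \<sigma>) \<in> c" "cfinite_dim K" by (auto simp: spectrum_fin_def)
  have irr: "irreducible_on K \<sigma>"
    using c in_quotient_imp_subset[OF equiv_irrep_equiv, of c] by (auto simp: spectrum_def irreps_def)
  then have unital: "unital_representation_on K \<sigma>"
    using irreducible_unital[OF irr] by (simp add: unital_representation_on_def irreducible_on_def)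
  have K: "K \<noteq> {0}" using irreducible_onD(9,10)[OF irr] by auto
  have "\<pi> \<in> Rep"
    using \<pi> interior_of_subset_topspace[of Rep_topology ?WM] by (auto simp: topspace_Rep_topology)
  then obtain \<rho> where \<rho>: "\<rho> \<in> Rep" "\<rho> \<notin> ?WM" "\<And>a x. (a, x) \<in> D \<Longrightarrow> \<rho> a x = \<pi> a x"
    by (rule insert_finite_dim_subrep[OF inf _ unital c(3) K D(1)]) (rule that)
  then have "\<rho> \<in> {\<rho> \<in> Rep. \<forall>(a, x)\<in>D. blinfun_apply (\<rho> a) x = \<pi> a x}" by auto
  then have "\<rho> \<in> ?WM" using D(2) interior_of_subset[of Rep_topology ?WM] by (meson subsetD)
  then show False using \<rho>(2) by blast
qed

theorem theorem3p8:
  assumes "separable_space (euclidean :: 'a::unital_cstar_algebra topology)"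
    and "(spectrum_fin :: 'a rep set set) \<noteq> {}"
    and "\<forall>c \<in> (spectrum_fin :: 'a rep set set). openin spectrum_topology {c}"
    and "separable_space (euclidean :: 'h::complex_hilbert_space topology)"
    and "\<not> cfinite_dim (UNIV :: 'h set)"
  shows "closedin Rep_topology (WM :: ('a \<Rightarrow> 'h \<Rightarrow>\<^sub>L 'h) set)
    \<and> nowhere_dense_in Rep_topology (WM :: ('a \<Rightarrow> 'h \<Rightarrow>\<^sub>L 'h) set)"
proof -
  have "closedin Rep_topology (WM :: ('a \<Rightarrow> 'h \<Rightarrow>\<^sub>L 'h) set)"
    by (rule closedin_WM[OF assms(1,3)])
  then show ?thesis
    using interior_of_WM[OF assms(2,5)]
    by (simp add: nowhere_dense_in_def closure_of_closedin closedin_subset)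
qed

end
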